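(* Let $T$ be a locally finite tree and $M=Emb(T)$. (1) If $|\mathcal{D}(M)|=0$ or $|\mathcal{D}(M)|=2$, then $Sib(T)=1$. (2) If $|\mathcal{D}(M)|=1$, then $Sib(T)=1$ or $Sib(T)=\infty$. (3) If $|\mathcal{D}(M)|$ is infinite and either $T$ has a parabolic embedding or some non-regular end of $T$ is preserved forward or backward by some non-elliptic embedding of $T$, then $Sib(T)=\infty$.
   Context: Trees are connected acyclic simple graphs; an embedding of $T$ is an injective adjacency-preserving map from $T$ to itself; $Emb(T)$ is the monoid of embeddings. Two trees are siblings if each embeds into the other; $Sib(T)$ is the number of isomorphism classes of siblings of $T$. Two rays are equivalent if their intersection is a ray; equivalence classes are ends. An embedding fixes an end if it maps rays of that end to rays of that end. An embedding is elliptic if it maps some non-empty finite subtree onto itself; parabolic if not elliptic and it fixes exactly one end; hyperbolic if not elliptic and it fixes exactly two ends. A non-elliptic $g$ satisfies $g(R)\subsetneq R$ for some ray $R$; the end containing such $R$ is the direction $g^+$. $\mathcal{D}(M)$ is the set of directions $g^+$ of non-elliptic $g\in M$. An embedding $f$ preserves an end $\eta$ forward (resp. backward) if $f(R)\subseteq R$ (resp. $R\subseteq f(R)$) for some ray $R\in\eta$. For a ray $R$ and $r\in R$, $T^R_r$ is the maximal subtree containing $r$ edge-disjoint from $R$; $R$ is regular if only finitely many pairwise non-equimorphic trees occur among the $T^R_r$, non-regular otherwise; an end is non-regular if it contains a non-regular ray. *)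

theory Defs
  imports Main "HOL-Library.FuncSet" "HOL-Library.Extended_Nat"
begin

section \<open>Simple graphs and trees\<close>

text \<open>
  Graphs may be infinite. The symmetric digraphs of the AFP entry Graph_Theory are not used: there
  the closed walk a, b, a counts as a cycle, so its notion of a tree is not the undirected one.
\<close>

datatype 'a ugraph = Graph (verts: "'a set") (edges: "'a set set")

definition simple_graph :: "'a ugraph \<Rightarrow> bool" where
  "simple_graph G \<longleftrightarrow> (\<forall>e\<in>edges G. e \<subseteq> verts G \<and> card e = 2)"

definition adj_rel :: "'a ugraph \<Rightarrow> ('a \<times> 'a) set" where
  "adj_rel G = {(u, v). {u, v} \<in> edges G}"

definition graph_connected :: "'a ugraph \<Rightarrow> bool" where
  "graph_connected G \<longleftrightarrow> (\<forall>u\<in>verts G. \<forall>v\<in>verts G. (u, v) \<in> (adj_rel G)\<^sup>*)"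

definition is_cycle :: "'a ugraph \<Rightarrow> 'a list \<Rightarrow> bool" where
  "is_cycle G p \<longleftrightarrow> 3 \<le> length p \<and> distinct p \<and>
     (\<forall>i<length p. {p ! i, p ! (Suc i mod length p)} \<in> edges G)"

text \<open>Trees are non-empty.\<close>

definition is_tree :: "'a ugraph \<Rightarrow> bool" where
  "is_tree G \<longleftrightarrow> simple_graph G \<and> verts G \<noteq> {} \<and> graph_connected G \<and> (\<nexists>p. is_cycle G p)"

definition locally_finite :: "'a ugraph \<Rightarrow> bool" where
  "locally_finite G \<longleftrightarrow> (\<forall>v\<in>verts G. finite {u. {v, u} \<in> edges G})"

definition subgraph :: "'a ugraph \<Rightarrow> 'a ugraph \<Rightarrow> bool" where
  "subgraph H G \<longleftrightarrow> verts H \<subseteq> verts G \<and> edges H \<subseteq> edges G"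

definition strict_subgraph :: "'a ugraph \<Rightarrow> 'a ugraph \<Rightarrow> bool" where
  "strict_subgraph H G \<longleftrightarrow> subgraph H G \<and> H \<noteq> G"

definition subtree :: "'a ugraph \<Rightarrow> 'a ugraph \<Rightarrow> bool" where
  "subtree S T \<longleftrightarrow> is_tree S \<and> subgraph S T"

definition inter_graph :: "'a ugraph \<Rightarrow> 'a ugraph \<Rightarrow> 'a ugraph" where
  "inter_graph G H = Graph (verts G \<inter> verts H) (edges G \<inter> edges H)"

definition image_graph :: "('a \<Rightarrow> 'b) \<Rightarrow> 'a ugraph \<Rightarrow> 'b ugraph" where
  "image_graph f G = Graph (f ` verts G) ((`) f ` edges G)"


section \<open>Embeddings and siblings\<close>

definition embedding :: "'a ugraph \<Rightarrow> 'b ugraph \<Rightarrow> ('a \<Rightarrow> 'b) \<Rightarrow> bool" where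
  "embedding G H f \<longleftrightarrow> f \<in> verts G \<rightarrow> verts H \<and> inj_on f (verts G) \<and>
     (\<forall>u\<in>verts G. \<forall>v\<in>verts G. {u, v} \<in> edges G \<longrightarrow> {f u, f v} \<in> edges H)"

text \<open>Extensionality makes a map on the vertex set correspond to exactly one HOL function.\<close>

definition Emb :: "'a ugraph \<Rightarrow> ('a \<Rightarrow> 'a) set" where
  "Emb T = {f \<in> extensional (verts T). embedding T T f}"

definition siblings :: "'a ugraph \<Rightarrow> 'b ugraph \<Rightarrow> bool" where
  "siblings S T \<longleftrightarrow> is_tree S \<and> is_tree T \<and> (\<exists>f. embedding S T f) \<and> (\<exists>g. embedding T S g)"

definition isomorphic :: "'a ugraph \<Rightarrow> 'b ugraph \<Rightarrow> bool" where
  "isomorphic G H \<longleftrightarrow> (\<exists>f. bij_betw f (verts G) (verts H) \<and>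
     (\<forall>u\<in>verts G. \<forall>v\<in>verts G. {u, v} \<in> edges G \<longleftrightarrow> {f u, f v} \<in> edges H))"

text \<open>
  Only siblings whose vertices come from the vertex type of the given tree are collected. This loses
  no isomorphism class: a sibling on any type embeds into the tree and is isomorphic to its image.
\<close>

definition sibling_classes :: "'a ugraph \<Rightarrow> 'a ugraph set set" where
  "sibling_classes T = {S. siblings S T} // {(S, S'). isomorphic S S'}"

definition Sib :: "'a ugraph \<Rightarrow> enat" where
  "Sib T = (if finite (sibling_classes T) then enat (card (sibling_classes T)) else \<infinity>)"


section \<open>Rays and ends\<close>

text \<open>Rays are subgraphs, not parametrised paths.\<close>

definition is_ray :: "'a ugraph \<Rightarrow> bool" where
  "is_ray R \<longleftrightarrow> (\<exists>r :: nat \<Rightarrow> 'a. inj r \<and> R = Graph (range r) (range (\<lambda>n. {r n, r (Suc n)})))"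

definition rays :: "'a ugraph \<Rightarrow> 'a ugraph set" where
  "rays T = {R. is_ray R \<and> subgraph R T}"

definition ray_equiv :: "'a ugraph \<Rightarrow> ('a ugraph \<times> 'a ugraph) set" where
  "ray_equiv T = {(R, R'). R \<in> rays T \<and> R' \<in> rays T \<and> is_ray (inter_graph R R')}"

definition Ends :: "'a ugraph \<Rightarrow> 'a ugraph set set" where
  "Ends T = rays T // ray_equiv T"


section \<open>Types of embeddings and their directions\<close>

definition fixes_end :: "('a \<Rightarrow> 'a) \<Rightarrow> 'a ugraph set \<Rightarrow> bool" where
  "fixes_end f \<eta> \<longleftrightarrow> (\<forall>R\<in>\<eta>. image_graph f R \<in> \<eta>)"

definition elliptic :: "'a ugraph \<Rightarrow> ('a \<Rightarrow> 'a) \<Rightarrow> bool" where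
  "elliptic T f \<longleftrightarrow> (\<exists>S. subtree S T \<and> finite (verts S) \<and> image_graph f S = S)"

definition parabolic :: "'a ugraph \<Rightarrow> ('a \<Rightarrow> 'a) \<Rightarrow> bool" where
  "parabolic T f \<longleftrightarrow> \<not> elliptic T f \<and> (\<exists>!\<eta>. \<eta> \<in> Ends T \<and> fixes_end f \<eta>)"

definition direction :: "'a ugraph \<Rightarrow> ('a \<Rightarrow> 'a) \<Rightarrow> 'a ugraph set" where
  "direction T g = (THE \<eta>. \<eta> \<in> Ends T \<and> (\<exists>R\<in>\<eta>. strict_subgraph (image_graph g R) R))"

definition directions :: "'a ugraph \<Rightarrow> ('a \<Rightarrow> 'a) set \<Rightarrow> 'a ugraph set set" where
  "directions T M = direction T ` {g \<in> M. \<not> elliptic T g}"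

definition preserves_forward :: "('a \<Rightarrow> 'a) \<Rightarrow> 'a ugraph set \<Rightarrow> bool" where
  "preserves_forward f \<eta> \<longleftrightarrow> (\<exists>R\<in>\<eta>. subgraph (image_graph f R) R)"

definition preserves_backward :: "('a \<Rightarrow> 'a) \<Rightarrow> 'a ugraph set \<Rightarrow> bool" where
  "preserves_backward f \<eta> \<longleftrightarrow> (\<exists>R\<in>\<eta>. subgraph R (image_graph f R))"


section \<open>Regular rays and ends\<close>

definition hanging_at :: "'a ugraph \<Rightarrow> 'a ugraph \<Rightarrow> 'a \<Rightarrow> 'a ugraph \<Rightarrow> bool" where
  "hanging_at T R r S \<longleftrightarrow> subtree S T \<and> r \<in> verts S \<and> edges S \<inter> edges R = {}"

definition hanging_tree :: "'a ugraph \<Rightarrow> 'a ugraph \<Rightarrow> 'a \<Rightarrow> 'a ugraph" where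
  "hanging_tree T R r =
     (THE S. hanging_at T R r S \<and> (\<forall>S'. hanging_at T R r S' \<and> subgraph S S' \<longrightarrow> S' = S))"

text \<open>Equimorphic means mutually embeddable; the embeddings need not respect the roots on the ray.\<close>

definition regular_ray :: "'a ugraph \<Rightarrow> 'a ugraph \<Rightarrow> bool" where
  "regular_ray T R \<longleftrightarrow> finite (hanging_tree T R ` verts R // {(S, S'). siblings S S'})"

definition nonregular_end :: "'a ugraph \<Rightarrow> 'a ugraph set \<Rightarrow> bool" where
  "nonregular_end T \<eta> \<longleftrightarrow> (\<exists>R\<in>\<eta>. \<not> regular_ray T R)"

end

theory Submission
  imports Defs "HOL-Library.Countable_Set"
begin

text \<open>
  An elliptic embedding of a locally finite tree is surjective, and a non-elliptic one translates a
  ray towards its direction. Orienting the tree towards an end \<open>\<eta>\<close> turns the embeddings fixing \<open>\<eta>\<close>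
  into the maps that commute with the parent function, up to a shift of levels.

  With no direction or two directions all embeddings are surjective: for two, a composition argument
  shows that one of two embeddings \<open>g\<close>, \<open>h\<close> with different directions fixes the direction of the
  other, and then a product of powers of \<open>g\<close> and \<open>h\<close> has a fixed vertex. With one direction \<open>\<eta>\<close>,
  every embedding fixes \<open>\<eta>\<close> and some \<open>g\<close> is not surjective. If \<open>T\<close> is not a ray, adding \<open>m\<close>
  vertices to the image of \<open>g\<close> (when its complement is infinite) or deleting a leaf at varying
  levels (when it is finite) produces infinitely many siblings, told apart by counting vertices
  below \<open>\<eta>\<close>.

  With infinitely many directions, it suffices to find a subtree \<open>Y\<close> that contains a copy of \<open>T\<close> and
  has infinitely many boundary vertices: subsets of these give uncountably many rooted trees with
  distinct sphere sizes, whereas each unrooted tree has only countably many roots. A parabolic \<open>f\<close>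
  provides \<open>Y\<close> as the image of a power of \<open>f\<close> together with a ray of another direction, and a
  non-elliptic \<open>f\<close> preserving a non-regular end provides it as the image of \<open>f\<close>, for otherwise \<open>f\<close>
  would eventually map hanging trees isomorphically onto hanging trees.
\<close>

section \<open>Non-backtracking walks\<close>

text \<open>What makes siblings hard to tell apart is that an isomorphism between two of them is an
  unknown map. With one direction it can be controlled: preceded by an embedding of \<open>T\<close>
  into the first sibling it becomes an embedding of \<open>T\<close>, so it respects the parent
  function and acts on a tail of \<open>r\<close> as a shift of indices. Vertices are then counted
  below \<open>r i\<close> down to a finite depth \<open>N\<close>, because a full descendant set
  may be infinite. For the siblings constructed, a non-zero shift by \<open>d\<close> is excluded by
  comparison with \<open>g\<close>: \<open>k\<close> rounds of the shift and \<open>d\<close>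
  applications of \<open>g\<close> lead from \<open>r i\<close> to the same vertex, but with
  incompatible counts.

  With infinitely many directions an isomorphism need not respect any end, so such an invariant is
  missing and cardinality takes its place: local finiteness makes the vertex set countable and the
  spheres finite. All that is left is to find one copy of \<open>T\<close> with infinitely many
  neighbours outside, and this is the geometric content of both cases of (3).\<close>

definition nbwalk :: "'a ugraph \<Rightarrow> (nat \<Rightarrow> 'a) \<Rightarrow> nat \<Rightarrow> bool" where
  "nbwalk G p n \<longleftrightarrow> p 0 \<in> verts G \<and> (\<forall>i<n. {p i, p (Suc i)} \<in> edges G) \<and>
     (\<forall>i. Suc (Suc i) \<le> n \<longrightarrow> p i \<noteq> p (Suc (Suc i)))"

lemma tree_edge:
  assumes "is_tree G" "{u, v} \<in> edges G"
  shows "u \<noteq> v" "u \<in> verts G" "v \<in> verts G"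
proof -
  have "{u, v} \<subseteq> verts G" "card {u, v} = 2"
    using assms by (auto simp: is_tree_def simple_graph_def)
  then show "u \<noteq> v" "u \<in> verts G" "v \<in> verts G"
    by (auto simp: card_insert_if split: if_splits)
qed

lemma nbwalk_verts:
  assumes "is_tree G" "nbwalk G p n" "i \<le> n"
  shows "p i \<in> verts G"
proof (cases i)
  case 0
  then show ?thesis using assms by (simp add: nbwalk_def)
next
  case (Suc j)
  then have "{p j, p (Suc j)} \<in> edges G" using assms by (simp add: nbwalk_def)
  then show ?thesis using tree_edge(3)[OF assms(1)] Suc by blast
qed

lemma nbwalk_mono: "nbwalk G p n \<Longrightarrow> m \<le> n \<Longrightarrow> nbwalk G p m"
  by (auto simp: nbwalk_def)

lemma nbwalk_drop:
  assumes "is_tree G" "nbwalk G p n" "a + m \<le> n"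
  shows "nbwalk G (\<lambda>i. p (a + i)) m"
  using assms nbwalk_verts[of G p n a] by (auto simp: nbwalk_def)

text \<open>Acyclicity enters here. Adjacent vertices differ and there is no backtracking, so a
  closed stretch has length at least 3; by induction on this length its vertices are distinct, hence
  they form a cycle.\<close>

lemma nbwalk_inj_on:
  assumes t: "is_tree G" and w: "nbwalk G p n"
  shows "inj_on p {..n}"
proof -
  have "p i \<noteq> p (i + d)" if "d > 0" "i + d \<le> n" for i d
    using that
  proof (induction d arbitrary: i rule: less_induct)
    case (less d)
    show ?case
    proof
      assume eq: "p i = p (i + d)"
      have "{p i, p (Suc i)} \<in> edges G" using less.prems w by (simp add: nbwalk_def)
      then have "d \<noteq> 1" using tree_edge(1)[OF t, of "p i" "p (Suc i)"] eq by auto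
      moreover have "d \<noteq> 2"
        using less.prems w eq unfolding nbwalk_def
        by (metis add_2_eq_Suc')
      ultimately have d: "3 \<le> d" using less.prems(1) by linarith
      let ?c = "map (\<lambda>j. p (i + j)) [0..<d]"
      have "inj_on (\<lambda>j. p (i + j)) {0..<d}"
      proof (rule linorder_inj_onI')
        fix a b assume ab: "a \<in> {0..<d}" "b \<in> {0..<d}" "a < b"
        then show "p (i + a) \<noteq> p (i + b)"
          using less.IH[of "b - a" "i + a"] less.prems by auto
      qed
      then have "distinct ?c" by (simp add: distinct_map)
      moreover have "\<forall>j<d. {?c ! j, ?c ! (Suc j mod d)} \<in> edges G"
      proof (intro allI impI)
        fix j assume j: "j < d"
        have e: "{p (i + j), p (Suc (i + j))} \<in> edges G"
          using w j less.prems by (simp add: nbwalk_def)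
        show "{?c ! j, ?c ! (Suc j mod d)} \<in> edges G"
        proof (cases "Suc j = d")
          case True
          then have "p (Suc (i + j)) = p i" using eq by auto
          then show ?thesis using e True j by simp
        next
          case False
          then show ?thesis using e j by simp
        qed
      qed
      ultimately have "is_cycle G ?c" using d by (simp add: is_cycle_def)
      then show False using t by (auto simp: is_tree_def)
    qed
  qed
  then have *: "p i \<noteq> p j" if "i < j" "j \<le> n" for i j
    using that by (metis add_diff_inverse_nat less_imp_le_nat not_less zero_less_diff)
  show ?thesis by (rule linorder_inj_onI') (auto simp: *)
qed

text \<open>The reverse of \<open>p\<close> followed by \<open>q\<close>; the last hypothesis
  excludes backtracking at the junction.\<close>

lemma nbwalk_join:
  assumes p: "nbwalk G p n" and q: "nbwalk G q m" and t: "is_tree G"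
    and 0: "p 0 = q 0" and 1: "n > 0 \<Longrightarrow> m > 0 \<Longrightarrow> p 1 \<noteq> q 1"
  shows "nbwalk G (\<lambda>i. if i \<le> n then p (n - i) else q (i - n)) (n + m)" (is "nbwalk G ?r _")
  unfolding nbwalk_def
proof (intro conjI allI impI)
  show "?r 0 \<in> verts G" using nbwalk_verts[OF t p, of n] by simp
next
  fix i assume i: "i < n + m"
  show "{?r i, ?r (Suc i)} \<in> edges G"
  proof (cases "i < n")
    case True
    then have "{p (n - Suc i), p (Suc (n - Suc i))} \<in> edges G" using p by (simp add: nbwalk_def)
    then show ?thesis using True by (simp add: insert_commute Suc_diff_Suc)
  next
    case False
    then have "{q (i - n), q (Suc (i - n))} \<in> edges G" using q i by (simp add: nbwalk_def)
    then show ?thesis using False 0 by (cases "i = n") (auto simp: Suc_diff_le)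
  qed
next
  fix i assume i: "Suc (Suc i) \<le> n + m"
  consider "Suc (Suc i) \<le> n" | "Suc i = n" | "i \<ge> n" by linarith
  then show "?r i \<noteq> ?r (Suc (Suc i))"
  proof cases
    case 1
    then have "p (n - Suc (Suc i)) \<noteq> p (Suc (Suc (n - Suc (Suc i))))"
      using p by (simp add: nbwalk_def)
    moreover have "Suc (Suc (n - Suc (Suc i))) = n - i" using 1 by simp
    ultimately show ?thesis using 1 by auto
  next
    case 2
    then have "n - i = 1" "Suc (Suc i) - n = 1" "m > 0" using i by auto
    then show ?thesis using 1 2 by auto
  next
    case 3
    then have "q (i - n) \<noteq> q (Suc (Suc (i - n)))" using q i by (simp add: nbwalk_def)
    then show ?thesis using 3 0 by (cases "i = n") (auto simp: Suc_diff_le)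
  qed
qed

text \<open>Geodesics are unique: a common first edge is removed by induction, and if the first
  edges differ, the reverse of \<open>p\<close> joined to \<open>q\<close> is a closed walk without
  backtracking, contrary to injectivity.\<close>

lemma nbwalk_unique:
  assumes t: "is_tree G" and p: "nbwalk G p n" and q: "nbwalk G q m"
    and 0: "p 0 = q 0" and e: "p n = q m"
  shows "n = m \<and> (\<forall>i\<le>n. p i = q i)"
  using p q 0 e
proof (induction n arbitrary: m p q)
  case 0
  have "inj_on q {..m}" by (rule nbwalk_inj_on[OF t 0(2)])
  then show ?case using 0 by (auto simp: inj_on_def)
next
  case (Suc n)
  have ip: "inj_on p {..Suc n}" by (rule nbwalk_inj_on[OF t Suc.prems(1)])
  show ?case
  proof (cases m)
    case 0
    then have "p 0 = p (Suc n)" using Suc.prems by simp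
    then show ?thesis using ip by (auto simp: inj_on_def)
  next
    case m: (Suc m')
    show ?thesis
    proof (cases "p 1 = q 1")
      case True
      have "n = m' \<and> (\<forall>i\<le>n. p (1 + i) = q (1 + i))"
      proof (rule Suc.IH)
        show "nbwalk G (\<lambda>i. p (1 + i)) n" "nbwalk G (\<lambda>i. q (1 + i)) m'"
          using nbwalk_drop[OF t Suc.prems(1), of 1 n] nbwalk_drop[OF t Suc.prems(2), of 1 m'] m by auto
      qed (use True Suc.prems m in auto)
      then show ?thesis using Suc.prems(3) m
        by (metis One_nat_def Suc_le_mono not0_implies_Suc plus_1_eq_Suc)
    next
      case False
      let ?r = "\<lambda>i. if i \<le> Suc n then p (Suc n - i) else q (i - Suc n)"
      have "inj_on ?r {..Suc n + m}"
        by (rule nbwalk_inj_on[OF t nbwalk_join[OF Suc.prems(1,2) t Suc.prems(3)]])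
           (use False in auto)
      moreover have "?r 0 = ?r (Suc n + m)" using Suc.prems m by auto
      ultimately show ?thesis unfolding inj_on_def by (metis add_is_0 atMost_iff le0 nat.simps(3) order_refl)
    qed
  qed
qed

lemma nbwalk_snoc:
  assumes p: "nbwalk G p n" and e: "{p n, v} \<in> edges G" and b: "n > 0 \<Longrightarrow> v \<noteq> p (n - 1)"
  shows "nbwalk G (p(Suc n := v)) (Suc n)"
  unfolding nbwalk_def
proof (intro conjI allI impI)
  show "(p(Suc n := v)) 0 \<in> verts G" using p by (simp add: nbwalk_def)
next
  fix i assume "i < Suc n"
  then show "{(p(Suc n := v)) i, (p(Suc n := v)) (Suc i)} \<in> edges G"
    using p e by (cases "i = n") (auto simp: nbwalk_def)
next
  fix i assume "Suc (Suc i) \<le> Suc n"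
  then show "(p(Suc n := v)) i \<noteq> (p(Suc n := v)) (Suc (Suc i))"
    using p b by (cases "Suc i = n") (auto simp: nbwalk_def)
qed

lemma nbwalk_exists:
  assumes "(u, v) \<in> (adj_rel G)\<^sup>*" "u \<in> verts G"
  obtains p n where "nbwalk G p n" "p 0 = u" "p n = v"
  using assms
proof (induction arbitrary: thesis rule: rtrancl_induct)
  case base
  show ?case by (rule base(1)[of "\<lambda>_. u" 0]) (use base in \<open>auto simp: nbwalk_def\<close>)
next
  case (step y z)
  obtain p n where p: "nbwalk G p n" "p 0 = u" "p n = y" by (rule step.IH) (use step in auto)
  show ?case
  proof (cases "n > 0 \<and> z = p (n - 1)")
    \<comment> \<open>A step that would backtrack shortens the walk by one instead.\<close>
    case True
    then show ?thesis using step.prems(1)[of p "n - 1"] p nbwalk_mono[OF p(1), of "n - 1"] by auto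
  next
    case False
    have "nbwalk G (p(Suc n := z)) (Suc n)"
      by (rule nbwalk_snoc) (use p step False in \<open>auto simp: adj_rel_def\<close>)
    from step.prems(1)[OF this] show ?thesis using p by simp
  qed
qed

lemma tree_nbwalk:
  assumes "is_tree G" "u \<in> verts G" "v \<in> verts G"
  obtains p n where "nbwalk G p n" "p 0 = u" "p n = v"
  using nbwalk_exists[of u v G] assms unfolding is_tree_def graph_connected_def by metis

lemma nbwalk_embedding:
  assumes f: "embedding G H f" and t: "is_tree G" and p: "nbwalk G p n"
  shows "nbwalk H (f \<circ> p) n"
proof -
  have v: "p i \<in> verts G" if "i \<le> n" for i by (rule nbwalk_verts[OF t p that])
  show ?thesis
    unfolding nbwalk_def comp_def
  proof (intro conjI allI impI)
    show "f (p 0) \<in> verts H" using f v[of 0] by (auto simp: embedding_def)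
  next
    fix i assume "i < n"
    then have "{p i, p (Suc i)} \<in> edges G" "p i \<in> verts G" "p (Suc i) \<in> verts G"
      using p v by (auto simp: nbwalk_def)
    then show "{f (p i), f (p (Suc i))} \<in> edges H" using f by (simp add: embedding_def)
  next
    fix i assume "Suc (Suc i) \<le> n"
    then have "p i \<noteq> p (Suc (Suc i))" "p i \<in> verts G" "p (Suc (Suc i)) \<in> verts G"
      using p v by (auto simp: nbwalk_def)
    then show "f (p i) \<noteq> f (p (Suc (Suc i)))" using f by (auto simp: embedding_def inj_on_def)
  qed
qed

section \<open>Embeddings and induced subtrees\<close>

lemma embedding_verts: "embedding G H f \<Longrightarrow> v \<in> verts G \<Longrightarrow> f v \<in> verts H"
  by (auto simp: embedding_def)

lemma embedding_eq: "embedding G H f \<Longrightarrow> u \<in> verts G \<Longrightarrow> v \<in> verts G \<Longrightarrow> f u = f v \<longleftrightarrow> u = v"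
  by (auto simp: embedding_def inj_on_def)

lemma embedding_edge: "is_tree G \<Longrightarrow> embedding G H f \<Longrightarrow> {u, v} \<in> edges G \<Longrightarrow> {f u, f v} \<in> edges H"
  using tree_edge[of G u v] by (auto simp: embedding_def)

lemma embedding_comp:
  assumes "embedding G H f" "embedding H K g"
  shows "embedding G K (g \<circ> f)"
  using assms unfolding embedding_def
  by (auto simp: Pi_iff intro!: comp_inj_on inj_on_subset[of g "verts H"])

lemma embedding_id: "embedding G G id"
  by (auto simp: embedding_def)

lemma embedding_funpow: "embedding G G g \<Longrightarrow> embedding G G (g ^^ n)"
  by (induction n) (auto simp: embedding_id[unfolded id_def] id_def intro: embedding_comp[of G G _ G])

text \<open>The geodesic from \<open>u\<close> to \<open>v\<close> is mapped to the geodesic between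
  the images; if these are adjacent, its length is 1.\<close>

lemma embedding_edge_iff:
  assumes G: "is_tree G" and H: "is_tree H" and f: "embedding G H f"
    and u: "u \<in> verts G" "v \<in> verts G"
  shows "{f u, f v} \<in> edges H \<longleftrightarrow> {u, v} \<in> edges G"
proof
  assume e: "{f u, f v} \<in> edges H"
  obtain p n where p: "nbwalk G p n" "p 0 = u" "p n = v" by (rule tree_nbwalk[OF G u])
  have fp: "nbwalk H (f \<circ> p) n" by (rule nbwalk_embedding[OF f G p(1)])
  have "nbwalk H (\<lambda>i. if i = 0 then f u else f v) 1"
    using e tree_edge[OF H e] by (auto simp: nbwalk_def)
  from nbwalk_unique[OF H this fp] have "n = 1" using p by auto
  then show "{u, v} \<in> edges G" using p by (auto simp: nbwalk_def)
qed (rule embedding_edge[OF G f])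

text \<open>Siblings are handled through vertex sets. Nothing is lost, since embeddings between
  trees reflect edges and so their images are induced subgraphs.\<close>

definition induced :: "'a ugraph \<Rightarrow> 'a set \<Rightarrow> 'a ugraph" where
  "induced G A = Graph A {e \<in> edges G. e \<subseteq> A}"

lemma induced_simps [simp]:
  "verts (induced G A) = A" "{u, v} \<in> edges (induced G A) \<longleftrightarrow> {u, v} \<in> edges G \<and> u \<in> A \<and> v \<in> A"
  by (auto simp: induced_def)

lemma induced_tree:
  assumes G: "is_tree G" and A: "A \<noteq> {}" "A \<subseteq> verts G"
    and c: "\<And>u v. u \<in> A \<Longrightarrow> v \<in> A \<Longrightarrow> (u, v) \<in> (adj_rel (induced G A))\<^sup>*"
  shows "is_tree (induced G A)"
  unfolding is_tree_def
proof (intro conjI notI)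
  show "simple_graph (induced G A)"
    using G A by (auto simp: simple_graph_def is_tree_def induced_def)
  show "verts (induced G A) = {} \<Longrightarrow> False" using A by simp
  show "graph_connected (induced G A)" using c by (simp add: graph_connected_def)
  assume "\<exists>p. is_cycle (induced G A) p"
  then obtain p where "is_cycle G p" by (auto simp: is_cycle_def)
  then show False using G by (auto simp: is_tree_def)
qed

lemma adj_rel_sym: "(u, v) \<in> (adj_rel G)\<^sup>* \<Longrightarrow> (v, u) \<in> (adj_rel G)\<^sup>*"
  using sym_rtrancl[of "adj_rel G"] by (auto simp: sym_def adj_rel_def insert_commute)

lemma induced_embedding: "A \<subseteq> verts G \<Longrightarrow> embedding (induced G A) G id"
  by (auto simp: embedding_def)

lemma embedding_induced:
  assumes "is_tree G" "embedding H G f" "f ` verts H \<subseteq> A" 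
  shows "embedding H (induced G A) f"
  using assms by (auto simp: embedding_def)

lemma siblings_induced:
  assumes "is_tree T" "is_tree (induced T A)" "A \<subseteq> verts T"
    and "embedding T T f" "f ` verts T \<subseteq> A"
  shows "siblings (induced T A) T"
  unfolding siblings_def using assms induced_embedding[of A T] embedding_induced[of T T f A] by blast

lemma isomorphic_embedding:
  assumes "is_tree G" "is_tree H" "embedding G H f" "f ` verts G = verts H"
  shows "isomorphic G H"
  unfolding isomorphic_def
  using assms embedding_edge_iff[OF assms(1-3)]
  by (intro exI[of _ f]) (auto simp: bij_betw_def embedding_def)

lemma isomorphic_obtain:
  assumes "is_tree G" "is_tree H" "isomorphic G H"
  obtains f where "embedding G H f" "bij_betw f (verts G) (verts H)"
    "embedding H G (inv_into (verts G) f)"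
proof -
  obtain f where f: "bij_betw f (verts G) (verts H)"
     "\<forall>u\<in>verts G. \<forall>v\<in>verts G. {u, v} \<in> edges G \<longleftrightarrow> {f u, f v} \<in> edges H"
    using assms(3) by (auto simp: isomorphic_def)
  let ?g = "inv_into (verts G) f"
  have g: "bij_betw ?g (verts H) (verts G)" by (rule bij_betw_inv_into[OF f(1)])
  have fg: "f (?g y) = y" if "y \<in> verts H" for y using f(1) that by (simp add: bij_betw_inv_into_right)
  show ?thesis
  proof
    show "embedding G H f" using f by (auto simp: embedding_def bij_betw_def)
    have "?g y \<in> verts G" if "y \<in> verts H" for y
      using g that by (auto simp: bij_betw_def)
    then show "embedding H G ?g"
      unfolding embedding_def using g f(2) fg by (auto simp: bij_betw_def) 
  qed (rule f)
qed

lemma isomorphic_equiv: "equiv UNIV {(S :: 'a ugraph, S' :: 'a ugraph). isomorphic S S'}"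
proof (rule equivI)
  show "refl {(S :: 'a ugraph, S' :: 'a ugraph). isomorphic S S'}"
    by (auto simp: refl_on_def isomorphic_def intro!: exI[of _ id])
  show "sym {(S :: 'a ugraph, S' :: 'a ugraph). isomorphic S S'}"
  proof (rule symI, clarsimp)
    fix S S' :: "'a ugraph" assume "isomorphic S S'"
    then obtain f where f: "bij_betw f (verts S) (verts S')"
      "\<forall>u\<in>verts S. \<forall>v\<in>verts S. {u, v} \<in> edges S \<longleftrightarrow> {f u, f v} \<in> edges S'"
      by (auto simp: isomorphic_def)
    have g: "bij_betw (inv_into (verts S) f) (verts S') (verts S)" by (rule bij_betw_inv_into[OF f(1)])
    have fg: "f (inv_into (verts S) f y) = y" if "y \<in> verts S'" for y
      using f(1) that by (simp add: bij_betw_inv_into_right)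
    have gv: "inv_into (verts S) f y \<in> verts S" if "y \<in> verts S'" for y
      using g that by (auto simp: bij_betw_def)
    show "isomorphic S' S" unfolding isomorphic_def
      using g f(2) fg gv by (intro exI[of _ "inv_into (verts S) f"] conjI ballI) auto
  qed
  show "trans {(S :: 'a ugraph, S' :: 'a ugraph). isomorphic S S'}"
  proof (rule transI, clarsimp)
    fix S S' S'' :: "'a ugraph" assume "isomorphic S S'" "isomorphic S' S''"
    then obtain f g where f: "bij_betw f (verts S) (verts S')"
      "\<forall>u\<in>verts S. \<forall>v\<in>verts S. {u, v} \<in> edges S \<longleftrightarrow> {f u, f v} \<in> edges S'"
      and g: "bij_betw g (verts S') (verts S'')"
      "\<forall>u\<in>verts S'. \<forall>v\<in>verts S'. {u, v} \<in> edges S' \<longleftrightarrow> {g u, g v} \<in> edges S''"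
      by (auto simp: isomorphic_def)
    have "\<forall>u\<in>verts S. f u \<in> verts S'" using f(1) by (auto simp: bij_betw_def)
    then show "isomorphic S S''" unfolding isomorphic_def
      using bij_betw_trans[OF f(1) g(1)] f(2) g(2) by (intro exI[of _ "g \<circ> f"]) auto
  qed
qed simp_all

lemma Sib_eq_1I:
  fixes T :: "'a ugraph"
  assumes "is_tree T" "\<And>S :: 'a ugraph. siblings S T \<Longrightarrow> isomorphic S T"
  shows "Sib T = 1"
proof -
  let ?r = "{(S :: 'a ugraph, S' :: 'a ugraph). isomorphic S S'}"
  have s: "siblings T T" using assms(1) embedding_id[of T] by (auto simp: siblings_def)
  have "sibling_classes T = {?r `` {T}}"
  proof -
    have "?r `` {S} = ?r `` {T}" if "siblings S T" for S
      using equiv_class_eq[OF isomorphic_equiv, of S T] assms(2)[OF that] by simp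
    then show ?thesis using s unfolding sibling_classes_def quotient_def by blast
  qed
  then show ?thesis by (simp add: Sib_def one_enat_def)
qed

lemma Sib_eq_infI:
  fixes F :: "'i \<Rightarrow> 'a ugraph" and T :: "'a ugraph"
  assumes "\<And>s. s \<in> A \<Longrightarrow> siblings (F s) T" "infinite A"
    and "\<And>s t. s \<in> A \<Longrightarrow> t \<in> A \<Longrightarrow> isomorphic (F s) (F t) \<Longrightarrow> s = t"
  shows "Sib T = \<infinity>"
proof -
  let ?r = "{(S :: 'a ugraph, S' :: 'a ugraph). isomorphic S S'}"
  have "inj_on (\<lambda>s. ?r `` {F s}) A"
  proof (rule inj_onI)
    fix x y assume "x \<in> A" "y \<in> A" "?r `` {F x} = ?r `` {F y}"
    then show "x = y" using assms(3)[of x y] eq_equiv_class[OF _ isomorphic_equiv, of "F x" "F y"] by simp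
  qed
  moreover have "(\<lambda>s. ?r `` {F s}) ` A \<subseteq> sibling_classes T"
    using assms(1) by (auto simp: sibling_classes_def quotient_def)
  ultimately have "infinite (sibling_classes T)"
    using assms(2) finite_imageD finite_subset by blast
  then show ?thesis by (simp add: Sib_def)
qed

text \<open>The composite of \<open>T\<close> into \<open>S\<close> and back is onto, which forces
  the embedding of \<open>S\<close> into \<open>T\<close> to be onto.\<close>

lemma Sib_eq_1_surj:
  assumes "is_tree T" "\<And>f. embedding T T f \<Longrightarrow> f ` verts T = verts T"
  shows "Sib T = 1"
proof (rule Sib_eq_1I[OF assms(1)])
  fix S :: "'a ugraph" assume "siblings S T"
  then obtain f g where S: "is_tree S" and fg: "embedding S T f" "embedding T S g"
    by (auto simp: siblings_def)
  have "(f \<circ> g) ` verts T = verts T" by (rule assms(2)[OF embedding_comp[OF fg(2,1)]])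
  moreover have "g ` verts T \<subseteq> verts S" "f ` verts S \<subseteq> verts T"
    using embedding_verts[OF fg(1)] embedding_verts[OF fg(2)] by blast+
  ultimately have "f ` verts S = verts T"
    by (metis image_comp image_mono subset_antisym)
  then show "isomorphic S T" by (rule isomorphic_embedding[OF S assms(1) fg(1)])
qed

section \<open>Rays and ends\<close>

definition ray :: "'a ugraph \<Rightarrow> (nat \<Rightarrow> 'a) \<Rightarrow> bool" where
  "ray G r \<longleftrightarrow> (\<forall>n. nbwalk G r n)"

text \<open>Equivalence of rays for parametrised rays. Unlike the intersection of graphs, it is
  visibly preserved by composition with any map.\<close>

definition tail_eq :: "(nat \<Rightarrow> 'a) \<Rightarrow> (nat \<Rightarrow> 'a) \<Rightarrow> bool" where
  "tail_eq r s \<longleftrightarrow> (\<exists>a b. \<forall>n. r (a + n) = s (b + n))"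

definition ray_graph :: "(nat \<Rightarrow> 'a) \<Rightarrow> 'a ugraph" where
  "ray_graph r = Graph (range r) (range (\<lambda>n. {r n, r (Suc n)}))"

definition end_of :: "'a ugraph \<Rightarrow> (nat \<Rightarrow> 'a) \<Rightarrow> 'a ugraph set" where
  "end_of G r = ray_equiv G `` {ray_graph r}"

lemma ray_verts: "is_tree G \<Longrightarrow> ray G r \<Longrightarrow> r n \<in> verts G"
  using nbwalk_verts[of G r n n] by (auto simp: ray_def)

lemma ray_edge: "ray G r \<Longrightarrow> {r n, r (Suc n)} \<in> edges G"
  unfolding ray_def nbwalk_def by blast

lemma ray_inj: "is_tree G \<Longrightarrow> ray G r \<Longrightarrow> r m = r n \<longleftrightarrow> m = n"
  using nbwalk_inj_on[of G r "max m n"] by (auto simp: ray_def inj_on_def)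

lemma ray_drop: "is_tree G \<Longrightarrow> ray G r \<Longrightarrow> ray G (\<lambda>n. r (a + n))"
  using nbwalk_drop[of G r _ a] by (auto simp: ray_def)

lemma rayI:
  assumes "\<And>n. {r n, r (Suc n)} \<in> edges G" "\<And>n. r n \<noteq> r (Suc (Suc n))" "is_tree G"
  shows "ray G r"
  using assms tree_edge(2)[OF assms(3,1)] by (auto simp: ray_def nbwalk_def)

lemma ray_inj_iff: "is_tree G \<Longrightarrow> ray G r \<longleftrightarrow> inj r \<and> (\<forall>n. {r n, r (Suc n)} \<in> edges G)"
  using ray_inj[of G r] ray_edge[of G r] rayI[of r G] unfolding inj_def by fastforce

lemma ray_embedding: "is_tree G \<Longrightarrow> embedding G H f \<Longrightarrow> ray G r \<Longrightarrow> ray H (f \<circ> r)"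
  unfolding ray_def by (blast intro: nbwalk_embedding)

lemma tail_eq_refl [simp]: "tail_eq r r"
  by (auto simp: tail_eq_def)

lemma tail_eq_sym: "tail_eq r s \<Longrightarrow> tail_eq s r"
  unfolding tail_eq_def by metis

lemma tail_eq_trans:
  assumes "tail_eq r s" "tail_eq s t"
  shows "tail_eq r t"
proof -
  obtain a b c d where *: "\<And>n. r (a + n) = s (b + n)" "\<And>n. s (c + n) = t (d + n)"
    using assms unfolding tail_eq_def by metis
  have "r (a + c + n) = t (d + b + n)" for n
    using *(1)[of "c + n"] *(2)[of "b + n"] by (simp add: ac_simps)
  then show ?thesis unfolding tail_eq_def by blast
qed

lemma tail_eq_drop: "tail_eq (\<lambda>n. r (a + n)) r"
  unfolding tail_eq_def by (metis add_0)

lemma tail_eq_comp: "tail_eq r s \<Longrightarrow> tail_eq (f \<circ> r) (f \<circ> s)"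
  unfolding tail_eq_def comp_def by metis

lemma tail_eq_comp_inj:
  assumes "is_tree G" "ray G r" "ray G s" "embedding G H f" "tail_eq (f \<circ> r) (f \<circ> s)"
  shows "tail_eq r s"
proof -
  obtain a b where "\<And>n. f (r (a + n)) = f (s (b + n))"
    using assms(5) unfolding tail_eq_def comp_def by metis
  then have "r (a + n) = s (b + n)" for n
    using embedding_eq[OF assms(4)] ray_verts[OF assms(1)] assms(2,3) by metis
  then show ?thesis unfolding tail_eq_def by blast
qed

text \<open>From the common vertex to a vertex of the common tail there is only one geodesic, so the
  rays agree from their meeting point on and not merely eventually.\<close>

lemma tail_eq_aligned:
  assumes t: "is_tree G" and r: "ray G r" and s: "ray G s" and e: "tail_eq r s" and ij: "r i = s j"
  shows "r (i + n) = s (j + n)"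
proof -
  obtain a b where ab: "\<And>n. r (a + n) = s (b + n)" using e unfolding tail_eq_def by metis
  \<comment> \<open>Large enough for \<open>a + m - i\<close> and \<open>b + m - j\<close> to be
    true differences.\<close>
  define m where "m = i + j"
  have w: "nbwalk G (\<lambda>n. r (i + n)) (a + m - i)" "nbwalk G (\<lambda>n. s (j + n)) (b + m - j)"
    using ray_drop[OF t r] ray_drop[OF t s] unfolding ray_def by blast+
  have "r (i + (a + m - i)) = s (j + (b + m - j))" using ab[of m] by (simp add: m_def add.commute add.left_commute)
  from nbwalk_unique[OF t w _ this] ij
  have l: "a + m - i = b + m - j" and eq: "\<And>k. k \<le> a + m - i \<Longrightarrow> r (i + k) = s (j + k)" by auto
  show ?thesis
  proof (cases "n \<le> a + m - i")
    case False
    then have "r (i + n) = r (a + (i + n - a))" "s (b + (i + n - a)) = s (j + n)"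
      using l by (auto simp: m_def intro!: arg_cong[of _ _ s] arg_cong[of _ _ r])
    then show ?thesis using ab by metis
  qed (rule eq)
qed

text \<open>By injectivity a downward step can only be followed by further downward steps, and these
  would pass below 0.\<close>

lemma nat_unit_steps:
  fixes \<sigma> :: "nat \<Rightarrow> nat"
  assumes i: "inj \<sigma>" and s: "\<And>n. \<sigma> (Suc n) = Suc (\<sigma> n) \<or> \<sigma> n = Suc (\<sigma> (Suc n))"
  shows "\<sigma> n = \<sigma> 0 + n"
proof -
  have up: "\<sigma> (Suc n) = Suc (\<sigma> n)" for n
  proof (rule ccontr)
    assume d: "\<sigma> (Suc n) \<noteq> Suc (\<sigma> n)"
    have "\<sigma> (n + j) = Suc (\<sigma> (Suc (n + j)))" for j
    proof (induction j)
      case 0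
      then show ?case using d s[of n] by simp
    next
      case (Suc j)
      have "\<sigma> (n + j) \<noteq> \<sigma> (Suc (Suc (n + j)))" using i by (simp add: inj_eq)
      then show ?case using Suc s[of "Suc (n + j)"] by auto
    qed
    then have dn: "\<sigma> (n + j) = Suc (\<sigma> (n + Suc j))" for j by simp
    have "\<sigma> (n + j) + j = \<sigma> n" for j
    proof (induction j)
      case (Suc j)
      then show ?case using dn[of j] by linarith
    qed simp
    from this[of "Suc (\<sigma> n)"] show False by simp
  qed
  show ?thesis by (induction n) (auto simp: up)
qed

text \<open>Recovers a parametrisation from inclusion of graphs: the map between the indices is
  injective and moves by unit steps, hence is a shift.\<close>

lemma ray_graph_subgraph:
  assumes q: "inj q" and r: "inj r" and sub: "subgraph (ray_graph q) (ray_graph r)"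
  obtains k where "\<And>n. q n = r (k + n)"
proof -
  have "\<exists>m. q n = r m" for n using sub unfolding subgraph_def ray_graph_def by auto blast
  then obtain \<sigma> where \<sigma>: "\<And>n. q n = r (\<sigma> n)" by metis
  have "inj \<sigma>" using q \<sigma> by (auto simp: inj_def)
  moreover have "\<sigma> (Suc n) = Suc (\<sigma> n) \<or> \<sigma> n = Suc (\<sigma> (Suc n))" for n
  proof -
    have "{q n, q (Suc n)} \<in> edges (ray_graph r)"
      using sub by (auto simp: subgraph_def ray_graph_def)
    then obtain m where "{q n, q (Suc n)} = {r m, r (Suc m)}" by (auto simp: ray_graph_def)
    then show ?thesis using r \<sigma> by (auto simp: doubleton_eq_iff inj_eq)
  qed
  ultimately have "\<sigma> n = \<sigma> 0 + n" for n by (rule nat_unit_steps)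
  then show ?thesis using that[of "\<sigma> 0"] \<sigma> by metis
qed

lemma rays_eq: "is_tree G \<Longrightarrow> rays G = ray_graph ` {r. ray G r}"
proof (intro equalityI subsetI)
  assume t: "is_tree G"
  fix R assume "R \<in> rays G"
  then obtain r where "inj r" "R = ray_graph r" "subgraph R G"
    by (auto simp: rays_def is_ray_def ray_graph_def)
  then show "R \<in> ray_graph ` {r. ray G r}"
    using ray_inj_iff[OF t, of r] by (force simp: subgraph_def ray_graph_def)
next
  assume t: "is_tree G"
  fix R assume "R \<in> ray_graph ` {r. ray G r}"
  then show "R \<in> rays G"
    using ray_inj_iff[OF t] ray_verts[OF t] by (auto simp: rays_def is_ray_def ray_graph_def subgraph_def)
qed

text \<open>For the converse direction, the first index at which \<open>r\<close> meets
  \<open>s\<close> is decisive: before it the rays share nothing, after it they agree, so the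
  intersection is exactly a tail.\<close>

lemma ray_inter_iff:
  assumes t: "is_tree G" and r: "ray G r" and s: "ray G s"
  shows "is_ray (inter_graph (ray_graph r) (ray_graph s)) \<longleftrightarrow> tail_eq r s"
proof
  have inj: "inj r" "inj s" using r s ray_inj_iff[OF t] by blast+
  assume "is_ray (inter_graph (ray_graph r) (ray_graph s))"
  then obtain q where q: "inj q" "inter_graph (ray_graph r) (ray_graph s) = ray_graph q"
    by (auto simp: is_ray_def ray_graph_def)
  have "subgraph (ray_graph q) (ray_graph r)" "subgraph (ray_graph q) (ray_graph s)"
    unfolding q(2)[symmetric] by (auto simp: subgraph_def inter_graph_def)
  then obtain k l where "\<And>n. q n = r (k + n)" "\<And>n. q n = s (l + n)"
    using ray_graph_subgraph q(1) inj by metis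
  then show "tail_eq r s" unfolding tail_eq_def by metis
next
  assume e: "tail_eq r s"
  then have "\<exists>i. r i \<in> range s" unfolding tail_eq_def by (metis rangeI)
  define i where "i = (LEAST i. r i \<in> range s)"
  have "r i \<in> range s" unfolding i_def by (rule LeastI_ex) fact
  then obtain j where j: "r i = s j" by auto
  have al: "r (i + n) = s (j + n)" for n by (rule tail_eq_aligned[OF t r s e j])
  have ge: "i \<le> m" if "r m = s l" for m l
    unfolding i_def by (rule Least_le) (use that in auto)
  let ?q = "\<lambda>n. r (i + n)"
  have "inter_graph (ray_graph r) (ray_graph s) = ray_graph ?q"
  proof -
    have "range r \<inter> range s = range ?q"
    proof (intro equalityI subsetI)
      fix x assume "x \<in> range r \<inter> range s"
      then obtain m l where "x = r m" "r m = s l" by auto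
      then show "x \<in> range ?q" using ge[of m l] by (auto intro!: image_eqI[of _ _ "m - i"])
    next
      fix x assume "x \<in> range ?q"
      then obtain n where "x = r (i + n)" by auto
      then show "x \<in> range r \<inter> range s" using al[of n] by (metis IntI rangeI)
    qed
    moreover have "range (\<lambda>n. {r n, r (Suc n)}) \<inter> range (\<lambda>n. {s n, s (Suc n)})
        = range (\<lambda>n. {?q n, ?q (Suc n)})"
    proof (intro equalityI subsetI)
      fix x assume "x \<in> range (\<lambda>n. {r n, r (Suc n)}) \<inter> range (\<lambda>n. {s n, s (Suc n)})"
      then obtain m l where x: "x = {r m, r (Suc m)}" "{r m, r (Suc m)} = {s l, s (Suc l)}" by auto
      have "r m = s l \<or> r m = s (Suc l)" using x(2) by (auto simp: doubleton_eq_iff)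
      then have "i \<le> m" using ge by blast
      then have "x = {?q (m - i), ?q (Suc (m - i))}" using x(1) by simp
      then show "x \<in> range (\<lambda>n. {?q n, ?q (Suc n)})" by blast
    next
      fix x assume "x \<in> range (\<lambda>n. {?q n, ?q (Suc n)})"
      then obtain n where x: "x = {?q n, ?q (Suc n)}" by auto
      then have "x = {s (j + n), s (Suc (j + n))}" using al[of n] al[of "Suc n"] by simp
      then show "x \<in> range (\<lambda>n. {r n, r (Suc n)}) \<inter> range (\<lambda>n. {s n, s (Suc n)})" using x by auto
    qed
    ultimately show ?thesis by (simp add: inter_graph_def ray_graph_def)
  qed
  moreover have "inj ?q" using ray_inj[OF t r] by (auto simp: inj_def)
  ultimately show "is_ray (inter_graph (ray_graph r) (ray_graph s))"
    unfolding is_ray_def by (intro exI[of _ ?q]) (simp add: ray_graph_def)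
qed

lemma ray_equiv_iff:
  assumes "is_tree G" "ray G r" "ray G s"
  shows "(ray_graph r, ray_graph s) \<in> ray_equiv G \<longleftrightarrow> tail_eq r s"
  using ray_inter_iff[OF assms] assms rays_eq[OF assms(1)] by (auto simp: ray_equiv_def)

lemma in_end_of:
  assumes "is_tree G" "ray G r"
  shows "end_of G r = ray_graph ` {s. ray G s \<and> tail_eq r s}"
proof -
  have "end_of G r \<subseteq> ray_graph ` {s. ray G s}"
    unfolding end_of_def rays_eq[OF assms(1), symmetric] by (auto simp: ray_equiv_def)
  then show ?thesis unfolding end_of_def using ray_equiv_iff[OF assms] by blast
qed

lemma ray_graph_tail_eq:
  assumes "is_tree G" "ray G r" "ray G s" "ray_graph r = ray_graph s"
  shows "tail_eq r s"
proof -
  have "inj r" "inj s" using ray_inj_iff assms by blast+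
  moreover have "subgraph (ray_graph r) (ray_graph s)" using assms(4) by (simp add: subgraph_def)
  ultimately obtain k where "\<And>n. r n = s (k + n)" using ray_graph_subgraph by metis
  then show ?thesis unfolding tail_eq_def by (metis add_0)
qed

lemma mem_end_of_iff:
  assumes "is_tree G" "ray G r" "ray G s"
  shows "ray_graph s \<in> end_of G r \<longleftrightarrow> tail_eq r s"
proof
  assume "ray_graph s \<in> end_of G r"
  then obtain t where "ray G t" "tail_eq r t" "ray_graph s = ray_graph t"
    by (auto simp: in_end_of[OF assms(1,2)])
  then show "tail_eq r s"
    using ray_graph_tail_eq[OF assms(1,3)] tail_eq_trans tail_eq_sym by metis
qed (use assms in \<open>auto simp: in_end_of\<close>)

lemma end_of_eq_iff:
  assumes "is_tree G" "ray G r" "ray G s"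
  shows "end_of G r = end_of G s \<longleftrightarrow> tail_eq r s"
proof
  assume "end_of G r = end_of G s"
  then show "tail_eq r s" using mem_end_of_iff[OF assms(1,2,3)] mem_end_of_iff[OF assms(1,3,3)] by simp
next
  assume "tail_eq r s"
  then show "end_of G r = end_of G s"
    unfolding in_end_of[OF assms(1,2)] in_end_of[OF assms(1,3)]
    by (metis tail_eq_trans tail_eq_sym)
qed

lemma Ends_eq: "is_tree G \<Longrightarrow> Ends G = end_of G ` {r. ray G r}"
  unfolding Ends_def quotient_def by (auto simp: rays_eq end_of_def)

lemma image_ray_graph: "image_graph f (ray_graph r) = ray_graph (f \<circ> r)"
  by (auto simp: image_graph_def ray_graph_def image_image)

lemma fixes_end_iff:
  assumes "is_tree G" "ray G r" "embedding G G f"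
  shows "fixes_end f (end_of G r) \<longleftrightarrow> tail_eq (f \<circ> r) r"
proof
  assume "fixes_end f (end_of G r)"
  then have "ray_graph (f \<circ> r) \<in> end_of G r"
    unfolding fixes_end_def image_ray_graph[symmetric]
    using mem_end_of_iff[OF assms(1,2,2)] by auto
  then show "tail_eq (f \<circ> r) r"
    using mem_end_of_iff[OF assms(1,2) ray_embedding[OF assms(1,3,2)]] tail_eq_sym by blast
next
  assume e: "tail_eq (f \<circ> r) r"
  have "ray_graph (f \<circ> s) \<in> end_of G r" if "ray G s" "tail_eq r s" for s
    unfolding mem_end_of_iff[OF assms(1,2) ray_embedding[OF assms(1,3) that(1)]]
    using tail_eq_trans[OF tail_eq_sym[OF e] tail_eq_comp[OF that(2)]] .
  then show "fixes_end f (end_of G r)"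
    by (auto simp: fixes_end_def in_end_of[OF assms(1,2)] image_ray_graph) 
qed

section \<open>Trees oriented towards an end\<close>

text \<open>The ray from \<open>v\<close> in the end of \<open>r\<close>. It exists for every
  vertex, and it is unique because two rays of one end agree from a common vertex on.\<close>

definition ray_to :: "'a ugraph \<Rightarrow> (nat \<Rightarrow> 'a) \<Rightarrow> 'a \<Rightarrow> nat \<Rightarrow> 'a" where
  "ray_to G r v = (THE s. ray G s \<and> s 0 = v \<and> tail_eq s r)"

definition parent :: "'a ugraph \<Rightarrow> (nat \<Rightarrow> 'a) \<Rightarrow> 'a \<Rightarrow> 'a" where
  "parent G r v = ray_to G r v 1"

locale ended_tree =
  fixes T :: "'a ugraph" and r :: "nat \<Rightarrow> 'a"
  assumes tree: "is_tree T" and ray: "ray T r"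
begin

abbreviation V where "V \<equiv> verts T"
abbreviation \<pi> where "\<pi> \<equiv> parent T r"

lemma ray_to_unique:
  assumes "ray T s" "ray T s'" "tail_eq s r" "tail_eq s' r" "s 0 = s' 0"
  shows "s = s'"
proof
  fix n
  have "tail_eq s s'" using assms tail_eq_trans tail_eq_sym by blast
  from tail_eq_aligned[OF tree assms(1,2) this assms(5), of n] show "s n = s' n" by simp
qed

lemma ray_to_eq:
  assumes "ray T s" "tail_eq s r"
  shows "ray_to T r (s 0) = s"
  unfolding ray_to_def by (rule the_equality) (use assms ray_to_unique in auto)

lemma ray_cons:
  assumes s: "ray T s" and e: "{v, s 0} \<in> edges T" and n: "v \<noteq> s 1"
  shows "ray T (case_nat v s)" "tail_eq (case_nat v s) s"
proof -
  have s2: "s n \<noteq> s (Suc (Suc n))" for n using ray_inj[OF tree s] by auto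
  show "ray T (case_nat v s)"
    by (rule rayI[OF _ _ tree]) (use s2 ray_edge[OF s] e n in \<open>auto split: nat.split\<close>)
  show "tail_eq (case_nat v s) s"
    unfolding tail_eq_def by (intro exI[of _ 1] exI[of _ 0]) simp
qed

text \<open>Induction along a path from \<open>r 0\<close>: when passing to a neighbour, the ray
  either loses its first vertex or gains a new one.\<close>

lemma ray_to_ex:
  assumes "v \<in> V"
  shows "\<exists>s. ray T s \<and> s 0 = v \<and> tail_eq s r"
proof -
  have "(r 0, v) \<in> (adj_rel T)\<^sup>*"
    using tree assms ray_verts[OF tree ray] by (auto simp: is_tree_def graph_connected_def)
  then show ?thesis
  proof induction
    case base
    then show ?case using ray by (auto intro!: exI[of _ r])
  next
    case (step y z)
    then obtain s where s: "ray T s" "s 0 = y" "tail_eq s r" by auto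
    show ?case
    proof (cases "z = s 1")
      case True
      then show ?thesis
        using ray_drop[OF tree s(1), of 1] tail_eq_trans[OF tail_eq_drop s(3), of 1]
        by (intro exI[of _ "\<lambda>n. s (1 + n)"]) auto
    next
      case False
      have "{z, s 0} \<in> edges T" using step(2) s by (auto simp: adj_rel_def insert_commute)
      from ray_cons[OF s(1) this False] show ?thesis
        using tail_eq_trans[OF _ s(3)] by (intro exI[of _ "case_nat z s"]) auto
    qed
  qed
qed

lemma ray_to:
  assumes "v \<in> V"
  shows "ray T (ray_to T r v)" "ray_to T r v 0 = v" "tail_eq (ray_to T r v) r"
  using ray_to_ex[OF assms] ray_to_eq by auto

lemma parent_ray: "ray T s \<Longrightarrow> tail_eq s r \<Longrightarrow> \<pi> (s n) = s (Suc n)"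
  using ray_to_eq[of "\<lambda>i. s (n + i)"] ray_drop[OF tree, of s n] tail_eq_trans[OF tail_eq_drop, of s r n]
  by (simp add: parent_def)

lemma parent_pow_ray: "ray T s \<Longrightarrow> tail_eq s r \<Longrightarrow> (\<pi> ^^ m) (s n) = s (n + m)"
  by (induction m) (auto simp: parent_ray)

lemma parent_pow_r: "(\<pi> ^^ m) (r n) = r (n + m)"
  by (simp add: parent_pow_ray ray)

lemma parent_pow: "v \<in> V \<Longrightarrow> (\<pi> ^^ n) v = ray_to T r v n"
  using parent_pow_ray[of "ray_to T r v" n 0] ray_to by auto

lemma r_in_V: "r n \<in> V"
  by (rule ray_verts[OF tree ray])

lemma parent_pow_V: "v \<in> V \<Longrightarrow> (\<pi> ^^ n) v \<in> V"
  using parent_pow ray_to(1) ray_verts[OF tree] by metis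

lemma parent_V: "v \<in> V \<Longrightarrow> \<pi> v \<in> V"
  using parent_pow_V[of v 1] by simp

lemma parent_edge: "v \<in> V \<Longrightarrow> {v, \<pi> v} \<in> edges T"
  using ray_edge[OF ray_to(1), of v 0] ray_to(2)[of v] by (simp add: parent_def)

text \<open>Unless \<open>u\<close> is the second vertex of the ray from \<open>v\<close>,
  prepending \<open>u\<close> to that ray gives the ray from \<open>u\<close>.\<close>

lemma edge_parent:
  assumes "{u, v} \<in> edges T"
  shows "v = \<pi> u \<or> u = \<pi> v"
proof (cases "u = \<pi> v")
  case False
  have v: "v \<in> V" "u \<in> V" using tree_edge[OF tree assms] by auto
  let ?s = "ray_to T r v"
  have "ray T (case_nat u ?s)" "tail_eq (case_nat u ?s) ?s"
    using ray_cons[of ?s u] assms False ray_to[OF v(1)] by (auto simp: parent_def)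
  then have "\<pi> (case_nat u ?s 0) = case_nat u ?s 1"
    using parent_ray[of "case_nat u ?s" 0] tail_eq_trans ray_to(3)[OF v(1)] by (metis One_nat_def)
  then show ?thesis using ray_to(2)[OF v(1)] by simp
qed simp

lemma edge_iff_parent: "{u, v} \<in> edges T \<longleftrightarrow> u \<in> V \<and> v \<in> V \<and> (v = \<pi> u \<or> u = \<pi> v)"
  using edge_parent[of u v] parent_edge[of u] parent_edge[of v] tree_edge[OF tree, of u v]
  by (auto simp: insert_commute)

lemma parent_pow_inj: "v \<in> V \<Longrightarrow> (\<pi> ^^ m) v = (\<pi> ^^ n) v \<longleftrightarrow> m = n"
  by (simp add: parent_pow ray_inj[OF tree ray_to(1)])

lemma meets_ray:
  assumes "v \<in> V"
  obtains m n where "(\<pi> ^^ m) v = r n"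
  using ray_to(3)[OF assms] parent_pow[OF assms] unfolding tail_eq_def by (metis add_0_right)

lemma pow_shift: "(\<pi> ^^ m) v = w \<Longrightarrow> (\<pi> ^^ (j + m)) v = (\<pi> ^^ j) w"
  by (simp add: funpow_add)

lemma common_ancestor:
  assumes "u \<in> V" "v \<in> V"
  obtains m n where "(\<pi> ^^ m) u = (\<pi> ^^ n) v"
proof -
  obtain a b c d where *: "(\<pi> ^^ a) u = r b" "(\<pi> ^^ c) v = r d"
    using meets_ray assms by metis
  have "(\<pi> ^^ (d + a)) u = r (b + d)" "(\<pi> ^^ (b + c)) v = r (b + d)"
    using pow_shift[OF *(1), of d] pow_shift[OF *(2), of b] by (auto simp: parent_pow_r add.commute)
  then show ?thesis using that by metis
qed

text \<open>The Busemann function of the end, with value 0 at \<open>r 0\<close> and increasing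
  towards the end. The choice of the pair is immaterial by \<open>level_eq\<close>.\<close>

definition level :: "'a \<Rightarrow> int" where
  "level v = (let (m, n) = (SOME (m, n). (\<pi> ^^ m) v = r n) in int n - int m)"

lemma level_eq:
  assumes "v \<in> V" "(\<pi> ^^ m) v = r n"
  shows "level v = int n - int m"
proof -
  obtain a b where ab: "(SOME (m, n). (\<pi> ^^ m) v = r n) = (a, b)" by fastforce
  have "case (a, b) of (m, n) \<Rightarrow> (\<pi> ^^ m) v = r n"
    unfolding ab[symmetric] by (rule someI[of _ "(m, n)"]) (use assms in simp)
  then have "(\<pi> ^^ a) v = r b" by simp
  then have "(\<pi> ^^ (m + a)) v = r (b + m)" "(\<pi> ^^ (a + m)) v = r (n + a)"
    using pow_shift assms(2) parent_pow_r by metis+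
  then have "b + m = n + a" using ray_inj[OF tree ray] by (metis add.commute)
  then show ?thesis by (simp add: level_def ab)
qed

lemma level_parent: 
  assumes "v \<in> V"
  shows "level (\<pi> v) = level v + 1"
proof -
  obtain m n where "(\<pi> ^^ m) v = r n" by (rule meets_ray[OF assms])
  then have m: "(\<pi> ^^ Suc m) v = r (Suc n)" using parent_pow_r[of 1 n] by simp
  then have "(\<pi> ^^ m) (\<pi> v) = r (Suc n)" by (simp add: funpow_swap1)
  from level_eq[OF parent_V[OF assms] this] level_eq[OF assms m] show ?thesis by simp
qed

lemma level_pow: "v \<in> V \<Longrightarrow> level ((\<pi> ^^ m) v) = level v + int m"
  by (induction m) (auto simp: level_parent parent_pow_V)

definition up_closed :: "'a set \<Rightarrow> bool" where
  "up_closed A \<longleftrightarrow> A \<noteq> {} \<and> A \<subseteq> V \<and> (\<forall>v\<in>A. \<pi> v \<in> A)"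

lemma up_closed_pow: "up_closed A \<Longrightarrow> v \<in> A \<Longrightarrow> (\<pi> ^^ n) v \<in> A"
  by (induction n) (auto simp: up_closed_def)

lemma up_closed_V: "up_closed V"
  using parent_V r_in_V by (auto simp: up_closed_def)

lemma up_closed_ray_to: "up_closed A \<Longrightarrow> v \<in> A \<Longrightarrow> ray_to T r v n \<in> A"
  using up_closed_pow[of A v n] parent_pow[of v n] by (auto simp: up_closed_def)

text \<open>Any two vertices of \<open>A\<close> climb inside \<open>A\<close> to a common ancestor,
  so closure under parents already gives connectedness.\<close>

lemma up_closed_tree:
  assumes A: "up_closed A"
  shows "is_tree (induced T A)"
proof (rule induced_tree[OF tree])
  show "A \<noteq> {}" "A \<subseteq> V" using A by (auto simp: up_closed_def)
  have up: "(v, (\<pi> ^^ n) v) \<in> (adj_rel (induced T A))\<^sup>*" if "v \<in> A" for v n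
  proof (induction n)
    case (Suc n)
    have *: "(\<pi> ^^ n) v \<in> A" "(\<pi> ^^ Suc n) v \<in> A" using up_closed_pow[OF A that] by blast+
    then have "{(\<pi> ^^ n) v, (\<pi> ^^ Suc n) v} \<in> edges (induced T A)"
      using parent_edge[of "(\<pi> ^^ n) v"] A by (auto simp: up_closed_def simp del: induced_simps(1))
    then have "((\<pi> ^^ n) v, (\<pi> ^^ Suc n) v) \<in> adj_rel (induced T A)" by (simp add: adj_rel_def)
    then show ?case using Suc by (rule rtrancl_into_rtrancl[rotated])
  qed simp
  fix u v assume uv: "u \<in> A" "v \<in> A"
  then obtain m n where "(\<pi> ^^ m) u = (\<pi> ^^ n) v"
    using common_ancestor A unfolding up_closed_def by blast
  then show "(u, v) \<in> (adj_rel (induced T A))\<^sup>*"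
    using up[OF uv(1), of m] adj_rel_sym[OF up[OF uv(2), of n]] by auto
qed

lemma ray_induced:
  assumes "up_closed A" "ray T s" "\<And>n. s n \<in> A"
  shows "ray (induced T A) s"
  by (rule rayI[OF _ _ up_closed_tree[OF assms(1)]])
     (use assms ray_edge[OF assms(2)] ray_inj[OF tree assms(2)] in auto)

text \<open>One ray \<open>s\<close> of the end on which \<open>f\<close> preserves the end
  suffices: then \<open>f\<close> maps the ray from \<open>v\<close> towards the end to the ray from
  \<open>f v\<close>, and the second vertices are compared. The domain is a subtree so that
  isomorphisms between siblings are covered.\<close>

lemma embedding_parent:
  assumes A: "up_closed A" and f: "embedding (induced T A) T f"
    and s: "ray T s" "tail_eq s r" "\<And>n. s n \<in> A" "tail_eq (f \<circ> s) r" and v: "v \<in> A"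
  shows "f (\<pi> v) = \<pi> (f v)"
proof -
  have vV: "v \<in> V" using A v by (auto simp: up_closed_def)
  let ?s = "ray_to T r v"
  have "ray (induced T A) ?s"
    by (rule ray_induced[OF A ray_to(1)[OF vV]]) (rule up_closed_ray_to[OF A v])
  then have 1: "ray T (f \<circ> ?s)" by (rule ray_embedding[OF up_closed_tree[OF A] f])
  have "tail_eq ?s s" using ray_to(3)[OF vV] s(2) tail_eq_trans tail_eq_sym by blast
  then have "tail_eq (f \<circ> ?s) r" using tail_eq_trans[OF tail_eq_comp s(4)] by blast
  from parent_ray[OF 1 this, of 0] show ?thesis using ray_to(2)[OF vV] by (simp add: parent_def)
qed

lemma embedding_parent_V:
  assumes "embedding T T f" "tail_eq (f \<circ> r) r" "v \<in> V"
  shows "f (\<pi> v) = \<pi> (f v)"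
  by (rule embedding_parent[OF up_closed_V _ ray tail_eq_refl r_in_V assms(2,3)])
     (use assms(1) in \<open>auto simp: embedding_def\<close>)

lemma embedding_parent_pow:
  assumes "embedding T T f" "tail_eq (f \<circ> r) r" "v \<in> V"
  shows "f ((\<pi> ^^ n) v) = (\<pi> ^^ n) (f v)"
  by (induction n) (auto simp: embedding_parent_V[OF assms(1,2)] parent_pow_V assms(3))

text \<open>A ray that always climbs belongs to the end of \<open>r\<close>. Once it fails to climb
  it descends for ever, since the parent of the current vertex is the vertex just left.\<close>

lemma ray_descends:
  assumes s: "ray T s" and n: "\<not> tail_eq s r"
  obtains p where "\<And>n. n \<ge> p \<Longrightarrow> \<pi> (s (Suc n)) = s n"
proof -
  have sV: "s n \<in> V" for n by (rule ray_verts[OF tree s])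
  have "\<exists>p. \<pi> (s p) \<noteq> s (Suc p)"
  proof (rule ccontr)
    assume "\<nexists>p. \<pi> (s p) \<noteq> s (Suc p)"
    then have "(\<pi> ^^ m) (s 0) = s m" for m by (induction m) auto
    then have "ray_to T r (s 0) = s" using parent_pow[OF sV] by (metis ext)
    then show False using ray_to(3)[OF sV] n by metis
  qed
  then obtain p where p: "\<pi> (s p) \<noteq> s (Suc p)" by blast
  have "\<pi> (s (Suc n)) = s n" if "n \<ge> p" for n
    using that
  proof (induction n rule: dec_induct)
    case base
    then show ?case using edge_parent[OF ray_edge[OF s, of p]] p by auto
  next
    case (step n)
    then show ?case
      using edge_parent[OF ray_edge[OF s, of "Suc n"]] ray_inj[OF tree s, of n "Suc (Suc n)"] by auto
  qed
  then show ?thesis using that by blast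
qed

end

section \<open>Elliptic embeddings and translations\<close>

definition translates :: "('a \<Rightarrow> 'a) \<Rightarrow> (nat \<Rightarrow> 'a) \<Rightarrow> nat \<Rightarrow> bool" where
  "translates g r k \<longleftrightarrow> k > 0 \<and> (\<forall>i. g (r i) = r (i + k))"

lemma translates_pow: "translates g r k \<Longrightarrow> (g ^^ n) (r i) = r (i + n * k)"
  by (induction n) (auto simp: translates_def algebra_simps)

lemma translates_tail_eq: "translates g r k \<Longrightarrow> tail_eq (g \<circ> r) r"
  unfolding translates_def tail_eq_def comp_def by (metis add.commute add_0)

lemma translates_drop: "translates g r k \<Longrightarrow> translates g (\<lambda>n. r (a + n)) k"
  by (auto simp: translates_def algebra_simps)

lemma elliptic_fixed:
  assumes t: "is_tree T" and "v \<in> verts T" "g v = v"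
  shows "elliptic T g"
proof -
  let ?S = "Graph {v} {} :: 'a ugraph"
  have "\<not> is_cycle ?S p" for p
    by (auto simp: is_cycle_def) (metis Suc_le_lessD numeral_3_eq_3 zero_less_Suc order.strict_trans2)
  then have "is_tree ?S" by (auto simp: is_tree_def simple_graph_def graph_connected_def)
  then show ?thesis unfolding elliptic_def
    using assms by (intro exI[of _ ?S]) (auto simp: subtree_def subgraph_def image_graph_def)
qed

lemma elliptic_swap:
  assumes t: "is_tree T" and e: "{x, y} \<in> edges T" "g x = y" "g y = x"
  shows "elliptic T g"
proof -
  let ?S = "induced T {x, y}"
  have xy: "x \<noteq> y" "x \<in> verts T" "y \<in> verts T" using tree_edge[OF t e(1)] by auto
  have ed: "edges ?S = {{x, y}}"
  proof -
    have "e = {x, y}" if "e \<in> edges T" "e \<subseteq> {x, y}" for e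
      by (rule card_seteq) (use that t xy in \<open>auto simp: is_tree_def simple_graph_def\<close>)
    then show ?thesis using e(1) by (auto simp: induced_def)
  qed
  have a: "(x, y) \<in> adj_rel ?S" "(y, x) \<in> adj_rel ?S"
    using ed by (auto simp: adj_rel_def insert_commute)
  have "is_tree ?S"
    by (rule induced_tree[OF t]) (use xy a in auto)
  then show ?thesis unfolding elliptic_def
    using ed xy e
    by (intro exI[of _ ?S]) (auto simp: subtree_def subgraph_def image_graph_def induced_def insert_commute)
qed

text \<open>The balls around the invariant finite subtree are finite, cover the tree and are mapped
  into themselves; an injective self-map of a finite set is onto.\<close>

lemma elliptic_surj:
  assumes t: "is_tree T" and lf: "locally_finite T" and g: "embedding T T g" and el: "elliptic T g"
  shows "g ` verts T = verts T"
proof -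
  obtain S where S: "subtree S T" "finite (verts S)" "image_graph g S = S"
    using el by (auto simp: elliptic_def)
  have gS: "g ` verts S = verts S" using S(3) by (metis image_graph_def ugraph.sel(1))
  obtain s where s: "s \<in> verts S" using S(1) by (auto simp: subtree_def is_tree_def)
  define B where "B n = (adj_rel T ^^ n) `` verts S" for n
  have BV: "B n \<subseteq> verts T" for n
  proof (induction n)
    case 0
    then show ?case using S(1) by (auto simp: B_def subtree_def subgraph_def)
  next
    case (Suc n)
    then show ?case using tree_edge[OF t] by (auto simp: B_def adj_rel_def)
  qed
  have BS: "B (Suc n) = adj_rel T `` B n" for n by (auto simp: B_def)
  have fin: "finite (B n)" for n
  proof (induction n)
    case 0
    then show ?case using S(2) by (simp add: B_def)
  next
    case (Suc n)
    have "B (Suc n) = (\<Union>v\<in>B n. {u. {v, u} \<in> edges T})" unfolding BS by (auto simp: adj_rel_def)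
    then show ?case using Suc BV[of n] lf by (auto simp: locally_finite_def)
  qed
  have gB: "g ` B n \<subseteq> B n" for n
  proof (induction n)
    case 0
    then show ?case using gS by (simp add: B_def)
  next
    case (Suc n)
    show ?case
    proof
      fix x assume "x \<in> g ` B (Suc n)"
      then obtain y z where "x = g z" "y \<in> B n" "{y, z} \<in> edges T" by (auto simp: BS adj_rel_def)
      then show "x \<in> B (Suc n)" using Suc embedding_edge[OF t g] by (auto simp: BS adj_rel_def)
    qed
  qed
  have gBn: "g ` B n = B n" for n
    by (rule endo_inj_surj[OF fin gB]) (use g BV[of n] in \<open>auto simp: embedding_def intro: inj_on_subset\<close>)
  have "verts T \<subseteq> g ` verts T"
  proof
    fix v assume "v \<in> verts T"
    then have "(s, v) \<in> (adj_rel T)\<^sup>*"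
      using t s S(1) by (auto simp: is_tree_def graph_connected_def subtree_def subgraph_def)
    then obtain n where "(s, v) \<in> adj_rel T ^^ n" using rtrancl_imp_relpow by metis
    then have "v \<in> B n" using s by (auto simp: B_def)
    then show "v \<in> g ` verts T" using gBn[of n] BV[of n] by blast
  qed
  then show ?thesis using embedding_verts[OF g] by blast
qed

text \<open>Among all geodesics from a vertex to its image a shortest one, \<open>p\<close>, is
  chosen. Minimality prevents its successive images from folding back where they meet, so together
  they form a ray, shifted by the length \<open>m\<close> of \<open>p\<close>.\<close>

lemma nonelliptic_translates:
  assumes t: "is_tree T" and g: "embedding T T g" and ne: "\<not> elliptic T g"
  obtains r k where "ray T r" "translates g r k"
proof -
  define P where "P n \<longleftrightarrow> (\<exists>p. nbwalk T p n \<and> p n = g (p 0))" for n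
  obtain v where v: "v \<in> verts T" using t by (auto simp: is_tree_def)
  obtain p0 n0 where "nbwalk T p0 n0" "p0 0 = v" "p0 n0 = g v"
    by (rule tree_nbwalk[OF t v embedding_verts[OF g v]])
  then have ex: "\<exists>n. P n" by (auto simp: P_def)
  define m where "m = (LEAST n. P n)"
  have "P m" unfolding m_def by (rule LeastI_ex[OF ex])
  have min: "m \<le> n" if "P n" for n unfolding m_def using that by (rule Least_le)
  from \<open>P m\<close> obtain p where p: "nbwalk T p m" "p m = g (p 0)" by (auto simp: P_def)
  have pV: "p i \<in> verts T" if "i \<le> m" for i by (rule nbwalk_verts[OF t p(1) that])
  have pe: "{p i, p (Suc i)} \<in> edges T" if "i < m" for i using p(1) that by (simp add: nbwalk_def)
  have m0: "m > 0"
  proof (rule ccontr)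
    assume "\<not> m > 0"
    then have "g (p 0) = p 0" using p by simp
    then show False using elliptic_fixed[OF t pV] ne by blast
  qed
  \<comment> \<open>If the walk folded back here, removing both end edges would leave a shorter walk
    from \<open>p 1\<close> to its image; for \<open>m = 1\<close> an edge would be
    inverted.\<close>
  have turn: "p (m - 1) \<noteq> g (p 1)"
  proof
    assume eq: "p (m - 1) = g (p 1)"
    show False
    proof (cases "m = 1")
      case True
      then show False using elliptic_swap[OF t pe[of 0], of g] p eq ne by simp
    next
      case False
      then have "nbwalk T (\<lambda>i. p (1 + i)) (m - 2)" using nbwalk_drop[OF t p(1), of 1 "m - 2"] m0 by simp
      moreover have "1 + (m - 2) = m - 1" using False m0 by simp
      ultimately have "P (m - 2)" unfolding P_def using eq by (intro exI[of _ "\<lambda>i. p (1 + i)"]) simp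
      then show False using min[of "m - 2"] m0 by simp
    qed
  qed
  \<comment> \<open>The quotient of \<open>i\<close> by \<open>m\<close> selects the copy of
    \<open>p\<close>, the remainder the position inside it.\<close>
  define r where "r i = (g ^^ (i div m)) (p (i mod m))" for i
  have gp: "embedding T T (g ^^ q)" for q by (rule embedding_funpow[OF g])
  have r: "r (q * m + j) = (g ^^ q) (p j)" if "j \<le> m" for q j
  proof (cases "j = m")
    case True
    then have "r (q * m + j) = (g ^^ Suc q) (p 0)"
      using m0 unfolding r_def by (metis add.commute div_mult_self1_is_m mod_mult_self2_is_0 mult.commute mult_Suc)
    then show ?thesis using p(2) True by (simp add: funpow_swap1)
  next
    case False
    then show ?thesis using that m0 by (simp add: r_def)
  qed
  have "ray T r"
  proof (rule rayI[OF _ _ t])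
    fix n
    define q j where "q = n div m" and "j = n mod m"
    have n: "n = q * m + j" and j: "j < m" using m0 by (auto simp: q_def j_def)
    show "{r n, r (Suc n)} \<in> edges T"
      using r[of j q] r[of "Suc j" q] embedding_edge[OF t gp pe[OF j]] j by (simp add: n)
    show "r n \<noteq> r (Suc (Suc n))"
    proof (cases "Suc (Suc j) \<le> m")
      case True
      then have "p j \<noteq> p (Suc (Suc j))" using p(1) by (simp add: nbwalk_def)
      then show ?thesis
        using r[of j q] r[of "Suc (Suc j)" q] True embedding_eq[OF gp, of "p j" "p (Suc (Suc j))" q] pV
        by (simp add: n)
    next
      case False
      then have j1: "j = m - 1" using j by simp
      then have n2: "Suc (Suc n) = Suc q * m + 1" using m0 by (simp add: n)
      have "r (Suc (Suc n)) = (g ^^ q) (g (p 1))"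
        using r[of 1 "Suc q"] m0 n2 by (simp add: funpow_swap1)
      then show ?thesis
        using r[of j q] turn embedding_eq[OF gp, of "p (m - 1)" "g (p 1)" q] pV embedding_verts[OF g] j m0 j1
        by (simp add: n)
    qed
  qed
  moreover have "translates g r m"
    using m0 by (auto simp: translates_def r_def)
  ultimately show ?thesis using that by blast
qed

context ended_tree
begin

lemma level_translates:
  assumes "embedding T T g" "translates g r k" "v \<in> V"
  shows "level (g v) = level v + int k"
proof -
  obtain m n where mn: "(\<pi> ^^ m) v = r n" by (rule meets_ray[OF assms(3)])
  then have "(\<pi> ^^ m) (g v) = r (n + k)"
    using embedding_parent_pow[OF assms(1) translates_tail_eq[OF assms(2)] assms(3), of m] assms(2)
    by (simp add: translates_def)
  then show ?thesis
    using level_eq[OF assms(3) mn] level_eq[OF embedding_verts[OF assms(1,3)]] by fastforce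
qed

lemma level_translates_pow:
  assumes "embedding T T g" "translates g r k" "v \<in> V"
  shows "level ((g ^^ n) v) = level v + int (n * k)"
  by (induction n)
     (auto simp: level_translates[OF assms(1,2)] embedding_verts[OF embedding_funpow[OF assms(1)] assms(3)]
       algebra_simps)

text \<open>On a ray outside the end of \<open>r\<close> levels eventually fall, so moving forward
  along it lowers the level, whereas \<open>g\<close> raises every level by
  \<open>k\<close>.\<close>

lemma translates_tail_eq_r:
  assumes g: "embedding T T g" and r: "translates g r k" and s: "ray T s" "translates g s j"
  shows "tail_eq s r"
proof (rule ccontr)
  assume n: "\<not> tail_eq s r"
  obtain p where p: "\<And>n. n \<ge> p \<Longrightarrow> \<pi> (s (Suc n)) = s n" by (rule ray_descends[OF s(1) n]) blast
  have "(\<pi> ^^ n) (s (p + n)) = s p" for n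
    by (induction n) (auto simp: p funpow_swap1)
  from this[of j] have "level (s (p + j)) = level (s p) - int j"
    using level_pow[OF ray_verts[OF tree s(1)], of j "p + j"] by simp
  moreover have "level (s (p + j)) = level (s p) + int k"
    using level_translates[OF g r ray_verts[OF tree s(1)], of p] s(2) by (simp add: translates_def)
  ultimately show False using r by (simp add: translates_def)
qed

end

text \<open>Levels grow strictly along an orbit, so no orbit stays inside a finite subtree.\<close>

lemma translates_not_elliptic:
  assumes t: "is_tree T" and g: "embedding T T g" and r: "ray T r" "translates g r k"
  shows "\<not> elliptic T g"
proof
  interpret ended_tree T r by unfold_locales (fact t, fact r)
  assume "elliptic T g"
  then obtain S where S: "subtree S T" "finite (verts S)" "image_graph g S = S"
    by (auto simp: elliptic_def)
  have gS: "g ` verts S = verts S" using S(3) by (metis image_graph_def ugraph.sel(1))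
  obtain s where s: "s \<in> verts S" using S(1) by (auto simp: subtree_def is_tree_def)
  then have sV: "s \<in> V" using S(1) by (auto simp: subtree_def subgraph_def)
  have "(g ^^ n) s \<in> verts S" for n using s gS by (induction n) auto
  then have "finite (range (\<lambda>n. (g ^^ n) s))" using S(2) by (auto intro: finite_subset)
  moreover have "inj (\<lambda>n. (g ^^ n) s)"
  proof (rule injI)
    fix m n assume "(g ^^ m) s = (g ^^ n) s"
    then have "level s + int (m * k) = level s + int (n * k)"
      using level_translates_pow[OF g r(2) sV, of m] level_translates_pow[OF g r(2) sV, of n] by metis
    then show "m = n" using r(2) by (simp add: translates_def)
  qed
  ultimately show False using finite_imageD[of "\<lambda>n. (g ^^ n) s" UNIV] by simp
qed

text \<open>Resolves the definite description: a ray that \<open>g\<close> maps properly into itself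
  is translated by \<open>g\<close>, and all translated rays lie in one end.\<close>

lemma direction_eq:
  assumes t: "is_tree T" and g: "embedding T T g" and r: "ray T r" "translates g r k"
  shows "direction T g = end_of T r"
  unfolding direction_def
proof (rule the_equality)
  interpret ended_tree T r by unfold_locales (fact t, fact r)
  have "strict_subgraph (image_graph g (ray_graph r)) (ray_graph r)"
  proof -
    have "r 0 \<notin> range (\<lambda>n. r (n + k))" using ray_inj[OF t r(1)] r(2) by (auto simp: translates_def)
    moreover have "subgraph (ray_graph (\<lambda>n. r (n + k))) (ray_graph r)"
      by (auto simp: subgraph_def ray_graph_def)
    moreover have "g \<circ> r = (\<lambda>n. r (n + k))" using r(2) by (auto simp: translates_def)
    ultimately show ?thesis
      unfolding strict_subgraph_def image_ray_graph by (auto simp: ray_graph_def)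
  qed
  then show "end_of T r \<in> Ends T \<and> (\<exists>R\<in>end_of T r. strict_subgraph (image_graph g R) R)"
    using r(1) mem_end_of_iff[OF t r(1) r(1)] Ends_eq[OF t] by auto
  fix \<eta> assume "\<eta> \<in> Ends T \<and> (\<exists>R\<in>\<eta>. strict_subgraph (image_graph g R) R)"
  then obtain s0 R where s0: "ray T s0" "\<eta> = end_of T s0" "R \<in> \<eta>" "strict_subgraph (image_graph g R) R"
    using Ends_eq[OF t] by auto
  then obtain s where s: "ray T s" "tail_eq s0 s" "R = ray_graph s"
    using in_end_of[OF t s0(1)] by auto
  have inj: "inj s" "inj (g \<circ> s)" using ray_inj_iff[OF t] s(1) ray_embedding[OF t g s(1)] by auto
  have sub: "strict_subgraph (ray_graph (g \<circ> s)) (ray_graph s)"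
    using s0(4) s(3) by (simp add: image_ray_graph)
  then obtain j where j: "\<And>n. (g \<circ> s) n = s (j + n)"
    using ray_graph_subgraph[OF inj(2,1)] by (auto simp: strict_subgraph_def)
  have "j \<noteq> 0"
  proof
    assume "j = 0"
    then have "g \<circ> s = s" using j by auto
    then show False using sub by (simp add: strict_subgraph_def)
  qed
  then have "translates g s j" using j by (auto simp: translates_def add.commute)
  then have "tail_eq s r" by (rule translates_tail_eq_r[OF g r(2) s(1)])
  then show "\<eta> = end_of T r"
    using end_of_eq_iff[OF t s0(1) r(1)] tail_eq_trans[OF s(2)] s0(2) by simp
qed

lemma embedding_cong: "(\<And>v. v \<in> verts G \<Longrightarrow> f v = g v) \<Longrightarrow> embedding G H f = embedding G H g"
  by (simp add: embedding_def Pi_iff inj_on_def)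

lemma directions_eq:
  assumes t: "is_tree T"
  shows "directions T (Emb T) =
    {end_of T r |r. ray T r \<and> (\<exists>g k. embedding T T g \<and> translates g r k)}"
proof (intro equalityI subsetI)
  fix \<eta> assume "\<eta> \<in> directions T (Emb T)"
  then obtain g where g: "embedding T T g" "\<not> elliptic T g" "\<eta> = direction T g"
    by (auto simp: directions_def Emb_def)
  obtain r k where "ray T r" "translates g r k" by (rule nonelliptic_translates[OF t g(1,2)])
  then show "\<eta> \<in> {end_of T r |r. ray T r \<and> (\<exists>g k. embedding T T g \<and> translates g r k)}"
    using direction_eq[OF t g(1)] g by blast
next
  fix \<eta> assume "\<eta> \<in> {end_of T r |r. ray T r \<and> (\<exists>g k. embedding T T g \<and> translates g r k)}"
  then obtain r g k where r: "\<eta> = end_of T r" "ray T r" "embedding T T g" "translates g r k" by blast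
  let ?g = "restrict g (verts T)"
  have e: "embedding T T ?g" using r(3) embedding_cong[of T ?g g T] by simp
  have tr: "translates ?g r k" using r(4) ray_verts[OF t r(2)] by (auto simp: translates_def)
  have "?g \<in> Emb T" using e by (simp add: Emb_def)
  then show "\<eta> \<in> directions T (Emb T)"
    using translates_not_elliptic[OF t e r(2) tr] direction_eq[OF t e r(2) tr] r(1)
    by (auto simp: directions_def intro!: image_eqI[of _ _ ?g])
qed

lemma directionsI:
  assumes "is_tree T" "ray T r" "embedding T T g" "translates g r k"
  shows "end_of T r \<in> directions T (Emb T)"
  using assms directions_eq by blast

lemma embedding_inverse:
  assumes t: "is_tree T" and h: "embedding T T h" "h ` verts T = verts T"
  shows "embedding T T (inv_into (verts T) h)"
proof -
  have "bij_betw h (verts T) (verts T)" using h by (auto simp: bij_betw_def embedding_def)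
  then have b: "bij_betw (inv_into (verts T) h) (verts T) (verts T)"
    and i: "\<And>y. y \<in> verts T \<Longrightarrow> h (inv_into (verts T) h y) = y"
    by (auto simp: bij_betw_inv_into bij_betw_inv_into_right)
  have v: "inv_into (verts T) h y \<in> verts T" if "y \<in> verts T" for y
    using b that by (auto simp: bij_betw_def)
  then show ?thesis
    unfolding embedding_def
    using b i embedding_edge_iff[OF t t h(1) v v] by (auto simp: bij_betw_def)
qed

text \<open>The conjugate of \<open>g\<close> by \<open>h\<close> translates
  \<open>h \<circ> r\<close>.\<close>

lemma translates_conj:
  assumes t: "is_tree T" and h: "embedding T T h" "h ` verts T = verts T"
    and g: "embedding T T g" "ray T r" "translates g r k"
  shows "end_of T (h \<circ> r) \<in> directions T (Emb T)"
proof -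
  let ?i = "inv_into (verts T) h"
  have "?i (h v) = v" if "v \<in> verts T" for v
    using h that by (auto simp: embedding_def)
  then have "translates (h \<circ> g \<circ> ?i) (h \<circ> r) k"
    using g(3) ray_verts[OF t g(2)] by (auto simp: translates_def)
  moreover have "embedding T T (h \<circ> g \<circ> ?i)"
    using embedding_comp embedding_inverse[OF t h] g(1) h(1) by metis
  ultimately show ?thesis
    by (intro directionsI[OF t ray_embedding[OF t h(1) g(2)]])
qed

lemma surj_comp_iff:
  assumes f: "embedding T T f" and g: "embedding T T g"
  shows "(f \<circ> g) ` verts T = verts T \<longleftrightarrow> f ` verts T = verts T \<and> g ` verts T = verts T"
proof
  assume s: "(f \<circ> g) ` verts T = verts T"
  have sub: "f ` verts T \<subseteq> verts T" "g ` verts T \<subseteq> verts T" using f g by (auto simp: embedding_def)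
  then have fs: "f ` verts T = verts T" using s by (metis image_comp image_mono subset_antisym)
  then have "f ` (g ` verts T) = f ` verts T" using s by (simp add: image_comp)
  then have "g ` verts T = verts T"
    using f sub(2) inj_on_image_eq_iff[of f "verts T"] by (auto simp: embedding_def)
  then show "f ` verts T = verts T \<and> g ` verts T = verts T" using fs by simp
qed (metis image_comp)

lemma surj_pow_iff:
  assumes f: "embedding T T f" and n: "n > 0"
  shows "(f ^^ n) ` verts T = verts T \<longleftrightarrow> f ` verts T = verts T"
  using n
proof (induction n rule: nat_induct_non_zero)
  case 1
  then show ?case by simp
next
  case (Suc n)
  then show ?case using surj_comp_iff[OF f embedding_funpow[OF f, of n]] by simp
qed

section \<open>Two directions\<close>

text \<open>As \<open>h\<close> fixes the end of \<open>r\<close>, it shifts a tail of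
  \<open>r\<close>. A forward shift would make this end the direction of \<open>h\<close>, which is
  the end of \<open>s\<close>, and no shift at all would give a fixed vertex. So \<open>h\<close>
  moves \<open>r\<close> backwards and can be balanced against \<open>g\<close>.\<close>

lemma fixing_direction_surj:
  assumes t: "is_tree T" and lf: "locally_finite T"
    and g: "embedding T T g" "ray T r" "translates g r k"
    and h: "embedding T T h" "ray T s" "translates h s l"
    and n: "\<not> tail_eq r s" and fx: "tail_eq (h \<circ> r) r"
  shows "g ` verts T = verts T \<and> h ` verts T = verts T"
proof -
  obtain p q where pq: "\<And>n. h (r (p + n)) = r (q + n)"
    using fx unfolding tail_eq_def comp_def by metis
  have "\<not> elliptic T h" by (rule translates_not_elliptic[OF t h])
  then have "p \<noteq> q" using elliptic_fixed[OF t ray_verts[OF t g(2)], of h p] pq[of 0] by auto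
  moreover have "\<not> p < q"
  proof
    assume "p < q"
    then have tr: "translates h (\<lambda>n. r (p + n)) (q - p)"
      using pq by (auto simp: translates_def intro!: arg_cong[of _ _ r])
    have "end_of T (\<lambda>n. r (p + n)) = end_of T s"
      using direction_eq[OF t h(1) ray_drop[OF t g(2)] tr] direction_eq[OF t h] by simp
    then have "tail_eq (\<lambda>n. r (p + n)) s" using end_of_eq_iff[OF t ray_drop[OF t g(2)] h(2)] by simp
    then show False using n tail_eq_drop tail_eq_trans tail_eq_sym by blast
  qed
  ultimately have "q < p" by simp
  define a where "a = p - q"
  have a: "a > 0" "p = q + a" using \<open>q < p\<close> by (auto simp: a_def)
  have hr: "(h ^^ m) (r (p + m * a + j)) = r (p + j)" for m j
  proof (induction m)
    case (Suc m)
    have "h (r (p + Suc m * a + j)) = r (p + m * a + j)"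
      using pq[of "Suc m * a + j"] a by (simp add: add_ac)
    then show ?case using Suc by (simp add: funpow_swap1)
  qed simp
  \<comment> \<open>\<open>h ^^ k\<close> moves back by \<open>k * a\<close> and
    \<open>g ^^ a\<close> forward by \<open>a * k\<close>. The start at \<open>p + k * a\<close>
    keeps all intermediate vertices on the tail where the action of \<open>h\<close> is
    known.\<close>
  have "(g ^^ a) ((h ^^ k) (r (p + k * a))) = r (p + k * a)"
    using hr[of k 0] translates_pow[OF g(3), of a p] by (simp add: mult.commute)
  then have "elliptic T (g ^^ a \<circ> h ^^ k)"
    using elliptic_fixed[OF t ray_verts[OF t g(2)]] by simp
  then have "(g ^^ a \<circ> h ^^ k) ` verts T = verts T"
    by (rule elliptic_surj[OF t lf embedding_comp[OF embedding_funpow[OF h(1)] embedding_funpow[OF g(1)]]])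
  then show ?thesis
    using surj_comp_iff embedding_funpow g(1) h(1) surj_pow_iff a g(3) unfolding translates_def by metis
qed

text \<open>If \<open>h\<close> does not fix the direction of \<open>g\<close> and vice versa, then \<open>h \<circ> g\<close> can have neither of
  the two directions, hence is elliptic.\<close>

lemma two_directions_pair:
  assumes t: "is_tree T" and lf: "locally_finite T"
    and g: "embedding T T g" "ray T r" "translates g r k"
    and h: "embedding T T h" "ray T s" "translates h s l"
    and n: "\<not> tail_eq r s" and D: "directions T (Emb T) = {end_of T r, end_of T s}"
  shows "g ` verts T = verts T \<and> h ` verts T = verts T"
proof (cases "tail_eq (h \<circ> r) r \<or> tail_eq (g \<circ> s) s")
  case True
  then show ?thesis
    using fixing_direction_surj[OF t lf g h n] fixing_direction_surj[OF t lf h g] n tail_eq_sym by blast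
next
  case False
  have hg: "embedding T T (h \<circ> g)" by (rule embedding_comp[OF g(1) h(1)])
  have D': "tail_eq x r \<or> tail_eq x s" if "end_of T x \<in> directions T (Emb T)" "ray T x" for x
    using that end_of_eq_iff[OF t that(2)] g(2) h(2) unfolding D by blast
  have gr: "tail_eq (g \<circ> r) r" and hs: "tail_eq (h \<circ> s) s"
    using translates_tail_eq g(3) h(3) by blast+
  show ?thesis
  proof (cases "elliptic T (h \<circ> g)")
    case True
    then have "(h \<circ> g) ` verts T = verts T" by (rule elliptic_surj[OF t lf hg])
    then show ?thesis using surj_comp_iff[OF h(1) g(1)] by simp
  next
    case ne: False
    obtain x m where x: "ray T x" "translates (h \<circ> g) x m" by (rule nonelliptic_translates[OF t hg ne])
    have hx: "tail_eq ((h \<circ> g) \<circ> x) x" by (rule translates_tail_eq[OF x(2)])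
    have "tail_eq x r \<or> tail_eq x s" by (rule D'[OF directionsI[OF t x(1) hg x(2)] x(1)])
    then show ?thesis
    proof
      assume xr: "tail_eq x r"
      have "tail_eq (h \<circ> (g \<circ> r)) r"
        using tail_eq_comp[OF xr, of "h \<circ> g"] hx xr unfolding comp_assoc
        by (meson tail_eq_trans tail_eq_sym)
      moreover have "tail_eq (h \<circ> (g \<circ> r)) (h \<circ> r)" by (rule tail_eq_comp[OF gr])
      ultimately show ?thesis using False tail_eq_trans tail_eq_sym by metis
    next
      assume xs: "tail_eq x s"
      have "tail_eq (h \<circ> (g \<circ> s)) s"
        using tail_eq_comp[OF xs, of "h \<circ> g"] hx xs unfolding comp_assoc
        by (meson tail_eq_trans tail_eq_sym)
      then have "tail_eq (h \<circ> (g \<circ> s)) (h \<circ> s)" using tail_eq_trans tail_eq_sym[OF hs] by metis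
      \<comment> \<open>Since \<open>h\<close> sends both \<open>g \<circ> s\<close> and
        \<open>s\<close> into one end, injectivity allows it to be cancelled.\<close>
      then have "tail_eq (g \<circ> s) s"
        by (rule tail_eq_comp_inj[OF t ray_embedding[OF t g(1) h(2)] h(2) h(1)])
      then show ?thesis using False by simp
    qed
  qed
qed

lemma no_direction_surj:
  assumes "is_tree T" "locally_finite T" "directions T (Emb T) = {}" "embedding T T f"
  shows "f ` verts T = verts T"
  using nonelliptic_translates[OF assms(1,4)] directionsI[OF assms(1) _ assms(4)] assms
    elliptic_surj by (metis empty_iff)

lemma two_directions_surj:
  assumes t: "is_tree T" and lf: "locally_finite T" and D: "card (directions T (Emb T)) = 2"
    and f: "embedding T T f"
  shows "f ` verts T = verts T"
proof (cases "elliptic T f")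
  case True
  then show ?thesis by (rule elliptic_surj[OF t lf f])
next
  case False
  then obtain x m where x: "ray T x" "translates f x m" by (rule nonelliptic_translates[OF t f])
  then have "end_of T x \<in> directions T (Emb T)" by (intro directionsI[OF t _ f])
  then obtain \<eta> where \<eta>: "directions T (Emb T) = {end_of T x, \<eta>}" "\<eta> \<noteq> end_of T x"
    using D by (metis card_2_iff doubleton_eq_iff insertE singletonD)
  then have "\<eta> \<in> directions T (Emb T)" by simp
  then obtain y h l where y: "\<eta> = end_of T y" "ray T y" "embedding T T h" "translates h y l"
    unfolding directions_eq[OF t] by blast
  have "\<not> tail_eq x y" using \<eta>(2) y end_of_eq_iff[OF t x(1) y(2)] by simp
  then show ?thesis using two_directions_pair[OF t lf f x y(3,2,4)] \<eta>(1) y(1) by simp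
qed

section \<open>One direction\<close>

text \<open>A sibling embeds as an infinite connected set of vertices of the ray, hence as a tail,
  and a tail is isomorphic to the whole ray.\<close>

lemma Sib_ray:
  assumes t: "is_tree T" and s: "ray T s" and V: "verts T = range s"
  shows "Sib T = 1"
proof (rule Sib_eq_1I[OF t])
  fix S :: "'a ugraph" assume "siblings S T"
  then obtain f h where S: "is_tree S" and f: "embedding S T f" and h: "embedding T S h"
    by (auto simp: siblings_def)
  have inj: "s m = s n \<longleftrightarrow> m = n" for m n by (rule ray_inj[OF t s])
  define N where "N = {n. s n \<in> f ` verts S}"
  have sN: "f ` verts S = s ` N"
  proof (intro equalityI subsetI)
    fix y assume y: "y \<in> f ` verts S"
    then have "y \<in> range s" using embedding_verts[OF f] unfolding V by blast
    then obtain n where "y = s n" by blast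
    then show "y \<in> s ` N" using y by (simp add: N_def)
  qed (auto simp: N_def)
  have "infinite N"
  proof
    assume "finite N"
    then have "finite (f ` verts S)" by (simp add: sN)
    then have "finite (verts S)" using f by (auto simp: embedding_def dest: finite_imageD)
    then have "finite (h ` range s)" using embedding_verts[OF h] V by (metis finite_subset image_subsetI)
    then have "finite (range s)" using h V by (auto simp: embedding_def dest: finite_imageD)
    then show False using inj finite_imageD[of s UNIV] by (auto simp: inj_def)
  qed
  define a where "a = (LEAST n. n \<in> N)"
  have aN: "a \<in> N" unfolding a_def using \<open>infinite N\<close> by (metis LeastI finite.emptyI ex_in_conv)
  have a_le: "a \<le> n" if "n \<in> N" for n unfolding a_def using that by (rule Least_le)
  have N: "N = {a..}"
  proof (intro equalityI subsetI)
    fix n assume n: "n \<in> {a..}"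
    obtain m where m: "m \<in> N" "n \<le> m" using \<open>infinite N\<close> by (metis infinite_nat_iff_unbounded_le)
    obtain u v where uv: "u \<in> verts S" "v \<in> verts S" "f u = s a" "f v = s m"
      using aN m(1) by (auto simp: N_def)
    obtain p l where p: "nbwalk S p l" "p 0 = u" "p l = v" by (rule tree_nbwalk[OF S uv(1,2)])
    have "nbwalk T (f \<circ> p) l" by (rule nbwalk_embedding[OF f S p(1)])
    moreover have "nbwalk T (\<lambda>i. s (a + i)) (m - a)" using ray_drop[OF t s] by (auto simp: ray_def)
    ultimately have "l = m - a \<and> (\<forall>i\<le>l. (f \<circ> p) i = s (a + i))"
      by (rule nbwalk_unique[OF t]) (use p uv m n in auto)
    moreover from this have "n - a \<le> l" using m n by auto
    ultimately have "f (p (n - a)) = s n" "p (n - a) \<in> verts S"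
      using n nbwalk_verts[OF S p(1)] by auto
    then show "n \<in> N" unfolding N_def by (metis (mono_tags) image_eqI mem_Collect_eq)
  qed (use a_le in auto)
  \<comment> \<open>The embedding \<open>f\<close> followed by the shift that moves the tail
    starting at \<open>s a\<close> back to \<open>s 0\<close>.\<close>
  define e where "e v = s ((THE n. s n = f v) - a)" for v
  have e: "e v = s n" if "f v = s (a + n)" for v n
    using that inj by (simp add: e_def)
  have fe: "\<exists>n. f v = s (a + n) \<and> e v = s n" if "v \<in> verts S" for v
  proof -
    have "f v \<in> s ` N" using that sN by blast
    then obtain n where "n \<ge> a" "f v = s n" by (auto simp: N)
    then have "f v = s (a + (n - a))" by simp
    then show ?thesis using e by blast
  qed
  have "embedding S T e"
    unfolding embedding_def
  proof (intro conjI ballI impI)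
    show "e \<in> verts S \<rightarrow> verts T" using fe V by fastforce
    show "inj_on e (verts S)"
      using fe inj embedding_eq[OF f] by (metis (no_types, lifting) inj_on_def)
    fix u v assume uv: "u \<in> verts S" "v \<in> verts S" "{u, v} \<in> edges S"
    obtain m n where mn: "f u = s (a + m)" "e u = s m" "f v = s (a + n)" "e v = s n"
      using fe uv by metis
    interpret ended_tree T s by unfold_locales (fact t, fact s)
    have "{s (a + m), s (a + n)} \<in> edges T" using embedding_edge[OF S f uv(3)] mn by simp
    then have "n = Suc m \<or> m = Suc n"
      using edge_iff_parent[of "s (a + m)" "s (a + n)"] parent_ray[OF s] inj by auto
    then show "{e u, e v} \<in> edges T" using mn ray_edge[OF s] by (auto simp: insert_commute)
  qed
  moreover have "e ` verts S = verts T"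
  proof
    show "e ` verts S \<subseteq> verts T" using fe V by fastforce
    show "verts T \<subseteq> e ` verts S"
    proof
      fix x assume "x \<in> verts T"
      then obtain n where x: "x = s n" using V by auto
      have "s (a + n) \<in> f ` verts S" using sN N by auto
      then obtain v where "v \<in> verts S" "f v = s (a + n)" by auto
      then show "x \<in> e ` verts S" using e[of v n] x by (metis imageI)
    qed
  qed
  ultimately show "isomorphic S T" by (rule isomorphic_embedding[OF S t])
qed

section \<open>Boundary vertices and finite cones\<close>

context ended_tree
begin

lemma exists_boundary:
  assumes A: "up_closed A" and v: "v \<in> V" "v \<notin> A"
  obtains n where "(\<pi> ^^ n) v \<notin> A" "(\<pi> ^^ Suc n) v \<in> A"
proof -
  obtain u where u: "u \<in> A" "u \<in> V" using A by (auto simp: up_closed_def)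
  obtain m n where "(\<pi> ^^ m) u = (\<pi> ^^ n) v" by (rule common_ancestor[OF u(2) v(1)])
  then have "(\<pi> ^^ n) v \<in> A" using up_closed_pow[OF A u(1)] by metis
  then have "\<exists>n. (\<pi> ^^ n) v \<notin> A \<and> (\<pi> ^^ Suc n) v \<in> A"
    using v(2) by (induction n) auto
  then show ?thesis using that by blast
qed

lemma up_closed_image:
  assumes "embedding T T h" "tail_eq (h \<circ> r) r" "up_closed A"
  shows "up_closed (h ` A)"
proof -
  have "\<pi> (h v) \<in> h ` A" if "v \<in> A" for v
  proof -
    have "v \<in> V" "\<pi> v \<in> A" using assms(3) that by (auto simp: up_closed_def)
    then show ?thesis using embedding_parent_V[OF assms(1,2), of v] by (metis imageI)
  qed
  moreover have "h ` A \<subseteq> V" using assms(3) embedding_verts[OF assms(1)] by (auto simp: up_closed_def)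
  ultimately show ?thesis using assms(3) by (auto simp: up_closed_def)
qed

definition descendants :: "'a \<Rightarrow> 'a set" where
  "descendants w = {v \<in> V. \<exists>n. (\<pi> ^^ n) v = w}"

text \<open>Vertices below \<open>r i\<close>, restricted to depths in \<open>J\<close>. For finite
  \<open>J\<close> this is a finite set even if infinitely many vertices lie below
  \<open>r i\<close>.\<close>

definition cone :: "nat \<Rightarrow> nat set \<Rightarrow> 'a set" where
  "cone i J = {v \<in> V. \<exists>j\<in>J. (\<pi> ^^ j) v = r i}"

text \<open>The order of the quantifiers matters: raising the apex \<open>r i\<close> increases the
  depth of every vertex, so \<open>N\<close> can only be chosen after \<open>i\<close>.\<close>

lemma eventually_cone:
  assumes "finite F" "F \<subseteq> V"
  shows "\<forall>\<^sub>F i in sequentially. \<forall>\<^sub>F N in sequentially. F \<subseteq> cone i {..N}"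
proof -
  have "\<forall>\<^sub>F i in sequentially. \<forall>\<^sub>F N in sequentially. v \<in> cone i {..N}" if "v \<in> F" for v
  proof -
    have v: "v \<in> V" using assms(2) that by blast
    obtain m n where mn: "(\<pi> ^^ m) v = r n" by (rule meets_ray[OF v])
    have "\<forall>\<^sub>F N in sequentially. v \<in> cone i {..N}" if "i \<ge> n" for i
    proof (rule eventually_sequentiallyI[of "i - n + m"])
      fix N assume "i - n + m \<le> N"
      moreover have "(\<pi> ^^ (i - n + m)) v = r i"
        using pow_shift[OF mn, of "i - n"] that by (simp add: parent_pow_r)
      ultimately show "v \<in> cone i {..N}" using v by (auto simp: cone_def)
    qed
    then show ?thesis by (rule eventually_sequentiallyI)
  qed
  then have "\<forall>\<^sub>F i in sequentially. \<forall>v\<in>F. \<forall>\<^sub>F N in sequentially. v \<in> cone i {..N}"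
    by (simp add: eventually_ball_finite_distrib[OF assms(1)])
  then show ?thesis
  proof (rule eventually_mono)
    fix i assume "\<forall>v\<in>F. \<forall>\<^sub>F N in sequentially. v \<in> cone i {..N}"
    then have "\<forall>\<^sub>F N in sequentially. \<forall>v\<in>F. v \<in> cone i {..N}"
      by (simp only: eventually_ball_finite_distrib[OF assms(1)])
    then show "\<forall>\<^sub>F N in sequentially. F \<subseteq> cone i {..N}" by (simp only: subset_iff Ball_def)
  qed
qed

lemma finite_preimages:
  assumes lf: "locally_finite T" and w: "w \<in> V"
  shows "finite {v \<in> V. (\<pi> ^^ n) v = w}"
proof (induction n)
  case 0
  have "{v \<in> V. (\<pi> ^^ 0) v = w} \<subseteq> {w}" by auto
  then show ?case using finite_subset by blast
next
  case (Suc n)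
  have "finite {v \<in> V. \<pi> v = u}" if "u \<in> V" for u
    by (rule finite_subset[of _ "{v. {u, v} \<in> edges T}"])
       (use lf that parent_edge in \<open>auto simp: locally_finite_def insert_commute\<close>)
  moreover have "{v \<in> V. (\<pi> ^^ Suc n) v = w} \<subseteq> (\<Union>u\<in>{u \<in> V. (\<pi> ^^ n) u = w}. {v \<in> V. \<pi> v = u})"
    using parent_V by (auto simp: funpow_swap1)
  ultimately show ?case using Suc finite_subset by blast
qed

lemma finite_cone:
  assumes lf: "locally_finite T" and J: "finite J"
  shows "finite (cone i J)"
proof -
  have "cone i J = (\<Union>j\<in>J. {v \<in> V. (\<pi> ^^ j) v = r i})" by (auto simp: cone_def)
  then show ?thesis using finite_preimages[OF lf r_in_V] J by auto
qed

end

section \<open>Counting vertices in cones\<close>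

locale one_direction = ended_tree T r for T :: "'a ugraph" and r +
  fixes g :: "'a \<Rightarrow> 'a" and k :: nat
  assumes locally_finite: "locally_finite T"
    and g: "embedding T T g"
    and g_translates: "translates g r k"
    and fixing: "\<And>h. embedding T T h \<Longrightarrow> tail_eq (h \<circ> r) r"
    and not_surj: "g ` verts T \<noteq> verts T"
begin

lemma g_pow: "embedding T T (g ^^ n)"
  by (rule embedding_funpow[OF g])

lemma g_pow_r: "(g ^^ n) (r i) = r (i + n * k)"
  by (rule translates_pow[OF g_translates])

lemma k_pos: "k > 0"
  using g_translates by (simp add: translates_def)

lemma g_pow_V: "v \<in> V \<Longrightarrow> (g ^^ n) v \<in> V"
  by (rule embedding_verts[OF g_pow])

lemma g_pow_eq: "u \<in> V \<Longrightarrow> v \<in> V \<Longrightarrow> (g ^^ n) u = (g ^^ n) v \<longleftrightarrow> u = v"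
  by (rule embedding_eq[OF g_pow])

lemma g_pow_parent: "v \<in> V \<Longrightarrow> (g ^^ n) ((\<pi> ^^ m) v) = (\<pi> ^^ m) ((g ^^ n) v)"
  by (rule embedding_parent_pow[OF g_pow fixing[OF g_pow]])

lemma level_g_pow: "v \<in> V \<Longrightarrow> level ((g ^^ n) v) = level v + int (n * k)"
  by (rule level_translates_pow[OF g g_translates])

text \<open>The isomorphism commutes with the parent function and maps some \<open>r p\<close> to
  some \<open>r q\<close>; from there on it carries cones to cones, depth by depth.\<close>

lemma isomorphic_shift:
  assumes A: "up_closed A" "embedding T T f" "f ` V \<subseteq> A" and B: "up_closed B"
    and iso: "isomorphic (induced T A) (induced T B)"
  obtains p q where "\<And>n J. finite J \<Longrightarrow> card (A \<inter> cone (p + n) J) = card (B \<inter> cone (q + n) J)"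
proof -
  have AV: "A \<subseteq> V" "B \<subseteq> V" using A B by (auto simp: up_closed_def)
  obtain \<phi> where \<phi>: "embedding (induced T A) (induced T B) \<phi>" "bij_betw \<phi> A B"
    using isomorphic_obtain[OF up_closed_tree[OF A(1)] up_closed_tree[OF B] iso] by auto
  have \<phi>T: "embedding (induced T A) T \<phi>"
    using embedding_comp[OF \<phi>(1) induced_embedding[OF AV(2)]] by simp
  have fA: "embedding T (induced T A) f" by (rule embedding_induced[OF tree A(2,3)])
  \<comment> \<open>Here a copy of \<open>T\<close> inside \<open>A\<close> is essential:
    \<open>fixing\<close> speaks of embeddings of the whole tree.\<close>
  have "tail_eq (\<phi> \<circ> f \<circ> r) r" by (rule fixing[OF embedding_comp[OF fA \<phi>T]])
  then have par: "\<phi> (\<pi> v) = \<pi> (\<phi> v)" if "v \<in> A" for v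
    using embedding_parent[OF A(1) \<phi>T ray_embedding[OF tree A(2) ray] fixing[OF A(2)] _ _ that]
      A(3) r_in_V by (auto simp: comp_assoc)
  have parn: "\<phi> ((\<pi> ^^ n) v) = (\<pi> ^^ n) (\<phi> v)" if "v \<in> A" for v n
    using up_closed_pow[OF A(1) that] by (induction n) (auto simp: par)
  have inj: "inj_on \<phi> A" and img: "\<phi> ` A = B" using \<phi>(2) by (auto simp: bij_betw_def)
  obtain a where a: "a \<in> A" using A(1) by (auto simp: up_closed_def)
  then obtain l m where "(\<pi> ^^ l) a = r m" using meets_ray AV by blast
  then have rm: "r m \<in> A" using up_closed_pow[OF A(1) a] by metis
  have "\<phi> (r m) \<in> V" using rm img AV by blast
  then obtain j q where q: "(\<pi> ^^ j) (\<phi> (r m)) = r q" by (rule meets_ray)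
  define p where "p = m + j"
  have rp: "r (p + n) \<in> A" for n
    using up_closed_pow[OF A(1) rm, of "j + n"] by (simp add: parent_pow_r p_def add.assoc)
  have \<phi>r: "\<phi> (r (p + n)) = r (q + n)" for n
    using parn[OF rm, of "n + j"] pow_shift[OF q, of n] parent_pow_r by (simp add: p_def add_ac)
  have "card (A \<inter> cone (p + n) J) = card (B \<inter> cone (q + n) J)" for n J
  proof (rule bij_betw_same_card[of \<phi>])
    have iff: "\<phi> v \<in> cone (q + n) J \<longleftrightarrow> v \<in> cone (p + n) J" if v: "v \<in> A" for v
    proof -
      have "(\<pi> ^^ i) (\<phi> v) = r (q + n) \<longleftrightarrow> (\<pi> ^^ i) v = r (p + n)" for i
        unfolding parn[OF v, symmetric] \<phi>r[symmetric]
        by (rule inj_on_eq_iff[OF inj up_closed_pow[OF A(1) v] rp])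
      moreover have "v \<in> V" "\<phi> v \<in> V" using v img AV by auto
      ultimately show ?thesis by (simp add: cone_def)
    qed
    show "bij_betw \<phi> (A \<inter> cone (p + n) J) (B \<inter> cone (q + n) J)"
      unfolding bij_betw_def using inj img iff by (auto intro: inj_on_subset)
  qed
  then show ?thesis using that by blast
qed

text \<open>The difference between the sizes of \<open>A\<close> and \<open>Y\<close>, meaningful
  also for infinite sets as long as their symmetric difference is finite.\<close>

definition excess :: "'a set \<Rightarrow> 'a set \<Rightarrow> int" where
  "excess A Y = int (card (A - Y)) - int (card (Y - A))"

lemma card_cone_excess:
  assumes "A \<subseteq> V" "Y \<subseteq> V" "finite (A - Y)" "finite (Y - A)"
  shows "\<forall>\<^sub>F i in sequentially. \<forall>\<^sub>F N in sequentially.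
    int (card (A \<inter> cone i {..N})) = int (card (Y \<inter> cone i {..N})) + excess A Y"
proof -
  have *: "int (card (A \<inter> C)) = int (card (Y \<inter> C)) + excess A Y"
    if C: "finite C" "(A - Y) \<union> (Y - A) \<subseteq> C" for C
  proof -
    have "A \<inter> C = (A \<inter> Y \<inter> C) \<union> (A - Y)" "Y \<inter> C = (A \<inter> Y \<inter> C) \<union> (Y - A)" using C(2) by auto
    moreover have "card ((A \<inter> Y \<inter> C) \<union> (A - Y)) = card (A \<inter> Y \<inter> C) + card (A - Y)"
      "card ((A \<inter> Y \<inter> C) \<union> (Y - A)) = card (A \<inter> Y \<inter> C) + card (Y - A)"
      by (rule card_Un_disjoint; use C assms in auto)+
    ultimately show ?thesis by (simp add: excess_def)
  qed
  have "\<forall>\<^sub>F i in sequentially. \<forall>\<^sub>F N in sequentially. (A - Y) \<union> (Y - A) \<subseteq> cone i {..N}"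
    by (rule eventually_cone) (use assms in auto)
  then show ?thesis
    by (rule eventually_mono) (erule eventually_mono, rule *[OF finite_cone[OF locally_finite]], auto)
qed

text \<open>The vertices of \<open>Y\<close> in the cones of \<open>r i\<close> and of
  \<open>r (i + k * d)\<close>, for \<open>d = q - p\<close>, are compared in two ways. By
  \<open>k\<close> rounds of the shift the numbers differ by exactly \<open>k\<close> times the
  difference of the excesses. But \<open>g ^^ d\<close> maps the first set injectively into the
  second and misses \<open>W\<close>, so they differ by at least \<open>card W\<close>.\<close>

lemma excess_le:
  assumes Y: "up_closed Y" "g ` Y \<subseteq> Y"
    and A: "A \<subseteq> V" "finite (A - Y)" "finite (Y - A)" and B: "B \<subseteq> V" "finite (B - Y)" "finite (Y - B)"
    and sh: "\<And>n J. finite J \<Longrightarrow> card (A \<inter> cone (p + n) J) = card (B \<inter> cone (q + n) J)"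
    and pq: "p < q" and W: "finite W" "W \<subseteq> Y - g ` Y"
  shows "int (card W) \<le> int k * (excess A Y - excess B Y)"
proof -
  define d where "d = q - p"
  define c where "c i N = int (card (Y \<inter> cone i {..N}))" for i N
  define \<mu> where "\<mu> = excess A Y - excess B Y"
  have YV: "Y \<subseteq> V" using Y(1) by (simp add: up_closed_def)
  obtain a where a: "\<And>i. i \<ge> a \<Longrightarrow> \<forall>\<^sub>F N in sequentially. int (card (A \<inter> cone i {..N})) = c i N + excess A Y"
    using card_cone_excess[OF A(1) YV A(2,3), THEN eventually_sequentially[THEN iffD1]]
    unfolding c_def by blast
  obtain b where b: "\<And>i. i \<ge> b \<Longrightarrow> \<forall>\<^sub>F N in sequentially. int (card (B \<inter> cone i {..N})) = c i N + excess B Y"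
    using card_cone_excess[OF B(1) YV B(2,3), THEN eventually_sequentially[THEN iffD1]]
    unfolding c_def by blast
  obtain w where w: "\<And>i. i \<ge> w \<Longrightarrow> \<forall>\<^sub>F N in sequentially. W \<subseteq> cone i {..N}"
    using eventually_cone[OF W(1) subset_trans[OF W(2)], THEN eventually_sequentially[THEN iffD1]] YV
    by blast
  define i where "i = a + b + w + p"
  \<comment> \<open>The shift matches \<open>A\<close> below \<open>r j\<close> with
    \<open>B\<close> below \<open>r (j + d)\<close>; replacing both by \<open>Y\<close> costs the
    two excesses, whose difference is \<open>\<mu>\<close>.\<close>
  have step: "\<forall>\<^sub>F N in sequentially. c (j + d) N = c j N + \<mu>" if "j \<ge> i" for j
  proof -
    have "j + d \<ge> b" "j \<ge> a" using that by (auto simp: i_def)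
    from a[OF this(2)] b[OF this(1)] show ?thesis
    proof eventually_elim
      case (elim N)
      have "p + (j - p) = j" "q + (j - p) = j + d" using that pq by (auto simp: i_def d_def)
      then have "card (A \<inter> cone j {..N}) = card (B \<inter> cone (j + d) {..N})"
        using sh[of "{..N}" "j - p"] by simp
      then show ?case using elim by (simp add: \<mu>_def)
    qed
  qed
  have iter: "\<forall>\<^sub>F N in sequentially. c (i + n * d) N = c i N + int n * \<mu>" for n
  proof (induction n)
    case (Suc n)
    have "\<forall>\<^sub>F N in sequentially. c (i + n * d + d) N = c (i + n * d) N + \<mu>" by (rule step) simp
    with Suc show ?case by eventually_elim (simp add: algebra_simps)
  qed simp
  have d0: "d > 0" using pq by (simp add: d_def)
  have gY: "(g ^^ n) ` Y \<subseteq> Y" for n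
    using Y(2) by (induction n) (auto simp: image_subset_iff)
  have WY: "W \<subseteq> Y - (g ^^ d) ` Y"
  proof -
    obtain d' where "d = Suc d'" using d0 by (cases d) auto
    then have "(g ^^ d) ` Y \<subseteq> g ` Y" using gY[of d'] by auto
    then show ?thesis using W(2) by blast
  qed
  have "i + k * d \<ge> w" by (simp add: i_def)
  from eventually_conj[OF w[OF this] iter[of k]]
  obtain N where N: "W \<subseteq> cone (i + k * d) {..N}" "c (i + k * d) N = c i N + int k * \<mu>"
    by (auto dest: eventually_happens)
  \<comment> \<open>\<open>g ^^ d\<close> moves \<open>r i\<close> by \<open>d * k\<close>, which is
    also the effect of \<open>k\<close> shifts by \<open>d\<close>; depths are kept because
    \<open>g\<close> commutes with the parent function.\<close>
  have "(g ^^ d) ` (Y \<inter> cone i {..N}) \<subseteq> Y \<inter> cone (i + k * d) {..N}"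
  proof
    fix x assume "x \<in> (g ^^ d) ` (Y \<inter> cone i {..N})"
    then obtain v j where v: "x = (g ^^ d) v" "v \<in> Y" "v \<in> V" "j \<le> N" "(\<pi> ^^ j) v = r i"
      by (auto simp: cone_def)
    then have "(\<pi> ^^ j) x = r (i + k * d)"
      using g_pow_parent[of v d j] g_pow_r[of d i] by (simp add: mult.commute)
    then show "x \<in> Y \<inter> cone (i + k * d) {..N}" using v gY[of d] g_pow_V by (auto simp: cone_def)
  qed
  then have "(g ^^ d) ` (Y \<inter> cone i {..N}) \<union> W \<subseteq> Y \<inter> cone (i + k * d) {..N}"
    using N(1) W(2) by auto
  moreover have fin: "finite (cone j {..N})" for j by (rule finite_cone[OF locally_finite]) simp
  ultimately have "card ((g ^^ d) ` (Y \<inter> cone i {..N}) \<union> W) \<le> card (Y \<inter> cone (i + k * d) {..N})"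
    by (intro card_mono) auto
  moreover have "card ((g ^^ d) ` (Y \<inter> cone i {..N}) \<union> W) = card ((g ^^ d) ` (Y \<inter> cone i {..N})) + card W"
    by (rule card_Un_disjoint) (use fin W WY in auto)
  moreover have "card ((g ^^ d) ` (Y \<inter> cone i {..N})) = card (Y \<inter> cone i {..N})"
    by (rule card_image) (use YV in \<open>auto simp: inj_on_def g_pow_eq subset_iff\<close>)
  ultimately show ?thesis using N(2) by (simp add: c_def \<mu>_def)
qed

text \<open>The embedding \<open>g\<close> pushes vertices out of every cone, so an isomorphism that shifts the
  distinguished ray would have to change the number of vertices.\<close>

lemma isomorphic_no_shift:
  assumes Y: "up_closed Y" "g ` Y \<subseteq> Y" "g ` Y \<noteq> Y"
    and A: "up_closed A" "embedding T T f" "f ` V \<subseteq> A" "finite (A - Y)" "finite (Y - A)"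
    and B: "up_closed B" "finite (B - Y)" "finite (Y - B)"
    and iso: "isomorphic (induced T A) (induced T B)"
    and inf: "infinite (Y - g ` Y) \<or> excess A Y = excess B Y"
  obtains p where "\<And>n J. finite J \<Longrightarrow> card (A \<inter> cone (p + n) J) = card (B \<inter> cone (p + n) J)"
proof -
  obtain p q where pq: "\<And>n J. finite J \<Longrightarrow> card (A \<inter> cone (p + n) J) = card (B \<inter> cone (q + n) J)"
    by (rule isomorphic_shift[OF A(1-3) B(1) iso]) blast
  have AB: "A \<subseteq> V" "B \<subseteq> V" using A B by (auto simp: up_closed_def)
  \<comment> \<open>An infinite difference supplies arbitrarily large sets \<open>W\<close>. If it
    is finite, the excesses agree, and then a single vertex contradicts the bound.\<close>
  have large: "\<exists>W. finite W \<and> W \<subseteq> Y - g ` Y \<and> int (card W) > int k * \<mu>"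
    if "infinite (Y - g ` Y) \<or> \<mu> = 0" for \<mu>
  proof (cases "infinite (Y - g ` Y)")
    case True
    then obtain W where "W \<subseteq> Y - g ` Y" "finite W" "card W = nat (int k * \<mu>) + 1"
      by (metis infinite_arbitrarily_large)
    then show ?thesis by (intro exI[of _ W]) auto
  next
    case False
    then have "\<mu> = 0" using that by simp
    moreover obtain x where "x \<in> Y - g ` Y" using Y(2,3) by blast
    ultimately show ?thesis by (intro exI[of _ "{x}"]) auto
  qed
  have "\<not> p < q" 
    using large[of "excess A Y - excess B Y"] inf
      excess_le[OF Y(1,2) AB(1) A(4,5) AB(2) B(2,3) pq] by fastforce
  moreover have "\<not> q < p" 
    using large[of "excess B Y - excess A Y"] inf
      excess_le[OF Y(1,2) AB(2) B(2,3) AB(1) A(4,5) pq[symmetric]] by fastforce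
  ultimately show ?thesis using pq that[of p] by simp
qed

text \<open>The reference set is the image of \<open>g\<close>, enlarged by \<open>m\<close>
  vertices of its complement. A second application of \<open>g\<close> again misses infinitely many
  vertices of the image, so shifts are excluded whatever the excesses are, and \<open>m\<close> can
  be read off from the cones.\<close>

lemma Sib_inf_infinite_complement:
  assumes "infinite (V - g ` V)"
  shows "Sib T = \<infinity>"
proof -
  let ?Y = "g ` V"
  have Y: "up_closed ?Y" by (rule up_closed_image[OF g fixing[OF g] up_closed_V])
  have gV: "g ` V \<subseteq> V" using embedding_verts[OF g] by blast
  have gi: "inj_on g V" using g by (simp add: embedding_def)
  have "\<exists>A. up_closed A \<and> ?Y \<subseteq> A \<and> finite (A - ?Y) \<and> card (A - ?Y) = m" for m
  proof (induction m)
    case 0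
    then show ?case using Y by (intro exI[of _ ?Y]) auto
  next
    case (Suc m)
    then obtain A where A: "up_closed A" "?Y \<subseteq> A" "finite (A - ?Y)" "card (A - ?Y) = m" by blast
    have "V - ?Y \<noteq> A - ?Y" using A(3) assms by metis
    then obtain v where "v \<in> V" "v \<notin> A" using A(1) by (auto simp: up_closed_def)
    \<comment> \<open>The last vertex outside \<open>A\<close> on the way up from \<open>v\<close>
      can be added without losing closure under parents.\<close>
    then obtain n where n: "(\<pi> ^^ n) v \<notin> A" "(\<pi> ^^ Suc n) v \<in> A" by (rule exists_boundary[OF A(1)])
    let ?w = "(\<pi> ^^ n) v"
    have "up_closed (insert ?w A)"
      using A(1) n parent_pow_V[OF \<open>v \<in> V\<close>] by (auto simp: up_closed_def)
    moreover have "insert ?w A - ?Y = insert ?w (A - ?Y)" using n A(2) by auto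
    ultimately show ?case using A n by (intro exI[of _ "insert ?w A"]) auto
  qed
  then obtain A where A: "\<And>m. up_closed (A m)" "\<And>m. ?Y \<subseteq> A m" "\<And>m. finite (A m - ?Y)"
    "\<And>m. card (A m - ?Y) = m" by metis
  have ex: "excess (A m) ?Y = int m" for m
    using A(2,4)[of m] by (simp add: excess_def Diff_eq_empty_iff[THEN iffD2])
  have inf: "infinite (?Y - g ` ?Y)"
  proof -
    have "?Y - g ` ?Y = g ` (V - ?Y)"
      using inj_on_image_set_diff[OF gi, of V ?Y] gV by auto
    then show ?thesis using assms finite_imageD[of g "V - ?Y"] gi by (auto intro: inj_on_subset)
  qed
  show ?thesis
  proof (rule Sib_eq_infI[where A = UNIV and F = "\<lambda>m. induced T (A m)"])
    fix m :: nat
    show "siblings (induced T (A m)) T"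
      by (rule siblings_induced[OF tree up_closed_tree[OF A(1)] _ g A(2)])
         (use A(1)[of m] in \<open>auto simp: up_closed_def\<close>)
  next
    fix m n :: nat assume iso: "isomorphic (induced T (A m)) (induced T (A n))"
    have fin: "finite (?Y - A l)" for l using A(2)[of l] by (simp add: Diff_eq_empty_iff[THEN iffD2])
    have gY: "g ` ?Y \<subseteq> ?Y" "g ` ?Y \<noteq> ?Y" using gV inf by (auto intro: image_mono)
    obtain p where p: "\<And>n' J. finite J \<Longrightarrow> card (A m \<inter> cone (p + n') J) = card (A n \<inter> cone (p + n') J)"
      by (rule isomorphic_no_shift[OF Y gY A(1) g A(2,3) fin A(1,3) fin iso]) (use inf in blast)+
    have YV: "?Y \<subseteq> V" and AV: "A l \<subseteq> V" for l using gV A(1) by (auto simp: up_closed_def)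
    have "\<forall>\<^sub>F i in sequentially. i \<ge> p" by (rule eventually_ge_at_top)
    with card_cone_excess[OF AV YV A(3) fin, of m] card_cone_excess[OF AV YV A(3) fin, of n]
    have "\<forall>\<^sub>F i in sequentially. \<forall>\<^sub>F N in sequentially. int m = int n"
    proof eventually_elim
      case (elim i)
      from elim(1,2) show ?case
      proof eventually_elim
        case (elim N)
        have "p + (i - p) = i" using \<open>i \<ge> p\<close> by simp
        then have "card (A m \<inter> cone i {..N}) = card (A n \<inter> cone i {..N})"
          using p[of "{..N}" "i - p"] by simp
        then show ?case using elim unfolding ex by linarith
      qed
    qed
    then show "m = n" by (auto dest: eventually_happens)
  qed simp
qed

section \<open>Finite complement: removable leaves, core and axis\<close>

definition core :: "'a set" where
  "core = (\<Inter>n. (g ^^ n) ` V)"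

text \<open>Vertices that some power of \<open>g\<close> moves to one of their ancestors. The
  exponent \<open>t * k\<close> is forced, since \<open>g\<close> raises levels by
  \<open>k\<close>.\<close>

definition axis :: "'a set" where
  "axis = {v \<in> V. \<exists>t>0. (g ^^ t) v = (\<pi> ^^ (t * k)) v}"

lemma up_closed_g_pow: "up_closed ((g ^^ n) ` V)"
  by (rule up_closed_image[OF g_pow fixing[OF g_pow] up_closed_V])

lemma finite_complement_pow:
  assumes "finite (V - g ` V)"
  shows "finite (V - (g ^^ n) ` V)"
proof (induction n)
  case (Suc n)
  have "V - (g ^^ Suc n) ` V \<subseteq> (V - g ` V) \<union> g ` (V - (g ^^ n) ` V)" by auto
  then show ?case using Suc assms finite_subset by blast
qed simp

text \<open>The descendant sets of the vertices \<open>(g ^^ t) v\<close> are finite and pairwise disjoint, so almost all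
  of them lie in the image of \<open>g\<close>; a leaf \<open>x\<close> found there yields the leaves \<open>(g ^^ s) x\<close>, and
  deleting any one of them gives a sibling.\<close>

lemma Sib_inf_leaf:
  assumes fin: "finite (V - g ` V)" and v: "v \<in> V" "v \<notin> core" "v \<notin> axis"
  shows "Sib T = \<infinity>"
proof -
  obtain a where a: "v \<notin> (g ^^ a) ` V" using v by (auto simp: core_def)
  define W where "W t = descendants ((g ^^ t) v)" for t
  \<comment> \<open>Images of powers of \<open>g\<close> are closed under parents, so otherwise
    \<open>(g ^^ t) v\<close> would lie in the image of \<open>g ^^ (t + a)\<close>; cancelling
    \<open>g ^^ t\<close> contradicts the choice of \<open>a\<close>.\<close>
  have notin: "u \<notin> (g ^^ (t + a)) ` V" if u: "u \<in> W t" for u t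
  proof
    assume "u \<in> (g ^^ (t + a)) ` V"
    moreover obtain n where "(\<pi> ^^ n) u = (g ^^ t) v" using u by (auto simp: W_def descendants_def)
    ultimately have "(g ^^ t) v \<in> (g ^^ (t + a)) ` V" using up_closed_pow[OF up_closed_g_pow] by metis
    then obtain x where x: "x \<in> V" "(g ^^ t) v = (g ^^ t) ((g ^^ a) x)" by (auto simp: funpow_add)
    then have "v = (g ^^ a) x" using g_pow_eq[OF v(1) g_pow_V[OF x(1)]] by metis
    then show False using a x(1) by blast
  qed
  have WV: "W t \<subseteq> V" for t by (auto simp: W_def descendants_def)
  have finW: "finite (W t)" for t
    by (rule finite_subset[OF _ finite_complement_pow[OF fin, of "t + a"]]) (use notin WV in blast)
  \<comment> \<open>A common descendant makes one of the two vertices an ancestor of the other, at a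
    distance determined by the levels; cancelling \<open>g ^^ s\<close> would put \<open>v\<close>
    on the axis.\<close>
  have disj: "u \<notin> W t" if "u \<in> W s" "s < t" for u s t
  proof
    assume "u \<in> W t"
    then obtain b where b: "(\<pi> ^^ b) u = (g ^^ t) v" by (auto simp: W_def descendants_def)
    obtain c where c: "(\<pi> ^^ c) u = (g ^^ s) v"
      using \<open>u \<in> W s\<close> unfolding W_def descendants_def by blast
    have u: "u \<in> V" using WV that by blast
    have "int b - int c = int (t * k) - int (s * k)"
      using level_pow[OF u, of b] level_pow[OF u, of c] b c
        level_g_pow[OF v(1), of t] level_g_pow[OF v(1), of s] by simp
    moreover have "t * k = (t - s) * k + s * k" using that(2) by (simp add: add_mult_distrib[symmetric])
    ultimately have "b = (t - s) * k + c" by linarith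
    then have "(g ^^ t) v = (\<pi> ^^ ((t - s) * k)) ((g ^^ s) v)" using pow_shift[OF c] b by metis
    then have "(g ^^ s) ((g ^^ (t - s)) v) = (g ^^ s) ((\<pi> ^^ ((t - s) * k)) v)"
      using that(2) g_pow_parent[OF v(1)] by (simp add: funpow_add[symmetric, THEN fun_cong, simplified comp_def])
    then have "(g ^^ (t - s)) v = (\<pi> ^^ ((t - s) * k)) v"
      using g_pow_eq[OF g_pow_V[OF v(1)] parent_pow_V[OF v(1)]] by metis
    then have "v \<in> axis" using v(1) that(2) unfolding axis_def by (intro CollectI conjI exI[of _ "t - s"]) auto
    then show False using v(3) by simp
  qed
  have "\<forall>\<^sub>F t in sequentially. u \<notin> W t" for u
  proof (cases "\<exists>s. u \<in> W s")
    case True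
    then obtain s where "u \<in> W s" by blast
    then show ?thesis using disj by (intro eventually_sequentiallyI[of "Suc s"]) auto
  qed simp
  then have "\<forall>\<^sub>F t in sequentially. \<forall>u\<in>V - g ` V. u \<notin> W t"
    by (simp add: eventually_ball_finite_distrib[OF fin])
  then obtain b where b: "\<And>t u. t \<ge> b \<Longrightarrow> u \<in> W t \<Longrightarrow> u \<in> g ` V"
    using WV unfolding eventually_sequentially by blast
  have vb: "(g ^^ b) v \<in> W b" using g_pow_V[OF v(1)] by (auto simp: W_def descendants_def intro!: exI[of _ 0])
  \<comment> \<open>A vertex of least level in \<open>W b\<close> has no child, because
    \<open>W b\<close> contains the children of its members.\<close>
  obtain x where x: "x \<in> W b" "\<And>y. y \<in> W b \<Longrightarrow> level x \<le> level y"
    using arg_min_if_finite[OF finW, of b level] vb by (metis empty_iff linorder_not_less)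
  have xV: "x \<in> V" using x WV by blast
  have child: "c \<in> W t" if "c \<in> V" "\<pi> c \<in> W t" for c t
  proof -
    obtain n where "(\<pi> ^^ n) (\<pi> c) = (g ^^ t) v"
      using \<open>\<pi> c \<in> W t\<close> unfolding W_def descendants_def by blast
    then have "(\<pi> ^^ Suc n) c = (g ^^ t) v" by (simp add: funpow_swap1)
    then show ?thesis using that(1) unfolding W_def descendants_def by blast
  qed
  have gx: "(g ^^ s) x \<in> W (b + s)" for s
  proof -
    obtain n where "(\<pi> ^^ n) x = (g ^^ b) v" using x by (auto simp: W_def descendants_def)
    then have "(\<pi> ^^ n) ((g ^^ s) x) = (g ^^ (b + s)) v"
      using g_pow_parent[OF xV, of s n] by (simp add: funpow_add add.commute[of b])
    then show ?thesis using g_pow_V[OF xV] by (auto simp: W_def descendants_def)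
  qed
  \<comment> \<open>By the choice of \<open>b\<close>, a child of \<open>(g ^^ Suc s) x\<close> lies
    in the image of \<open>g\<close>, so it pulls back to a child of
    \<open>(g ^^ s) x\<close>.\<close>
  have leaf: "\<pi> c \<noteq> (g ^^ s) x" if "c \<in> V" for c s
    using that
  proof (induction s arbitrary: c)
    case 0
    then show ?case using child[of c b] x level_parent[of c] by force
  next
    case (Suc s)
    show ?case
    proof
      assume c: "\<pi> c = (g ^^ Suc s) x"
      then have "c \<in> W (b + Suc s)" using child[OF Suc.prems] gx by metis
      then obtain c' where c': "c' \<in> V" "c = g c'" using b[of "b + Suc s" c] by auto
      then have "g (\<pi> c') = g ((g ^^ s) x)" using c embedding_parent_V[OF g fixing[OF g]] by simp
      then have "\<pi> c' = (g ^^ s) x" using embedding_eq[OF g parent_V[OF c'(1)] g_pow_V[OF xV]] by metis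
      then show False using Suc.IH c'(1) by blast
    qed
  qed
  define A where "A s = V - {(g ^^ s) x}" for s
  have AV: "A s \<subseteq> V" "V - A s = {(g ^^ s) x}" "A s - V = {}" for s
    using g_pow_V[OF xV] by (auto simp: A_def)
  have up: "up_closed (A s)" for s
  proof -
    have "\<pi> c \<in> A s" if "c \<in> V" for c using leaf[OF that] parent_V[OF that] by (simp add: A_def)
    then show ?thesis unfolding up_closed_def using AV(1)[of s] xV by blast
  qed
  have sub: "(g ^^ (b + s + a)) ` V \<subseteq> A s" for s
  proof -
    have "(g ^^ (b + s + a)) ` V \<subseteq> V" using g_pow_V by blast
    then show ?thesis using notin[OF gx, of s] unfolding A_def by blast
  qed
  show ?thesis
  proof (rule Sib_eq_infI[where A = UNIV and F = "\<lambda>s. induced T (A s)"])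
    fix s show "siblings (induced T (A s)) T"
      by (rule siblings_induced[OF tree up_closed_tree[OF up] AV(1) g_pow sub])
  next
    fix s t :: nat assume iso: "isomorphic (induced T (A s)) (induced T (A t))"
    have "g ` V \<subseteq> V" using embedding_verts[OF g] by blast
    then obtain p where p: "\<And>n J. finite J \<Longrightarrow> card (A s \<inter> cone (p + n) J) = card (A t \<inter> cone (p + n) J)"
      using isomorphic_no_shift[OF up_closed_V _ not_surj up g_pow sub _ _ up _ _ iso]
      by (auto simp: AV excess_def)
    obtain m n where mn: "(\<pi> ^^ m) ((g ^^ s) x) = r n" by (rule meets_ray[OF g_pow_V[OF xV]])
    define j where "j = p + m"
    have j: "(\<pi> ^^ j) ((g ^^ s) x) = r (p + n)"
      using pow_shift[OF mn, of p] by (simp add: parent_pow_r j_def add.commute)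
    \<comment> \<open>A single depth suffices. The deletion of \<open>(g ^^ s) x\<close> lowers this
      count by one, so the deletion of \<open>(g ^^ t) x\<close> has to lower it too, which puts
      both leaves on the same level.\<close>
    let ?C = "cone (p + n) {j}"
    have C: "finite ?C" by (rule finite_cone[OF locally_finite]) simp
    have sC: "(g ^^ s) x \<in> ?C" using j g_pow_V[OF xV] by (simp add: cone_def)
    have AC: "A u \<inter> ?C = ?C - {(g ^^ u) x}" for u by (auto simp: A_def cone_def)
    have "card (?C - {(g ^^ s) x}) = card (?C - {(g ^^ t) x})" using p[of "{j}" n] by (simp add: AC)
    moreover have "card (?C - {(g ^^ s) x}) < card ?C" using C sC by (rule card_Diff1_less)
    ultimately have "(g ^^ t) x \<in> ?C" using C by (metis Diff_empty Diff_insert0 less_irrefl)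
    then have "(\<pi> ^^ j) ((g ^^ t) x) = (\<pi> ^^ j) ((g ^^ s) x)" using j by (simp add: cone_def)
    then have "level ((g ^^ t) x) + int j = level ((g ^^ s) x) + int j"
      using level_pow[OF g_pow_V[OF xV]] by metis
    then show "s = t" using level_g_pow[OF xV] k_pos by simp
  qed simp
qed

text \<open>A suitable common power of \<open>g\<close> moves \<open>u\<close> and \<open>v\<close>
  to the same ancestor, and it is injective.\<close>

lemma axis_unique:
  assumes "u \<in> axis" "v \<in> axis" "level u = level v"
  shows "u = v"
proof -
  obtain s t where st: "s > 0" "t > 0" "(g ^^ s) u = (\<pi> ^^ (s * k)) u" "(g ^^ t) v = (\<pi> ^^ (t * k)) v"
    and uv: "u \<in> V" "v \<in> V"
    using assms by (auto simp: axis_def)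
  have mult: "(g ^^ (n * t)) w = (\<pi> ^^ (n * t * k)) w" if "(g ^^ t) w = (\<pi> ^^ (t * k)) w" "w \<in> V" for n t w
  proof (induction n)
    case (Suc n)
    have "(g ^^ (Suc n * t)) w = (g ^^ (n * t)) ((\<pi> ^^ (t * k)) w)"
      using that(1) by (simp add: funpow_add add.commute[of t])
    also have "\<dots> = (\<pi> ^^ (t * k)) ((\<pi> ^^ (n * t * k)) w)"
      using g_pow_parent[OF that(2)] Suc by simp
    finally show ?case by (simp add: funpow_add[symmetric, THEN fun_cong, simplified comp_def] algebra_simps)
  qed simp
  obtain m n where mn: "(\<pi> ^^ m) u = (\<pi> ^^ n) v" by (rule common_ancestor[OF uv])
  then have "m = n" using level_pow[OF uv(1), of m] level_pow[OF uv(2), of n] assms(3) by simp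
  \<comment> \<open>The factors \<open>s\<close> and \<open>t\<close> make \<open>N\<close> a
    multiple of both periods, and \<open>m\<close> makes the height \<open>N * k\<close> reach the
    common ancestor.\<close>
  define N where "N = m * s * t"
  have "m \<le> N * k" using st(1,2) k_pos by (simp add: N_def)
  then have eq: "(\<pi> ^^ (N * k)) u = (\<pi> ^^ (N * k)) v"
    using pow_shift[OF mn[unfolded \<open>m = n\<close>], of "N * k - m"] pow_shift[of m v _ "N * k - m"] \<open>m = n\<close> by simp
  have "(g ^^ N) u = (\<pi> ^^ (N * k)) u"
    using mult[OF st(3) uv(1), of "m * t"] by (simp add: N_def ac_simps)
  moreover have "(g ^^ N) v = (\<pi> ^^ (N * k)) v"
    using mult[OF st(4) uv(2), of "m * s"] by (simp add: N_def ac_simps)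
  ultimately show ?thesis using eq g_pow_eq[OF uv, of N] by simp
qed

text \<open>The core turns out to be empty, so all vertices lie on the axis, which has at most one
  vertex per level. As levels are bounded below, the tree is the ray that climbs from its lowest
  vertex.\<close>

lemma ray_if_complement_in_axis:
  assumes sub: "V - core \<subseteq> axis"
  obtains s where "ray T s" "V = range s"
proof -
  obtain v where v: "v \<in> V" "v \<notin> g ` V" using not_surj embedding_verts[OF g] by blast
  have "v \<notin> core" using v(2) by (auto simp: core_def intro!: exI[of _ 1])
  then have vax: "v \<in> axis" using sub v by blast
  have axis_pow: "(\<pi> ^^ n) w \<in> axis" if "w \<in> axis" for w n
  proof -
    obtain t where t: "t > 0" "(g ^^ t) w = (\<pi> ^^ (t * k)) w" "w \<in> V" using \<open>w \<in> axis\<close> by (auto simp: axis_def)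
    then have "(g ^^ t) ((\<pi> ^^ n) w) = (\<pi> ^^ (t * k)) ((\<pi> ^^ n) w)"
      using g_pow_parent[OF t(3)] by (simp add: funpow_add[symmetric, THEN fun_cong, simplified comp_def] add.commute)
    then show ?thesis using t parent_pow_V by (auto simp: axis_def)
  qed
  have core_pow: "(\<pi> ^^ n) w \<in> core" if "w \<in> core" for w n
    using that up_closed_pow[OF up_closed_g_pow] unfolding core_def by blast
  have "core = {}"
  proof (rule ccontr)
    assume "core \<noteq> {}"
    then obtain u where u: "u \<in> core" by blast
    then have uV: "u \<in> V" by (auto simp: core_def intro: exI[of _ 0] dest: spec[of _ 0])
    obtain m n where mn: "(\<pi> ^^ m) u = (\<pi> ^^ n) v" by (rule common_ancestor[OF uV v(1)])
    define z where "z = (\<pi> ^^ n) v"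
    have z: "z \<in> core" "z \<in> axis" using mn core_pow[OF u, of m] axis_pow[OF vax, of n] by (auto simp: z_def)
    \<comment> \<open>Pulling \<open>z\<close> back \<open>n\<close> times lowers its level by
      \<open>n * k\<close>, hence at least to the level of \<open>v\<close>. Climbing from there
      leads to \<open>v\<close> by uniqueness on the axis, but never leaves the core.\<close>
    define N where "N = n"
    have zN: "z \<in> (g ^^ (N + l)) ` V" for l using z(1) by (auto simp: core_def)
    obtain y where y: "y \<in> V" "z = (g ^^ N) y" using zN[of 0] by auto
    have "y \<in> core" unfolding core_def
    proof (rule INT_I)
      fix l
      obtain w where w: "w \<in> V" "z = (g ^^ N) ((g ^^ l) w)" using zN[of l] by (auto simp: funpow_add)
      then have "y = (g ^^ l) w" using g_pow_eq[OF y(1) g_pow_V[OF w(1)], of N l] y(2) by metis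
      then show "y \<in> (g ^^ l) ` V" using w(1) by blast
    qed
    obtain t where t: "t > 0" "(g ^^ t) z = (\<pi> ^^ (t * k)) z" using z(2) by (auto simp: axis_def)
    have "(g ^^ N) ((g ^^ t) y) = (g ^^ N) ((\<pi> ^^ (t * k)) y)"
      using t(2) g_pow_parent[OF y(1)] unfolding y(2)
      by (simp add: funpow_add[symmetric, THEN fun_cong, simplified comp_def] add.commute)
    then have "(g ^^ t) y = (\<pi> ^^ (t * k)) y"
      using g_pow_eq[OF g_pow_V[OF y(1)] parent_pow_V[OF y(1)]] by metis
    then have "y \<in> axis" using t(1) y(1) by (auto simp: axis_def)
    moreover have "n \<le> N * k" using k_pos by (simp add: N_def)
    moreover have "level z = level v + int n" using level_pow[OF v(1)] by (simp add: z_def)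
    moreover have "level z = level y + int (N * k)" using level_g_pow[OF y(1)] y(2) by simp
    ultimately have "(\<pi> ^^ (N * k - n)) y = v"
      using axis_unique[OF axis_pow vax, of y "N * k - n"] level_pow[OF y(1), of "N * k - n"] by simp
    then show False using core_pow[OF \<open>y \<in> core\<close>] \<open>v \<notin> core\<close> by metis
  qed
  then have ax: "V \<subseteq> axis" using sub by simp
  \<comment> \<open>Otherwise some ancestor of \<open>y\<close>, possibly \<open>y\<close> itself,
    has level \<open>level v - int k\<close>; its image under \<open>g\<close> has the level of
    \<open>v\<close>, hence equals \<open>v\<close>, which is outside the image.\<close>
  have low: "level v - int k < level y" if "y \<in> V" for y
  proof (rule ccontr)
    assume *: "\<not> level v - int k < level y"
    define w where "w = (\<pi> ^^ nat (level v - int k - level y)) y"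
    have w: "w \<in> V" "level w = level v - int k"
      using level_pow[OF that] parent_pow_V[OF that] * by (auto simp: w_def)
    then have "level (g w) = level v" using level_translates[OF g g_translates] by simp
    then have "g w = v" using axis_unique ax v(1) embedding_verts[OF g w(1)] by blast
    then show False using v(2) w(1) by blast
  qed
  obtain \<rho> where \<rho>: "\<rho> \<in> V" "\<And>y. y \<in> V \<Longrightarrow> level \<rho> \<le> level y"
  proof -
    define f where "f y = nat (level y - (level v - int k))" for y
    define x where "x = (ARG_MIN f y. y \<in> V)"
    have "x \<in> V" "\<And>y. y \<in> V \<Longrightarrow> f x \<le> f y"
      using arg_min_nat_lemma[of "\<lambda>y. y \<in> V" v f] v(1) unfolding x_def by auto
    then show ?thesis using that[of x] low by (force simp: f_def nat_le_eq_zle)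
  qed
  let ?s = "ray_to T r \<rho>"
  have "V = range ?s"
  proof (intro equalityI subsetI)
    fix y assume y: "y \<in> V"
    have "level ((\<pi> ^^ nat (level y - level \<rho>)) \<rho>) = level y"
      using level_pow[OF \<rho>(1)] \<rho>(2)[OF y] by simp
    then have "(\<pi> ^^ nat (level y - level \<rho>)) \<rho> = y"
      using axis_unique ax y parent_pow_V[OF \<rho>(1)] by blast
    then show "y \<in> range ?s" using parent_pow[OF \<rho>(1)] by (metis rangeI)
  qed (use ray_verts[OF tree ray_to(1)[OF \<rho>(1)]] in auto)
  then show ?thesis using that ray_to(1)[OF \<rho>(1)] by blast
qed

lemma Sib_one_or_inf: "Sib T = 1 \<or> Sib T = \<infinity>"
proof (cases "infinite (V - g ` V) \<or> \<not> V - core \<subseteq> axis")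
  case True
  show ?thesis
  proof (cases "infinite (V - g ` V)")
    case False
    then obtain v where "v \<in> V" "v \<notin> core" "v \<notin> axis" using True by blast
    then show ?thesis using Sib_inf_leaf False by simp
  qed (use Sib_inf_infinite_complement in simp)
next
  case False
  then obtain s where "ray T s" "V = range s" using ray_if_complement_in_axis by blast
  then show ?thesis using Sib_ray[OF tree] by blast
qed

end

text \<open>An elliptic \<open>h\<close> is invertible and conjugates \<open>g\<close> to a map
  whose direction is the end of \<open>h \<circ> r\<close>, so this is again the only direction; a
  non-elliptic \<open>h\<close> fixes the end as its own direction. If \<open>g\<close> were onto,
  its inverse would be non-elliptic with the same direction, although it moves \<open>r\<close>
  backwards.\<close>

lemma one_direction_Sib:
  fixes T :: "'a ugraph"
  assumes t: "is_tree T" and lf: "locally_finite T" and D: "card (directions T (Emb T)) = 1"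
  shows "Sib T = 1 \<or> Sib T = \<infinity>"
proof -
  obtain \<eta> where \<eta>: "directions T (Emb T) = {\<eta>}" using D by (metis card_1_singletonE)
  then have "\<eta> \<in> directions T (Emb T)" by simp
  then obtain r g k where r: "\<eta> = end_of T r" "ray T r" and g: "embedding T T g" "translates g r k"
    unfolding directions_eq[OF t] by blast
  have D': "tail_eq x r" if "end_of T x \<in> directions T (Emb T)" "ray T x" for x
    using that end_of_eq_iff[OF t that(2) r(2)] r(1) \<eta> by simp
  have fixing: "tail_eq (h \<circ> r) r" if h: "embedding T T h" for h
  proof (cases "elliptic T h")
    case True
    show ?thesis
      by (rule D'[OF translates_conj[OF t h elliptic_surj[OF t lf h True] g(1) r(2) g(2)]
            ray_embedding[OF t h r(2)]])
  next
    case False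
    then obtain x m where x: "ray T x" "translates h x m" by (rule nonelliptic_translates[OF t h])
    have "tail_eq x r" by (rule D'[OF directionsI[OF t x(1) h x(2)] x(1)])
    then show ?thesis
      using tail_eq_comp translates_tail_eq[OF x(2)] tail_eq_trans tail_eq_sym by metis
  qed
  have "g ` verts T \<noteq> verts T"
  proof
    assume s: "g ` verts T = verts T"
    let ?i = "inv_into (verts T) g"
    have i: "embedding T T ?i" by (rule embedding_inverse[OF t g(1) s])
    have ig: "?i (g v) = v" if "v \<in> verts T" for v using g(1) that by (auto simp: embedding_def)
    have ir: "?i (r (n + k)) = r n" for n
      using ig[OF ray_verts[OF t r(2)], of n] g(2) by (simp add: translates_def)
    have "\<not> elliptic T ?i"
    proof
      assume "elliptic T ?i"
      then obtain S where S: "subtree S T" "finite (verts S)" "image_graph ?i S = S"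
        by (auto simp: elliptic_def)
      have gi: "g (?i v) = v" if "v \<in> verts T" for v using s that by (simp add: f_inv_into_f)
      have e: "e \<subseteq> verts T" if "e \<in> edges S" for e
        using S(1) t that by (auto simp: subtree_def subgraph_def is_tree_def simple_graph_def)
      have "g ` ?i ` e = e" if "e \<subseteq> verts T" for e
        using that gi by (force simp: image_image)
      then have "image_graph g (image_graph ?i S) = S"
        using e S(1) unfolding image_graph_def subtree_def subgraph_def
        by (cases S) (auto simp: image_image)
      then have "elliptic T g" using S unfolding elliptic_def by metis
      then show False using translates_not_elliptic[OF t g(1) r(2) g(2)] by simp
    qed
    then obtain x m where x: "ray T x" "translates ?i x m" by (rule nonelliptic_translates[OF t i])
    have "tail_eq x r" by (rule D'[OF directionsI[OF t x(1) i x(2)] x(1)])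
    then obtain a b where ab: "\<And>n. x (a + n) = r (b + n)" unfolding tail_eq_def by metis
    have "?i (x (a + k)) = x (a + k + m)" using x(2) by (simp add: translates_def)
    then have "r b = r (b + k + m)" using ab[of k] ab[of "k + m"] ir[of b] by (simp add: add_ac)
    then show False using ray_inj[OF t r(2)] g(2) by (simp add: translates_def)
  qed
  then interpret one_direction T r g k
    by unfold_locales (use t r lf g fixing in auto)
  show ?thesis by (rule Sib_one_or_inf)
qed

section \<open>Siblings with infinitely many boundary vertices\<close>

definition sphere :: "'a ugraph \<Rightarrow> 'a \<Rightarrow> nat \<Rightarrow> 'a set" where
  "sphere G u n = {v. \<exists>p. nbwalk G p n \<and> p 0 = u \<and> p n = v}"

lemma sphere_disjoint:
  assumes "is_tree G" "v \<in> sphere G u m" "v \<in> sphere G u n"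
  shows "m = n"
proof -
  obtain p q where "nbwalk G p m" "nbwalk G q n" "p 0 = q 0" "p m = q n"
    using assms(2,3) unfolding sphere_def by auto
  then show ?thesis using nbwalk_unique[OF assms(1)] by blast
qed

lemma sphere_cover:
  assumes "is_tree G" "u \<in> verts G" "v \<in> verts G"
  obtains n where "v \<in> sphere G u n"
proof -
  obtain p n where "nbwalk G p n" "p 0 = u" "p n = v" by (rule tree_nbwalk[OF assms])
  then have "v \<in> sphere G u n" by (auto simp: sphere_def)
  then show ?thesis by (rule that)
qed

lemma sphere_embedding: "is_tree G \<Longrightarrow> embedding G H f \<Longrightarrow> f ` sphere G u n \<subseteq> sphere H (f u) n"
proof
  fix y assume t: "is_tree G" and f: "embedding G H f" and "y \<in> f ` sphere G u n"
  then obtain p where p: "nbwalk G p n" "p 0 = u" "y = f (p n)" by (auto simp: sphere_def)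
  have "nbwalk H (f \<circ> p) n" by (rule nbwalk_embedding[OF f t p(1)])
  then show "y \<in> sphere H (f u) n" using p unfolding sphere_def by (intro CollectI exI[of _ "f \<circ> p"]) simp
qed

lemma sphere_subset: "is_tree G \<Longrightarrow> sphere G u n \<subseteq> verts G"
  using nbwalk_verts[of G _ n n] by (auto simp: sphere_def)

lemma finite_sphere:
  assumes t: "is_tree G" and lf: "locally_finite G"
  shows "finite (sphere G u n)"
proof (induction n)
  case 0
  have "sphere G u 0 \<subseteq> {u}" by (auto simp: sphere_def)
  then show ?case using finite_subset by blast
next
  case (Suc n)
  have "sphere G u (Suc n) \<subseteq> (\<Union>v\<in>sphere G u n. {w. {v, w} \<in> edges G})"
  proof
    fix w assume "w \<in> sphere G u (Suc n)"
    then obtain p where p: "nbwalk G p (Suc n)" "p 0 = u" "p (Suc n) = w" by (auto simp: sphere_def)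
    then have "p n \<in> sphere G u n" using nbwalk_mono[OF p(1), of n] by (auto simp: sphere_def)
    moreover have "{p n, w} \<in> edges G" using p by (auto simp: nbwalk_def)
    ultimately show "w \<in> (\<Union>v\<in>sphere G u n. {w. {v, w} \<in> edges G})" by blast
  qed
  moreover have "finite (\<Union>v\<in>sphere G u n. {w. {v, w} \<in> edges G})"
    using Suc lf sphere_subset[OF t] by (auto simp: locally_finite_def)
  ultimately show ?case using finite_subset by blast
qed

text \<open>Geodesics of the subtree are geodesics of \<open>T\<close>, so both trees have the same
  distances.\<close>

lemma sphere_induced:
  assumes t: "is_tree T" "is_tree (induced T A)" "A \<subseteq> verts T" and u: "u \<in> A"
  shows "sphere (induced T A) u n = A \<inter> sphere T u n"
proof
  have "sphere (induced T A) u m \<subseteq> sphere T u m" for m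
    using sphere_embedding[OF t(2) induced_embedding[OF t(3)], of u m] by simp
  note sub = this
  show "sphere (induced T A) u n \<subseteq> A \<inter> sphere T u n"
    using sub[of n] sphere_subset[OF t(2), of u n] by simp
  show "A \<inter> sphere T u n \<subseteq> sphere (induced T A) u n"
  proof
    fix v assume v: "v \<in> A \<inter> sphere T u n"
    then obtain m where "v \<in> sphere (induced T A) u m"
      using sphere_cover[OF t(2), of u v] u by auto
    then show "v \<in> sphere (induced T A) u n"
      using sphere_disjoint[OF t(1), of v u m n] sub[of m] v by blast
  qed
qed

lemma countable_verts:
  assumes "is_tree T" "locally_finite T"
  shows "countable (verts T)"
proof -
  obtain u where u: "u \<in> verts T" using assms(1) by (auto simp: is_tree_def)
  have "verts T \<subseteq> (\<Union>n. sphere T u n)" using sphere_cover[OF assms(1) u] by blast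
  moreover have "countable (\<Union>n. sphere T u n)"
    using finite_sphere[OF assms] by (intro countable_UN) (auto intro: countable_finite)
  ultimately show ?thesis using countable_subset by blast
qed

lemma uncountable_Pow:
  assumes "infinite A"
  shows "\<not> countable (Pow A)"
proof
  assume c: "countable (Pow A)"
  have "(\<lambda>x. {x}) ` A \<subseteq> Pow A" by auto
  then have "countable ((\<lambda>x. {x}) ` A)" using c countable_subset by blast
  then have "countable A" by (rule countable_image_inj_on) auto
  then have "to_nat_on A ` A = UNIV" using to_nat_on_infinite[OF _ assms] by (simp add: bij_betw_def)
  then have "(from_nat_into (Pow A) \<circ> to_nat_on A) ` A = Pow A"
    using range_from_nat_into[OF _ c] Pow_not_empty[of A] unfolding image_comp[symmetric] by metis
  then show False using Cantors_theorem by blast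
qed

text \<open>Attaching boundary vertices at pairwise distinct depths below a root gives uncountably many
  rooted trees with distinct sphere sizes, whereas a single tree has only countably many vertices
  that could serve as the root.\<close>

lemma Sib_inf_boundary:
  fixes T :: "'a ugraph"
  assumes t: "is_tree T" and lf: "locally_finite T"
    and Y: "is_tree (induced T Y)" "Y \<subseteq> verts T" and f: "embedding T T f" "f ` verts T \<subseteq> Y"
    and inf: "infinite {v \<in> verts T - Y. \<exists>u\<in>Y. {u, v} \<in> edges T}"
  shows "Sib T = \<infinity>"
proof (rule ccontr)
  assume "Sib T \<noteq> \<infinity>"
  then have fin: "finite (sibling_classes T)" by (simp add: Sib_def split: if_splits)
  obtain z where z: "z \<in> Y" using Y(1) by (auto simp: is_tree_def)
  then have zV: "z \<in> verts T" using Y(2) by blast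
  define B where "B = {v \<in> verts T - Y. \<exists>u\<in>Y. {u, v} \<in> edges T}"
  \<comment> \<open>Spheres are finite, so the infinitely many boundary vertices occur at infinitely
    many distances; one of them is kept for each distance.\<close>
  define N where "N = {n. B \<inter> sphere T z n \<noteq> {}}"
  have "infinite N"
  proof
    assume "finite N"
    moreover have "B \<subseteq> (\<Union>n\<in>N. sphere T z n)"
    proof
      fix v assume v: "v \<in> B"
      then obtain n where "v \<in> sphere T z n" using sphere_cover[OF t zV, of v] by (auto simp: B_def)
      then show "v \<in> (\<Union>n\<in>N. sphere T z n)" using v by (auto simp: N_def)
    qed
    ultimately have "finite B" using finite_sphere[OF t lf] by (meson finite_UN_I finite_subset)
    then show False using inf by (simp add: B_def)
  qed
  have "\<forall>n\<in>N. \<exists>v. v \<in> B \<inter> sphere T z n" by (auto simp: N_def)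
  then obtain \<beta> where \<beta>: "\<And>n. n \<in> N \<Longrightarrow> \<beta> n \<in> B" "\<And>n. n \<in> N \<Longrightarrow> \<beta> n \<in> sphere T z n"
    by (metis IntE)
  define A where "A w = Y \<union> \<beta> ` w" for w
  let ?S = "\<lambda>w. induced T (A w)"
  have AV: "A w \<subseteq> verts T" if "w \<subseteq> N" for w using that \<beta>(1) Y(2) by (auto simp: A_def B_def)
  have zA: "z \<in> A w" for w using z by (simp add: A_def)
  have tr: "is_tree (?S w)" if w: "w \<subseteq> N" for w
  proof (rule induced_tree[OF t])
    show "A w \<noteq> {}" using zA by blast
    show "A w \<subseteq> verts T" by (rule AV[OF w])
    have sub: "adj_rel (induced T Y) \<subseteq> adj_rel (?S w)" by (auto simp: adj_rel_def A_def)
    have Yz: "(z, y) \<in> (adj_rel (?S w))\<^sup>*" if "y \<in> Y" for y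
      using Y(1) z that rtrancl_mono[OF sub] by (auto simp: is_tree_def graph_connected_def)
    have Az: "(z, y) \<in> (adj_rel (?S w))\<^sup>*" if y: "y \<in> A w" for y
    proof (cases "y \<in> Y")
      case False
      then have "y \<in> B" using y w \<beta>(1) by (auto simp: A_def)
      then obtain u where "u \<in> Y" "{u, y} \<in> edges T" by (auto simp: B_def)
      then have "(u, y) \<in> adj_rel (?S w)" using y by (simp add: adj_rel_def A_def)
      then show ?thesis using Yz[OF \<open>u \<in> Y\<close>] by (rule rtrancl_into_rtrancl[rotated])
    qed (rule Yz)
    show "(u, v) \<in> (adj_rel (?S w))\<^sup>*" if "u \<in> A w" "v \<in> A w" for u v
      using adj_rel_sym[OF Az[OF that(1)]] Az[OF that(2)] by (rule rtrancl_trans)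
  qed
  have sib: "siblings (?S w) T" if "w \<subseteq> N" for w
    by (rule siblings_induced[OF t tr[OF that] AV[OF that] f(1)]) (use f(2) in \<open>auto simp: A_def\<close>)
  have count: "n \<in> w \<longleftrightarrow> card (sphere (?S w) z n) = Suc (card (Y \<inter> sphere T z n))"
    if w: "w \<subseteq> N" and n: "n \<in> N" for w n
  proof -
    have s: "sphere (?S w) z n = A w \<inter> sphere T z n"
      by (rule sphere_induced[OF t tr[OF w] AV[OF w] zA])
    have b: "\<beta> m \<in> sphere T z n \<longleftrightarrow> m = n" if "m \<in> w" for m
      using sphere_disjoint[OF t, of "\<beta> m" z m n] \<beta>(2) w n that by blast
    have F: "finite (Y \<inter> sphere T z n)" using finite_sphere[OF t lf] by blast
    have bY: "\<beta> n \<notin> Y" using \<beta>(1)[OF n] by (auto simp: B_def)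
    show ?thesis
    proof (cases "n \<in> w")
      case True
      then have "A w \<inter> sphere T z n = insert (\<beta> n) (Y \<inter> sphere T z n)"
        using b by (auto simp: A_def \<beta>(2)[OF n])
      then show ?thesis using True F bY s by simp
    next
      case False
      then have "A w \<inter> sphere T z n = Y \<inter> sphere T z n" using b by (auto simp: A_def)
      then show ?thesis using False s by simp
    qed
  qed
  define cl where "cl w = {(S :: 'a ugraph, S' :: 'a ugraph). isomorphic S S'} `` {?S w}" for w
  have cl_iso: "isomorphic (?S u) (?S v)" if "cl u = cl v" for u v
    using eq_equiv_class[OF that[unfolded cl_def] isomorphic_equiv] by simp
  \<comment> \<open>All trees in one class are compared with a single representative, so that the
    images of their roots become vertices of one tree.\<close>
  define rep where "rep C = (SOME w. w \<subseteq> N \<and> cl w = C)" for C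
  have rep: "rep (cl w) \<subseteq> N \<and> cl (rep (cl w)) = cl w" if "w \<subseteq> N" for w
    unfolding rep_def by (rule someI[of _ w]) (use that in simp)
  have "\<exists>\<phi>. embedding (?S w) (?S (rep (cl w))) \<phi> \<and> embedding (?S (rep (cl w))) (?S w) (inv_into (A w) \<phi>)
      \<and> bij_betw \<phi> (A w) (A (rep (cl w)))" if "w \<subseteq> N" for w
  proof -
    have "isomorphic (?S w) (?S (rep (cl w)))" by (rule cl_iso) (use rep[OF that] in simp)
    moreover have R: "is_tree (?S (rep (cl w)))" using rep[OF that] by (intro tr) simp
    ultimately obtain f where "embedding (?S w) (?S (rep (cl w))) f" "bij_betw f (A w) (A (rep (cl w)))"
      "embedding (?S (rep (cl w))) (?S w) (inv_into (A w) f)"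
      using isomorphic_obtain[OF tr[OF \<open>w \<subseteq> N\<close>] R] by auto
    then show ?thesis by blast
  qed
  then obtain \<phi> where \<phi>: "\<And>w. w \<subseteq> N \<Longrightarrow> embedding (?S w) (?S (rep (cl w))) (\<phi> w)"
    "\<And>w. w \<subseteq> N \<Longrightarrow> embedding (?S (rep (cl w))) (?S w) (inv_into (A w) (\<phi> w))"
    "\<And>w. w \<subseteq> N \<Longrightarrow> bij_betw (\<phi> w) (A w) (A (rep (cl w)))" by metis
  have \<phi>z: "card (sphere (?S w) z n) = card (sphere (?S (rep (cl w))) (\<phi> w z) n)" if w: "w \<subseteq> N" for w n
  proof (rule bij_betw_same_card[of "\<phi> w"])
    let ?i = "inv_into (A w) (\<phi> w)" and ?R = "?S (rep (cl w))"
    have inj: "inj_on (\<phi> w) (A w)" and img: "\<phi> w ` A w = A (rep (cl w))"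
      using \<phi>(3)[OF w] by (auto simp: bij_betw_def)
    have 1: "\<phi> w ` sphere (?S w) z n \<subseteq> sphere ?R (\<phi> w z) n"
      by (rule sphere_embedding[OF tr[OF w] \<phi>(1)[OF w]])
    have "?i ` sphere ?R (\<phi> w z) n \<subseteq> sphere (?S w) (?i (\<phi> w z)) n"
      by (rule sphere_embedding[OF tr \<phi>(2)[OF w]]) (use rep[OF w] in simp)
    then have 2: "?i ` sphere ?R (\<phi> w z) n \<subseteq> sphere (?S w) z n" using inj zA by simp
    have sub: "sphere ?R (\<phi> w z) n \<subseteq> \<phi> w ` A w"
      using sphere_subset[OF tr, of "rep (cl w)"] rep[OF w] img by simp
    have "sphere ?R (\<phi> w z) n \<subseteq> \<phi> w ` sphere (?S w) z n"
    proof
      fix x assume x: "x \<in> sphere ?R (\<phi> w z) n"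
      then have "\<phi> w (?i x) = x" using sub by (auto simp: f_inv_into_f)
      then show "x \<in> \<phi> w ` sphere (?S w) z n" using x 2 by (metis image_eqI image_subset_iff)
    qed
    moreover have "inj_on (\<phi> w) (sphere (?S w) z n)"
      using inj sphere_subset[OF tr[OF w], of z n] by (auto intro: inj_on_subset)
    ultimately show "bij_betw (\<phi> w) (sphere (?S w) z n) (sphere ?R (\<phi> w z) n)"
      using 1 by (auto simp: bij_betw_def)
  qed
  \<comment> \<open>Class and image of the root determine the sphere sizes around \<open>z\<close>,
    and these tell for each \<open>n\<close> whether a vertex was attached.\<close>
  have "inj_on (\<lambda>w. (cl w, \<phi> w z)) (Pow N)"
  proof (rule inj_onI)
    fix w w' assume w: "w \<in> Pow N" "w' \<in> Pow N" and eq: "(cl w, \<phi> w z) = (cl w', \<phi> w' z)"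
    have "card (sphere (?S w) z n) = card (sphere (?S w') z n)" for n
      using \<phi>z[of w n] \<phi>z[of w' n] w eq by simp
    then have "n \<in> w \<longleftrightarrow> n \<in> w'" if "n \<in> N" for n using count[of w n] count[of w' n] w that by auto
    then show "w = w'" using w by blast
  qed
  moreover have "(\<lambda>w. (cl w, \<phi> w z)) ` Pow N \<subseteq> sibling_classes T \<times> verts T"
  proof (rule image_subsetI)
    fix w assume "w \<in> Pow N"
    then have w: "w \<subseteq> N" by simp
    have "cl w \<in> sibling_classes T" using sib[OF w] unfolding cl_def sibling_classes_def quotient_def by blast
    moreover have "\<phi> w z \<in> verts T" using embedding_verts[OF \<phi>(1)[OF w], of z] zA AV rep[OF w] by auto
    ultimately show "(cl w, \<phi> w z) \<in> sibling_classes T \<times> verts T" by simp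
  qed
  moreover have "countable (sibling_classes T \<times> verts T)"
    using fin countable_verts[OF t lf] by (simp add: countable_finite)
  ultimately have "countable (Pow N)"
    by (meson countable_image_inj_on countable_subset)
  then show False using uncountable_Pow[OF \<open>infinite N\<close>] by blast
qed

section \<open>Parabolic embeddings\<close>

context ended_tree
begin

text \<open>Otherwise the preimages of \<open>r j\<close> under the powers of \<open>f\<close> span a ray whose end is a second
  fixed end.\<close>

lemma parabolic_leaves_image:
  assumes f: "embedding T T f" "translates f r k" and par: "parabolic T f"
  shows "\<exists>n. r j \<notin> (f ^^ n) ` V"
proof (rule ccontr)
  assume "\<nexists>n. r j \<notin> (f ^^ n) ` V"
  then have "\<forall>n. \<exists>w\<in>V. (f ^^ n) w = r j" by (metis imageE)
  then obtain w where w: "\<And>n. w n \<in> V" "\<And>n. (f ^^ n) (w n) = r j" by metis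
  have k: "k > 0" using f(2) by (simp add: translates_def)
  have fp: "embedding T T (f ^^ n)" for n by (rule embedding_funpow[OF f(1)])
  have fn: "tail_eq (f \<circ> r) r" by (rule translates_tail_eq[OF f(2)])
  have fr: "(f ^^ n) (r i) = r (i + n * k)" for n i by (rule translates_pow[OF f(2)])
  have fpar: "(f ^^ n) ((\<pi> ^^ m) v) = (\<pi> ^^ m) ((f ^^ n) v)" if "v \<in> V" for n m v
  proof (induction n)
    case (Suc n)
    then show ?case using embedding_parent_pow[OF f(1) fn embedding_verts[OF fp that]] by simp
  qed simp
  \<comment> \<open>\<open>w i\<close> lies \<open>i * k\<close> levels below \<open>r j\<close>;
    \<open>q i\<close> is its ancestor just \<open>i\<close> levels below, so that consecutive
    values are adjacent.\<close>
  define q where "q i = (\<pi> ^^ (i * k - i)) (w i)" for i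
  have qV: "q i \<in> V" for i using parent_pow_V[OF w(1)] by (simp add: q_def)
  have fq: "(f ^^ m) (q i) = r (j + m * k - i)" if "i \<le> m" for m i
  proof -
    have ik: "i \<le> i * k" using k by simp
    have "(f ^^ i) (q i) = r (j + i * k - i)"
      using fpar[OF w(1)] w(2) parent_pow_r ik by (simp add: q_def)
    then have "(f ^^ (m - i + i)) (q i) = r (j + i * k - i + (m - i) * k)"
      unfolding funpow_add comp_def by (simp add: fr)
    moreover have "j + i * k - i + (m - i) * k = j + m * k - i"
    proof -
      have "i * k + (m - i) * k = m * k" using that by (simp add: add_mult_distrib[symmetric])
      then show ?thesis using ik by linarith
    qed
    ultimately show ?thesis using that by simp
  qed
  have qinj: "u = v" if "(f ^^ m) u = (f ^^ m) v" "u \<in> V" "v \<in> V" for u v m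
    using embedding_eq[OF fp that(2,3)] that(1) by blast
  have parent_q: "\<pi> (q (Suc i)) = q i" for i
  proof (rule qinj)
    have ik: "Suc i \<le> Suc i * k" using mult_le_mono2[of 1 k "Suc i"] k by simp
    have "(f ^^ Suc i) (\<pi> (q (Suc i))) = \<pi> (r (j + Suc i * k - Suc i))"
      using fpar[OF qV, of "Suc i" 1 "Suc i"] fq[of "Suc i" "Suc i"]
      by (simp only: One_nat_def funpow_0 funpow.simps(2)[of 0] comp_apply id_apply order_refl funpow_simps_right(1))
    also have "\<dots> = r (j + Suc i * k - i)"
      using parent_pow_r[of 1 "j + Suc i * k - Suc i"] ik by (simp add: Suc_diff_Suc del: mult_Suc)
    also have "\<dots> = (f ^^ Suc i) (q i)" using fq[of i "Suc i"] by (simp del: funpow.simps(2))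
    finally show "(f ^^ Suc i) (\<pi> (q (Suc i))) = (f ^^ Suc i) (q i)" .
  qed (use qV parent_V in auto)
  \<comment> \<open>\<open>f\<close> moves \<open>q\<close> by \<open>k\<close> steps towards its
    start, hence fixes its end.\<close>
  have shift_q: "f (q (k + n)) = q (0 + n)" for n
  proof (rule qinj)
    let ?m = "k + n"
    have "(f ^^ ?m) (f (q (k + n))) = (f ^^ Suc ?m) (q (k + n))" by (simp add: funpow_swap1)
    also have "\<dots> = r (j + Suc ?m * k - (k + n))" by (rule fq) simp
    also have "j + Suc ?m * k - (k + n) = j + ?m * k - n" by simp
    also have "r \<dots> = (f ^^ ?m) (q (0 + n))" using fq[of n ?m] by simp
    finally show "(f ^^ ?m) (f (q (k + n))) = (f ^^ ?m) (q (0 + n))" .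
  qed (use qV embedding_verts[OF f(1)] in auto)
  have q: "ray T q"
  proof (rule rayI[OF _ _ tree])
    fix n
    show "{q n, q (Suc n)} \<in> edges T" using parent_edge[OF qV, of "Suc n"] parent_q by (simp add: insert_commute)
    show "q n \<noteq> q (Suc (Suc n))"
      using parent_pow_inj[OF qV, of 2 "Suc (Suc n)" 0] parent_q by (simp add: numeral_2_eq_2)
  qed
  have "tail_eq (f \<circ> q) q" unfolding tail_eq_def comp_def using shift_q by blast
  then have "fixes_end f (end_of T q)" using fixes_end_iff[OF tree q f(1)] by simp
  moreover have "fixes_end f (end_of T r)" using fixes_end_iff[OF tree ray f(1)] fn by simp
  ultimately have "end_of T q = end_of T r"
    using par Ends_eq[OF tree] q ray unfolding parabolic_def by blast
  then have "tail_eq q r" using end_of_eq_iff[OF tree q ray] by simp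
  \<comment> \<open>In the end of \<open>r\<close> the ray \<open>q\<close> would have to climb,
    whereas it descends by construction.\<close>
  then have "\<pi> (q 1) = q 2" using parent_ray[OF q, of 1] by (simp add: numeral_2_eq_2)
  then show False using parent_q[of 0] ray_inj[OF tree q, of 0 2] by simp
qed

text \<open>If no vertex has two children, only one path leads down from any vertex; two descending
  rays start below a common ancestor and therefore merge.\<close>

lemma descending_rays_tail_eq:
  assumes inj: "inj_on \<pi> V" and x: "ray T x" "\<not> tail_eq x r" and y: "ray T y" "\<not> tail_eq y r"
  shows "tail_eq x y"
proof -
  have pinj: "u = v" if "(\<pi> ^^ n) u = (\<pi> ^^ n) v" "u \<in> V" "v \<in> V" for u v n
    using that
  proof (induction n)
    case (Suc n)
    then show ?case using inj_onD[OF inj, of "(\<pi> ^^ n) u" "(\<pi> ^^ n) v"] parent_pow_V by simp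
  qed simp
  have *: "tail_eq x y"
    if x: "ray T x" "\<And>i. i \<ge> p \<Longrightarrow> \<pi> (x (Suc i)) = x i" and y: "ray T y" "\<And>i. i \<ge> q \<Longrightarrow> \<pi> (y (Suc i)) = y i"
      and mn: "(\<pi> ^^ m) (x p) = (\<pi> ^^ n) (y q)" "m \<le> n" for x y p q m n
  proof -
    have xV: "x i \<in> V" and yV: "y i \<in> V" for i using ray_verts[OF tree] x y by auto
    have px: "(\<pi> ^^ i) (x (p + i)) = x p" and py: "(\<pi> ^^ i) (y (q + i)) = y q" for i
      by (induction i) (auto simp: x y funpow_swap1)
    have "(\<pi> ^^ m) (x p) = (\<pi> ^^ m) ((\<pi> ^^ (n - m)) (y q))"
      using mn pow_shift[of "n - m" "y q" _ m] by simp
    then have e: "x p = (\<pi> ^^ (n - m)) (y q)" by (rule pinj) (use xV yV parent_pow_V in auto)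
    have "x (p + (n - m) + i) = y (q + i)" for i
    proof (rule pinj)
      show "(\<pi> ^^ (n - m + i)) (x (p + (n - m) + i)) = (\<pi> ^^ (n - m + i)) (y (q + i))"
        using px[of "n - m + i"] py[of i] e pow_shift[OF py[of i], of "n - m"] by (simp add: add.assoc)
    qed (use xV yV in auto)
    then show ?thesis unfolding tail_eq_def by blast
  qed
  obtain p where p: "\<And>i. i \<ge> p \<Longrightarrow> \<pi> (x (Suc i)) = x i" by (rule ray_descends[OF x]) blast
  obtain q where q: "\<And>i. i \<ge> q \<Longrightarrow> \<pi> (y (Suc i)) = y i" by (rule ray_descends[OF y]) blast
  obtain m n where mn: "(\<pi> ^^ m) (x p) = (\<pi> ^^ n) (y q)"
    by (rule common_ancestor[OF ray_verts[OF tree x(1)] ray_verts[OF tree y(1)]])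
  show ?thesis
  proof (cases "m \<le> n")
    case True
    then show ?thesis using *[OF x(1) p y(1) q mn] by simp
  next
    case False
    then show ?thesis using *[OF y(1) q x(1) p mn[symmetric]] tail_eq_sym by simp
  qed
qed

text \<open>Applying \<open>g\<close> repeatedly moves any vertex onto the bare part of \<open>r\<close>, so no vertex has two
  children.\<close>

lemma inj_parent_if_bare:
  assumes g: "embedding T T g" "translates g r c"
    and bare: "\<And>j v. N < j \<Longrightarrow> v \<in> V \<Longrightarrow> \<pi> v = r j \<Longrightarrow> v = r (j - 1)"
  shows "inj_on \<pi> V"
proof (rule inj_onI)
  fix u v assume uv: "u \<in> V" "v \<in> V" "\<pi> u = \<pi> v"
  have desc: "y = r (L - m)" if "y \<in> V" "(\<pi> ^^ m) y = r L" "N + m < L" for y m L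
    using that
  proof (induction m arbitrary: y)
    case (Suc m)
    then have "\<pi> y = r (L - m)" using parent_V by (simp add: funpow_swap1)
    then have "y = r (L - m - 1)" using bare[of "L - m" y] Suc.prems by simp
    then show ?case by simp
  qed simp
  obtain m l where ml: "(\<pi> ^^ m) (\<pi> u) = r l" by (rule meets_ray[OF parent_V[OF uv(1)]])
  \<comment> \<open>After \<open>t\<close> applications the ancestor lies more than
    \<open>Suc m\<close> steps beyond \<open>N\<close>, so its only descendant at depth
    \<open>Suc m\<close> is the one on \<open>r\<close>.\<close>
  define t where "t = Suc (N + Suc m)"
  have c: "c > 0" using g(2) by (simp add: translates_def)
  have "N + Suc m < l + t * c"
  proof -
    have "t \<le> t * c" using c by simp
    then show ?thesis by (simp add: t_def)
  qed
  have gt: "embedding T T (g ^^ t)" by (rule embedding_funpow[OF g(1)])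
  have gtr: "tail_eq (g ^^ t \<circ> r) r"
    unfolding tail_eq_def comp_def using translates_pow[OF g(2)]
    by (intro exI[of _ 0] exI[of _ "t * c"]) (simp add: add.commute)
  have "(g ^^ t) x = r (l + t * c - Suc m)" if x: "x \<in> V" "\<pi> x = \<pi> u" for x
  proof (rule desc)
    have "(\<pi> ^^ Suc m) x = r l" using ml x by (simp add: funpow_swap1)
    then show "(\<pi> ^^ Suc m) ((g ^^ t) x) = r (l + t * c)"
      using embedding_parent_pow[OF gt gtr x(1), of "Suc m"] translates_pow[OF g(2)] by metis
  qed (use embedding_verts[OF gt x(1)] \<open>N + Suc m < l + t * c\<close> in auto)
  then have "(g ^^ t) u = (g ^^ t) v" using uv by metis
  then show "u = v" using embedding_eq[OF gt uv(1,2)] by simp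
qed

end

text \<open>Two further directions are chosen: \<open>a0\<close> supplies the ray that is added to
  an image, and \<open>s\<close> ensures that infinitely many vertices branch off this ray. The
  power of \<open>f\<close> is high enough for its image to miss the ray, so the branching vertices
  lie outside \<open>Y\<close>.\<close>

lemma parabolic_Sib_inf:
  assumes t: "is_tree T" and lf: "locally_finite T" and D: "infinite (directions T (Emb T))"
    and f: "embedding T T f" and par: "parabolic T f"
  shows "Sib T = \<infinity>"
proof -
  have "\<not> elliptic T f" using par by (simp add: parabolic_def)
  then obtain r k where r: "ray T r" "translates f r k" by (rule nonelliptic_translates[OF t f])
  interpret ended_tree T r by unfold_locales (fact t, fact r)
  have "\<exists>\<eta>. \<eta> \<in> directions T (Emb T) \<and> \<eta> \<notin> F" if "finite F" for F
    using D that by (meson finite_subset subsetI)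
  note other = this
  obtain \<eta> where "\<eta> \<in> directions T (Emb T)" "\<eta> \<noteq> end_of T r" using other[of "{end_of T r}"] by auto
  then obtain a0 g c where a0: "ray T a0" "embedding T T g" "translates g a0 c" "end_of T a0 \<noteq> end_of T r"
    unfolding directions_eq[OF t] by blast
  have na0: "\<not> tail_eq a0 r" using a0(4) end_of_eq_iff[OF t a0(1) r(1)] by simp
  obtain s where s: "ray T s" "end_of T s \<noteq> end_of T r" "end_of T s \<noteq> end_of T a0"
    using other[of "{end_of T r, end_of T a0}"] unfolding directions_eq[OF t] by auto
  obtain p where p: "\<And>n. n \<ge> p \<Longrightarrow> \<pi> (a0 (Suc n)) = a0 n" by (rule ray_descends[OF a0(1) na0]) blast
  define a where "a n = a0 (p + n)" for n
  have a: "ray T a" "translates g a c" "tail_eq a a0"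
    using ray_drop[OF t a0(1), of p] translates_drop[OF a0(3), of p] tail_eq_drop[of a0 p]
    by (simp_all add: a_def[abs_def])
  have pa: "\<pi> (a (Suc n)) = a n" for n using p[of "p + n"] by (simp add: a_def)
  have aV: "a n \<in> V" for n by (rule ray_verts[OF t a(1)])
  have ainj: "a m = a n \<longleftrightarrow> m = n" for m n by (rule ray_inj[OF t a(1)])
  define J where "J = {j. \<exists>v\<in>V. \<pi> v = a j \<and> v \<noteq> a (Suc j)}"
  have "infinite J"
  proof
    assume "finite J"
    then obtain N where N: "\<And>j. j \<in> J \<Longrightarrow> j \<le> N" by (metis finite_nat_set_iff_bounded_le)
    \<comment> \<open>The tree is reoriented towards the end of \<open>a\<close>. If
      \<open>a\<close> were bare from some point on, this parent function would be injective and all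
      other ends would coincide, but \<open>r\<close> and \<open>s\<close> represent two of
      them.\<close>
    interpret A: ended_tree T a by unfold_locales (fact t, fact a)
    have "inj_on A.\<pi> V"
    proof (rule A.inj_parent_if_bare[OF a0(2) a(2)])
      fix j v assume j: "N < j" "v \<in> V" "A.\<pi> v = a j"
      have "{v, a j} \<in> edges T" using A.parent_edge[OF j(2)] j(3) by simp
      then consider "a j = \<pi> v" | "v = \<pi> (a j)" using edge_parent by blast
      then show "v = a (j - 1)"
      proof cases
        case 1
        then have "v = a (Suc j)" using N[of j] j by (auto simp: J_def)
        then have "A.\<pi> v = a (Suc (Suc j))" using A.parent_ray[OF a(1), of "Suc j"] by simp
        then show ?thesis using j(3) ainj by simp
      next
        case 2
        then show ?thesis using pa[of "j - 1"] j(1) by simp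
      qed
    qed
    moreover have "\<not> tail_eq r a" using na0 a(3) tail_eq_trans tail_eq_sym by blast
    moreover have "\<not> tail_eq s a"
      using s(3) end_of_eq_iff[OF t s(1) a0(1)] a(3) tail_eq_trans by blast
    ultimately have "tail_eq s r" by (intro A.descending_rays_tail_eq s(1) r(1))
    then show False using s(2) end_of_eq_iff[OF t s(1) r(1)] by simp
  qed
  have lev_a: "level (a j) = level (a 0) - int j" for j
  proof -
    have "(\<pi> ^^ j) (a j) = a 0" by (induction j) (auto simp: pa funpow_swap1)
    then show ?thesis using level_pow[OF aV, of j j] by simp
  qed
  obtain m l where ml: "(\<pi> ^^ m) (a 0) = r l" by (rule meets_ray[OF aV])
  \<comment> \<open>\<open>r l\<close> is an ancestor of every \<open>a j\<close>, and the image is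
    closed under parents; missing \<open>r l\<close>, it misses the whole of
    \<open>a\<close>.\<close>
  obtain n where n: "r l \<notin> (f ^^ n) ` V" using parabolic_leaves_image[OF f r(2) par] by blast
  have fn: "embedding T T (f ^^ n)" by (rule embedding_funpow[OF f])
  have "tail_eq (f ^^ n \<circ> r) r"
    unfolding tail_eq_def comp_def using translates_pow[OF r(2)]
    by (intro exI[of _ 0] exI[of _ "n * k"]) (simp add: add.commute)
  then have I: "up_closed ((f ^^ n) ` V)" by (rule up_closed_image[OF fn _ up_closed_V])
  have aI: "a j \<notin> (f ^^ n) ` V" for j
  proof
    assume "a j \<in> (f ^^ n) ` V"
    moreover have "(\<pi> ^^ (m + j)) (a j) = r l"
    proof -
      have "(\<pi> ^^ j) (a j) = a 0" by (induction j) (auto simp: pa funpow_swap1)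
      then show ?thesis using pow_shift ml by metis
    qed
    ultimately show False using up_closed_pow[OF I] n by metis
  qed
  \<comment> \<open>The ancestors of \<open>a 0\<close> connect the ray to the image and make the
    union closed under parents.\<close>
  define Y where "Y = (f ^^ n) ` V \<union> range (\<lambda>i. (\<pi> ^^ i) (a 0)) \<union> range a"
  have Y: "up_closed Y"
    unfolding up_closed_def
  proof (intro conjI ballI)
    show "Y \<noteq> {}" by (auto simp: Y_def)
    show "Y \<subseteq> V" using I parent_pow_V[OF aV] aV by (auto simp: Y_def up_closed_def)
    fix v assume "v \<in> Y"
    then consider "v \<in> (f ^^ n) ` V" | i where "v = (\<pi> ^^ i) (a 0)" | i where "v = a i"
      by (auto simp: Y_def)
    then show "\<pi> v \<in> Y"
    proof cases
      case 1
      then have "\<pi> v \<in> (f ^^ n) ` V" using I unfolding up_closed_def by blast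
      then show ?thesis unfolding Y_def by blast
    next
      case 2
      then have "\<pi> v = (\<pi> ^^ Suc i) (a 0)" by simp
      then show ?thesis unfolding Y_def by blast
    next
      case 3
      then have "\<pi> v = (\<pi> ^^ 1) (a 0) \<or> \<pi> v \<in> range a" by (cases i) (auto simp: pa)
      then show ?thesis unfolding Y_def by blast
    qed
  qed
  have "\<forall>j\<in>J. \<exists>v\<in>V. \<pi> v = a j \<and> v \<noteq> a (Suc j)" by (simp add: J_def)
  then obtain v where v: "\<And>j. j \<in> J \<Longrightarrow> v j \<in> V" "\<And>j. j \<in> J \<Longrightarrow> \<pi> (v j) = a j"
    "\<And>j. j \<in> J \<Longrightarrow> v j \<noteq> a (Suc j)" by metis
  have vY: "v j \<notin> Y" if j: "j \<in> J" for j
  proof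
    assume "v j \<in> Y"
    \<comment> \<open>Being on a lower level than \<open>a 0\<close> distinguishes
      \<open>v j\<close> from \<open>a 0\<close> and all its ancestors.\<close>
    have lv: "level (v j) < level (a 0)" using level_parent[OF v(1)[OF j]] v(2)[OF j] lev_a[of j] by simp
    from \<open>v j \<in> Y\<close> consider "v j \<in> (f ^^ n) ` V" | i where "v j = (\<pi> ^^ i) (a 0)" | i where "v j = a i"
      by (auto simp: Y_def)
    then show False
    proof cases
      case 1
      then have "\<pi> (v j) \<in> (f ^^ n) ` V" using I unfolding up_closed_def by blast
      then show False using aI v(2)[OF j] by simp
    next
      case 2
      then show False using lv level_pow[OF aV, of i 0] by simp
    next
      case 3
      then obtain i' where "i = Suc i'" using lv by (cases i) auto
      then show False using 3 pa[of i'] v(2,3)[OF j] ainj by simp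
    qed
  qed
  have "inj_on v J" by (rule inj_onI) (metis v(2) ainj)
  then have "infinite (v ` J)" using \<open>infinite J\<close> finite_imageD by blast
  moreover have "v ` J \<subseteq> {w \<in> V - Y. \<exists>u\<in>Y. {u, w} \<in> edges T}"
  proof (rule image_subsetI)
    fix j assume j: "j \<in> J"
    have "{a j, v j} \<in> edges T" using parent_edge[OF v(1)[OF j]] v(2)[OF j] by (simp add: insert_commute)
    moreover have "a j \<in> Y" by (simp add: Y_def)
    ultimately show "v j \<in> {w \<in> V - Y. \<exists>u\<in>Y. {u, w} \<in> edges T}" using v(1) vY j by blast
  qed
  ultimately have inf: "infinite {w \<in> V - Y. \<exists>u\<in>Y. {u, w} \<in> edges T}" using finite_subset by blast
  show ?thesis
    by (rule Sib_inf_boundary[OF t lf up_closed_tree[OF Y] _ fn _ inf])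
       (use Y in \<open>auto simp: up_closed_def Y_def\<close>)
qed

section \<open>Non-regular ends\<close>

lemma siblings_sym: "siblings S S' \<Longrightarrow> siblings S' S"
  by (auto simp: siblings_def)

lemma siblings_trans: "siblings S S' \<Longrightarrow> siblings S' S'' \<Longrightarrow> siblings S S''"
  unfolding siblings_def by (metis embedding_comp)

lemma parent_tail_eq: "tail_eq s r \<Longrightarrow> parent T s = parent T r"
proof -
  assume "tail_eq s r"
  then have "tail_eq x s \<longleftrightarrow> tail_eq x r" for x using tail_eq_trans tail_eq_sym by blast
  then show ?thesis by (simp add: parent_def[abs_def] ray_to_def)
qed

context ended_tree
begin

text \<open>Index shift: \<open>hang i\<close> is the vertex set of the tree hanging at \<open>r (Suc i)\<close>.\<close>

definition hang :: "nat \<Rightarrow> 'a set" where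
  "hang i = descendants (r (Suc i)) - descendants (r i)"

lemma descendants_parent: "v \<in> V \<Longrightarrow> \<pi> v \<in> descendants w \<Longrightarrow> v \<in> descendants w"
proof -
  assume v: "v \<in> V" "\<pi> v \<in> descendants w"
  then obtain n where "(\<pi> ^^ n) (\<pi> v) = w" by (auto simp: descendants_def)
  then have "(\<pi> ^^ Suc n) v = w" by (simp add: funpow_swap1)
  then show ?thesis using v(1) unfolding descendants_def by blast
qed

lemma r_descendants: "r n \<in> descendants (r i) \<longleftrightarrow> n \<le> i"
  using r_in_V ray_inj[OF tree ray] le_iff_add[of n i] by (auto simp: descendants_def parent_pow_r)

lemma hang_parent:
  assumes v: "v \<in> hang i" "v \<noteq> r (Suc i)"
  shows "\<pi> v \<in> hang i"
proof -
  obtain n where n: "(\<pi> ^^ n) v = r (Suc i)" and vV: "v \<in> V"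
    using v by (auto simp: hang_def descendants_def)
  then obtain m where "n = Suc m" using v(2) by (cases n) auto
  then have "(\<pi> ^^ m) (\<pi> v) = r (Suc i)" using n by (simp add: funpow_swap1)
  then have "\<pi> v \<in> descendants (r (Suc i))" using parent_V[OF vV] by (auto simp: descendants_def)
  then show ?thesis using v(1) descendants_parent[OF vV] by (auto simp: hang_def)
qed

lemma r_hang: "r n \<in> hang i \<longleftrightarrow> n = Suc i"
  by (auto simp: hang_def r_descendants)

lemma hang_disjoint:
  assumes "v \<in> hang i" "i < j"
  shows "v \<notin> hang j"
proof -
  obtain n where n: "(\<pi> ^^ n) v = r (Suc i)" and vV: "v \<in> V"
    using assms(1) by (auto simp: hang_def descendants_def)
  have "(\<pi> ^^ (j - Suc i + n)) v = r j"
    using pow_shift[OF n, of "j - Suc i"] assms(2) by (simp add: parent_pow_r)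
  then show ?thesis using vV by (auto simp: hang_def descendants_def)
qed

lemma hang_tree: "is_tree (induced T (hang i))"
proof (rule induced_tree[OF tree])
  show "hang i \<noteq> {}" using r_hang by blast
  show "hang i \<subseteq> V" by (auto simp: hang_def descendants_def)
  have *: "(v, r (Suc i)) \<in> (adj_rel (induced T (hang i)))\<^sup>*" if "v \<in> hang i" "(\<pi> ^^ n) v = r (Suc i)" for n v
    using that
  proof (induction n arbitrary: v)
    case (Suc n)
    show ?case
    proof (cases "v = r (Suc i)")
      case False
      have "(\<pi> ^^ n) (\<pi> v) = r (Suc i)" using Suc.prems(2) by (simp add: funpow_swap1)
      then have "(\<pi> v, r (Suc i)) \<in> (adj_rel (induced T (hang i)))\<^sup>*"
        by (rule Suc.IH[OF hang_parent[OF Suc.prems(1) False]])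
      moreover have "(v, \<pi> v) \<in> adj_rel (induced T (hang i))"
        using hang_parent[OF Suc.prems(1) False] Suc.prems(1) parent_edge[of v]
        by (auto simp: adj_rel_def hang_def descendants_def)
      ultimately show ?thesis by (rule converse_rtrancl_into_rtrancl[rotated])
    qed simp
  qed simp
  have *: "(v, r (Suc i)) \<in> (adj_rel (induced T (hang i)))\<^sup>*" if "v \<in> hang i" for v
  proof -
    obtain n where "(\<pi> ^^ n) v = r (Suc i)"
      using \<open>v \<in> hang i\<close> unfolding hang_def descendants_def by blast
    then show ?thesis using *[OF that] by blast
  qed
  show "(u, v) \<in> (adj_rel (induced T (hang i)))\<^sup>*" if "u \<in> hang i" "v \<in> hang i" for u v
    using *[OF that(1)] adj_rel_sym[OF *[OF that(2)]] by (rule rtrancl_trans)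
qed

text \<open>\<open>hang i\<close> can only be left through one of the two edges of the ray at
  \<open>r (Suc i)\<close>, so a connected subgraph that avoids the edges of the ray stays
  inside.\<close>

lemma hanging_tree_eq: "hanging_tree T (ray_graph r) (r (Suc i)) = induced T (hang i)"
proof -
  let ?R = "ray_graph r" and ?H = "induced T (hang i)"
  have H: "hanging_at T ?R (r (Suc i)) ?H"
  proof -
    have "{r n, r (Suc n)} \<notin> edges ?H" for n using r_hang[of n i] r_hang[of "Suc n" i] by auto
    then have "edges ?H \<inter> edges ?R = {}" by (auto simp: ray_graph_def)
    moreover have "subgraph ?H T" by (auto simp: subgraph_def induced_def hang_def descendants_def)
    ultimately show ?thesis using hang_tree r_hang by (simp add: hanging_at_def subtree_def)
  qed
  have max: "subgraph S ?H" if S: "hanging_at T ?R (r (Suc i)) S" for S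
  proof -
    have ST: "is_tree S" "subgraph S T" "r (Suc i) \<in> verts S" "edges S \<inter> edges ?R = {}"
      using S by (auto simp: hanging_at_def subtree_def)
    have "v \<in> hang i" if "v \<in> verts S" for v
    proof -
      have "(r (Suc i), v) \<in> (adj_rel S)\<^sup>*"
        using ST(1,3) that by (auto simp: is_tree_def graph_connected_def)
      then show ?thesis
      proof induction
        case base
        show ?case by (simp add: r_hang)
      next
        case (step u w)
        have e: "{u, w} \<in> edges S" using step(2) by (simp add: adj_rel_def)
        then have eT: "{u, w} \<in> edges T" using ST(2) by (auto simp: subgraph_def)
        have notR: "{u, w} \<noteq> {r n, r (Suc n)}" for n using e ST(4) by (auto simp: ray_graph_def)
        have wV: "u \<in> V" "w \<in> V" using tree_edge[OF tree eT] by auto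
        from edge_parent[OF eT] show ?case
        proof
          assume w: "w = \<pi> u"
          have "u \<noteq> r (Suc i)" using notR[of "Suc i"] parent_ray[OF ray, of "Suc i"] w by auto
          then show ?case using hang_parent[OF step.IH] w by simp
        next
          assume u: "u = \<pi> w"
          have "w \<in> descendants (r (Suc i))" using descendants_parent[OF wV(2)] step.IH u by (auto simp: hang_def)
          moreover have "w \<notin> descendants (r i)"
          proof
            assume "w \<in> descendants (r i)"
            then obtain n where n: "(\<pi> ^^ n) w = r i" by (auto simp: descendants_def)
            show False
            proof (cases n)
              case 0
              then have "w = r i" "u = r (Suc i)" using n u parent_ray[OF ray] by auto
              then show False using notR[of i] by (simp add: insert_commute)
            next
              case (Suc m)
              then have "(\<pi> ^^ m) u = r i" using n u by (simp add: funpow_swap1)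
              then show False using step.IH wV by (auto simp: hang_def descendants_def)
            qed
          qed
          ultimately show ?case by (simp add: hang_def)
        qed
      qed
    qed
    moreover have "e \<subseteq> verts S" if "e \<in> edges S" for e
      using ST(1) that by (auto simp: is_tree_def simple_graph_def)
    ultimately show ?thesis using ST(2) by (fastforce simp: subgraph_def induced_def)
  qed
  have anti: "S = S'" if "subgraph S S'" "subgraph S' S" for S S' :: "'a ugraph"
    using that by (auto simp: subgraph_def intro: ugraph.expand)
  show ?thesis
    unfolding hanging_tree_def by (rule the_equality) (use H max anti in blast)+
qed

text \<open>An injective map that commutes with the parent function preserves and reflects ancestry;
  \<open>sub\<close> supplies the preimages.\<close>

lemma hang_image:
  assumes f: "embedding T T f" "tail_eq (f \<circ> r) r" and ij: "f (r i) = r j" "f (r (Suc i)) = r (Suc j)"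
    and sub: "hang j \<subseteq> f ` V"
  shows "f ` hang i = hang j"
proof -
  have iff: "f v \<in> hang j \<longleftrightarrow> v \<in> hang i" if v: "v \<in> V" for v
  proof -
    have "(\<pi> ^^ n) (f v) = f w \<longleftrightarrow> (\<pi> ^^ n) v = w" if "w \<in> V" for n w
      unfolding embedding_parent_pow[OF f v, symmetric]
      using embedding_eq[OF f(1) parent_pow_V[OF v] that] .
    then show ?thesis
      using v embedding_verts[OF f(1) v] r_in_V unfolding hang_def descendants_def ij[symmetric] by simp
  qed
  have "hang i \<subseteq> V" by (auto simp: hang_def descendants_def)
  then show ?thesis using iff sub by blast
qed

text \<open>A vertex of \<open>hang j\<close> outside the image has a boundary vertex of the image
  above it, still in \<open>hang j\<close>. These sets are disjoint, so finitely many boundary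
  vertices affect only finitely many \<open>j\<close>.\<close>

lemma eventually_hang_image:
  assumes f: "embedding T T f" "tail_eq (f \<circ> r) r"
    and fin: "finite {v \<in> V - f ` V. \<exists>u\<in>f ` V. {u, v} \<in> edges T}"
  shows "\<forall>\<^sub>F j in sequentially. r (Suc j) \<in> f ` V \<longrightarrow> hang j \<subseteq> f ` V"
proof -
  let ?B = "{v \<in> V - f ` V. \<exists>u\<in>f ` V. {u, v} \<in> edges T}"
  have up: "up_closed (f ` V)" by (rule up_closed_image[OF f up_closed_V])
  have "\<forall>\<^sub>F j in sequentially. w \<notin> hang j" for w
  proof (cases "\<exists>i. w \<in> hang i")
    case True
    then obtain i where "w \<in> hang i" by blast
    then show ?thesis using hang_disjoint by (intro eventually_sequentiallyI[of "Suc i"]) auto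
  qed simp
  then have "\<forall>\<^sub>F j in sequentially. \<forall>w\<in>?B. w \<notin> hang j"
    by (intro eventually_ball_finite[OF fin] ballI)
  then show ?thesis
  proof (rule eventually_mono, intro impI subsetI)
    fix j u assume B: "\<forall>w\<in>?B. w \<notin> hang j" and rj: "r (Suc j) \<in> f ` V" and u: "u \<in> hang j"
    have uV: "u \<in> V" using u by (auto simp: hang_def descendants_def)
    show "u \<in> f ` V"
    proof (rule ccontr)
      assume "u \<notin> f ` V"
      then obtain n where n: "(\<pi> ^^ n) u \<notin> f ` V" "(\<pi> ^^ Suc n) u \<in> f ` V"
        by (rule exists_boundary[OF up uV])
      have "{(\<pi> ^^ Suc n) u, (\<pi> ^^ n) u} \<in> edges T"
        using parent_edge[OF parent_pow_V[OF uV], of n] by (simp add: insert_commute)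
      then have "(\<pi> ^^ n) u \<in> ?B" using n parent_pow_V[OF uV] by blast
      \<comment> \<open>The way up to the boundary vertex does not pass \<open>r (Suc j)\<close>,
        since everything above that vertex is in the image.\<close>
      moreover have "(\<pi> ^^ m) u \<in> hang j" if "m \<le> n" for m
        using that
      proof (induction m)
        case (Suc m)
        have "(\<pi> ^^ m) u \<noteq> r (Suc j)"
        proof
          assume "(\<pi> ^^ m) u = r (Suc j)"
          then have "(\<pi> ^^ (n - m)) ((\<pi> ^^ m) u) \<in> f ` V" using up_closed_pow[OF up rj] by simp
          moreover have "(\<pi> ^^ (n - m)) ((\<pi> ^^ m) u) = (\<pi> ^^ n) u"
            using pow_shift[of m u "(\<pi> ^^ m) u" "n - m"] Suc.prems by simp
          ultimately show False using n(1) by simp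
        qed
        then show ?case using hang_parent Suc by simp
      qed (simp add: u)
      ultimately show False using B by blast
    qed
  qed
qed

lemma siblings_hang:
  assumes f: "embedding T T f" and img: "f ` hang i = hang j"
  shows "siblings (induced T (hang i)) (induced T (hang j))"
proof -
  have "hang i \<subseteq> V" by (auto simp: hang_def descendants_def)
  then have "embedding (induced T (hang i)) (induced T (hang j)) f"
    using f img embedding_edge[OF tree f] by (auto simp: embedding_def intro: inj_on_subset)
  moreover from this have "isomorphic (induced T (hang i)) (induced T (hang j))"
    by (rule isomorphic_embedding[OF hang_tree hang_tree]) (simp add: img)
  ultimately show ?thesis
    using isomorphic_obtain[OF hang_tree hang_tree] hang_tree unfolding siblings_def by metis
qed

text \<open>The rays \<open>s\<close> and \<open>r\<close> share a tail and hence the hanging sets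
  along it. The sequence of classes along \<open>s\<close> is therefore eventually periodic and
  takes finitely many values.\<close>

lemma regular_ray_if_periodic:
  assumes per: "\<And>i. i \<ge> i0 \<Longrightarrow> siblings (induced T (hang i)) (induced T (hang (i + k)))" and k: "k > 0"
    and s: "ray T s" "tail_eq s r"
  shows "regular_ray T (ray_graph s)"
proof -
  let ?sib = "{(S :: 'a ugraph, S' :: 'a ugraph). siblings S S'}"
  interpret S: ended_tree T s by unfold_locales (fact tree, fact s)
  obtain a b where ab: "\<And>n. s (a + n) = r (b + n)" using s(2) unfolding tail_eq_def by metis
  have SH: "S.hang (a + n) = hang (b + n)" for n
    using ab[of n] ab[of "Suc n"]
    by (simp add: S.hang_def hang_def S.descendants_def descendants_def parent_tail_eq[OF s(2)])
  define c where "c n = ?sib `` {hanging_tree T (ray_graph s) (s n)}" for n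
  \<comment> \<open>The successor accounts for \<open>hang i\<close> being attached at index
    \<open>Suc i\<close>.\<close>
  define n0 where "n0 = Suc (a + i0)"
  have c: "c (n + k) = c n" if "n \<ge> n0" for n
  proof -
    define i where "i = n - Suc a"
    have n: "n = Suc (a + i)" "i \<ge> i0" using that by (auto simp: i_def n0_def)
    then have "siblings (induced T (hang (b + i))) (induced T (hang (b + i + k)))" by (intro per) simp
    then have "siblings (hanging_tree T (ray_graph s) (s n)) (hanging_tree T (ray_graph s) (s (n + k)))"
      using S.hanging_tree_eq[of "a + i"] S.hanging_tree_eq[of "a + (i + k)"] SH[of i] SH[of "i + k"]
      by (simp add: n add.assoc)
    then show ?thesis unfolding c_def using siblings_trans siblings_sym by blast
  qed
  have "c n \<in> c ` {..<n0 + k}" for n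
  proof (induction n rule: less_induct)
    case (less n)
    show ?case
    proof (cases "n < n0 + k")
      case False
      then have "c n = c (n - k)" using c[of "n - k"] by simp
      then show ?thesis using less[of "n - k"] False k by simp
    qed simp
  qed
  then have "finite (range c)" by (meson finite_imageI finite_lessThan finite_subset image_subsetI)
  moreover have "hanging_tree T (ray_graph s) ` verts (ray_graph s) // ?sib = range c"
    by (auto simp: quotient_def c_def ray_graph_def)
  ultimately show ?thesis by (simp add: regular_ray_def)
qed

end

text \<open>Finitely many siblings would leave the image of \<open>f\<close> only finitely many
  boundary vertices. Far out on the ray the classes of hanging trees would then repeat with the
  shift of \<open>f\<close> as period, making every ray of the end regular.\<close>

lemma nonregular_Sib_inf:
  assumes t: "is_tree T" and lf: "locally_finite T" and \<eta>: "\<eta> \<in> Ends T" "nonregular_end T \<eta>"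
    and f: "embedding T T f" and ne: "\<not> elliptic T f"
    and pres: "preserves_forward f \<eta> \<or> preserves_backward f \<eta>"
  shows "Sib T = \<infinity>"
proof (rule ccontr)
  assume nS: "Sib T \<noteq> \<infinity>"
  obtain x where x: "ray T x" "\<eta> = end_of T x" using \<eta>(1) Ends_eq[OF t] by auto
  have mem: "\<exists>r. ray T r \<and> tail_eq x r \<and> R = ray_graph r" if "R \<in> \<eta>" for R
    using that in_end_of[OF t x(1)] x(2) by auto
  have inj: "inj r" "inj (f \<circ> r)" if "ray T r" for r
    using ray_inj_iff[OF t] that ray_embedding[OF t f that] by auto
  \<comment> \<open>In both cases the inclusion between a ray and its image is a shift of indices;
    its length \<open>k\<close> becomes the period.\<close>
  have "\<exists>r k. ray T r \<and> tail_eq x r \<and> ((\<forall>n. f (r n) = r (k + n)) \<or> (\<forall>n. f (r (k + n)) = r n))"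
    using pres
  proof
    assume "preserves_forward f \<eta>"
    then obtain r where r: "ray T r" "tail_eq x r" "subgraph (ray_graph (f \<circ> r)) (ray_graph r)"
      using mem unfolding preserves_forward_def by (metis image_ray_graph)
    from ray_graph_subgraph[OF inj(2)[OF r(1)] inj(1)[OF r(1)] r(3)] r(1,2) show ?thesis
      by (metis comp_apply)
  next
    assume "preserves_backward f \<eta>"
    then obtain r where r: "ray T r" "tail_eq x r" "subgraph (ray_graph r) (ray_graph (f \<circ> r))"
      using mem unfolding preserves_backward_def by (metis image_ray_graph)
    from ray_graph_subgraph[OF inj(1)[OF r(1)] inj(2)[OF r(1)] r(3)] r(1,2) show ?thesis
      by (metis comp_apply)
  qed
  then obtain r k where r: "ray T r" "tail_eq x r"
    and fr: "(\<forall>n. f (r n) = r (k + n)) \<or> (\<forall>n. f (r (k + n)) = r n)" by blast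
  interpret ended_tree T r by unfold_locales (fact t, fact r)
  have k: "k > 0"
  proof (rule ccontr)
    assume "\<not> k > 0"
    then have "f (r 0) = r 0" using fr by auto
    then show False using elliptic_fixed[OF t r_in_V] ne by blast
  qed
  have fx: "tail_eq (f \<circ> r) r"
    using fr unfolding tail_eq_def comp_def by (metis add_0)
  have up: "up_closed (f ` V)" by (rule up_closed_image[OF f fx up_closed_V])
  have fin: "finite {v \<in> V - f ` V. \<exists>u\<in>f ` V. {u, v} \<in> edges T}"
    using Sib_inf_boundary[OF t lf up_closed_tree[OF up] _ f] up nS by (auto simp: up_closed_def)
  obtain i0 where i0: "\<And>j. j \<ge> i0 \<Longrightarrow> r (Suc j) \<in> f ` V \<Longrightarrow> hang j \<subseteq> f ` V"
    using eventually_hang_image[OF f fx fin] unfolding eventually_sequentially by blast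
  have "siblings (induced T (hang i)) (induced T (hang (i + k)))" if i: "i \<ge> i0" for i
    using fr
  proof
    assume fr: "\<forall>n. f (r n) = r (k + n)"
    have 1: "f (r i) = r (i + k)" "f (r (Suc i)) = r (Suc (i + k))" using fr by (simp_all add: add.commute)
    have "f ` hang i = hang (i + k)"
      by (rule hang_image[OF f fx 1 i0]) (use i 1 r_in_V in \<open>auto intro: image_eqI[OF sym]\<close>)
    then show ?thesis by (rule siblings_hang[OF f])
  next
    assume fr: "\<forall>n. f (r (k + n)) = r n"
    have 1: "f (r (i + k)) = r i" "f (r (Suc (i + k))) = r (Suc i)"
      using fr[rule_format, of i] fr[rule_format, of "Suc i"] by (simp_all add: add.commute)
    have "f ` hang (i + k) = hang i"
      by (rule hang_image[OF f fx 1 i0]) (use i 1 r_in_V in \<open>auto intro: image_eqI[OF sym]\<close>)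
    then show ?thesis by (rule siblings_sym[OF siblings_hang[OF f]])
  qed
  then have "regular_ray T (ray_graph s)" if "ray T s" "tail_eq s r" for s
    using regular_ray_if_periodic k that by blast
  moreover obtain s where "ray T s" "tail_eq x s" "\<not> regular_ray T (ray_graph s)"
    using \<eta>(2) mem unfolding nonregular_end_def by blast
  ultimately show False using r(2) tail_eq_trans tail_eq_sym by blast
qed

theorem theorem3p13:
  fixes T :: "'a ugraph" and M :: "('a \<Rightarrow> 'a) set"
  assumes "is_tree T" and "locally_finite T" and "M = Emb T"
  shows "(directions T M = {} \<or> card (directions T M) = 2 \<longrightarrow> Sib T = 1) \<and>
    (card (directions T M) = 1 \<longrightarrow> Sib T = 1 \<or> Sib T = \<infinity>) \<and>
    (infinite (directions T M) \<and>
      ((\<exists>f\<in>M. parabolic T f) \<or>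
       (\<exists>\<eta>\<in>Ends T. nonregular_end T \<eta> \<and>
          (\<exists>f\<in>M. \<not> elliptic T f \<and> (preserves_forward f \<eta> \<or> preserves_backward f \<eta>))))
      \<longrightarrow> Sib T = \<infinity>)"
proof -
  have M: "embedding T T f" if "f \<in> M" for f using that assms(3) by (simp add: Emb_def)
  have "Sib T = 1" if "directions T M = {} \<or> card (directions T M) = 2"
    by (rule Sib_eq_1_surj[OF assms(1)])
       (use that no_direction_surj[OF assms(1,2)] two_directions_surj[OF assms(1,2)] assms(3) in blast)
  moreover have "Sib T = 1 \<or> Sib T = \<infinity>" if "card (directions T M) = 1"
    using that unfolding assms(3) by (rule one_direction_Sib[OF assms(1,2)])
  moreover have "Sib T = \<infinity>" if "infinite (directions T M)" "\<exists>f\<in>M. parabolic T f"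
    using parabolic_Sib_inf[OF assms(1,2)] that M unfolding assms(3) by blast
  moreover have "Sib T = \<infinity>" if "\<exists>\<eta>\<in>Ends T. nonregular_end T \<eta> \<and>
      (\<exists>f\<in>M. \<not> elliptic T f \<and> (preserves_forward f \<eta> \<or> preserves_backward f \<eta>))"
    using nonregular_Sib_inf[OF assms(1,2)] that M by blast
  ultimately show ?thesis by blast
qed

end
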